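(* Let $p$ be a prime. For every $\tau>2$, $W(\tau)$ is a Salem set in $\mathbb{Q}_p$ with Hausdorff dimension and Fourier dimension both equal to $2/\tau$, i.e. $\dim_H W(\tau)=\dim_F W(\tau)=2/\tau$. Moreover, there exists a Borel probability measure $\mu$ supported on $W(\tau)$ such that $$|\widehat{\mu}(\xi)|\lesssim |\xi|_p^{-1/\tau}\,\ln^2(1+|\xi|_p)\qquad\text{for all }\xi\in\mathbb{Q}_p,\ \xi\neq 0 .$$
   Context: $X\lesssim Y$ means $X\le CY$ for some positive constant $C$ whose value may depend on $p$, but not on any other parameters. $|\cdot|_p$ is the $p$-adic absolute value on $\mathbb{Q}_p$ (normalized by $|p|_p=p^{-1}$), $\mathbb{Z}_p=\{x\in\mathbb{Q}_p:|x|_p\le 1\}$, and $|\cdot|$ is the usual absolute value on $\mathbb{Z}$. For $\tau\in\mathbb{R}$, $$W(\tau)=\{x\in\mathbb{Z}_p: |xq-r|_p\le \max(|q|,|r|)^{-\tau}\text{ for infinitely many }(q,r)\in\mathbb{Z}^2\}.$$ For $x\in\mathbb{Q}_p$ with $p$-adic expansion $x=\sum_{j\ge M}c_jp^j$, $c_j\in\{0,\dots,p-1\}$, the fractional part is $\{x\}_p=\sum_{M\le j\le -1}c_jp^j\in\mathbb{Q}\cap[0,1)$, and $e(t)=e^{2\pi i t}$. For a finite Borel measure $\mu$ on $\mathbb{Q}_p$, $\widehat\mu(\xi)=\int_{\mathbb{Q}_p}e(\{x\xi\}_p)\,d\mu(x)$. A measure is supported on $A$ if its (closed) support is contained in $A$.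 $\dim_H$ is Hausdorff dimension with respect to the metric $|x-y|_p$. For $A\subseteq\mathbb{Q}_p$, the Fourier dimension is $$\dim_F(A)=\sup\Big\{0\le\beta\le 1:\ \sup_{0\ne\xi\in\mathbb{Q}_p}|\widehat\mu(\xi)|^2|\xi|_p^{\beta}<\infty\text{ for some }\mu\in\mathcal{P}(A)\Big\},$$ where $\mathcal{P}(A)$ is the set of Borel probability measures on $\mathbb{Q}_p$ with compact support in $A$. A set $A$ is a Salem set if $\dim_H(A)=\dim_F(A)$. $\ln^2(t)$ means $(\ln t)^2$.
   Formalization: The decay bound is asserted for all ξ with |ξ|_p ≥ 1 instead of all ξ ≠ 0: since μ lives on Z_p, its transform equals 1 for |ξ|_p ≤ 1, while the right-hand side tends to 0 as ξ → 0, so the printed bound fails near 0. *)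

theory Defs
  imports "HOL-Probability.Probability" "Berlekamp_Zassenhaus.Finite_Field"
begin

section \<open>The \<open>p\<close>-adic absolute value on the rationals\<close>

definition rat_pval :: "nat \<Rightarrow> rat \<Rightarrow> int" where
  "rat_pval p r = int (multiplicity (int p) (fst (quotient_of r)))
                - int (multiplicity (int p) (snd (quotient_of r)))"

definition rat_pabs :: "nat \<Rightarrow> rat \<Rightarrow> real" where
  "rat_pabs p r = (if r = 0 then 0 else real p powi (- rat_pval p r))"

lemma rat_pabs_0 [simp]: "rat_pabs p 0 = 0"
  by (simp add: rat_pabs_def)

lemma rat_pabs_nonneg [simp]: "0 \<le> rat_pabs p r"
  by (simp add: rat_pabs_def)

lemma rat_pabs_eq_0_iff [simp]: "prime p \<Longrightarrow> rat_pabs p r = 0 \<longleftrightarrow> r = 0"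
  by (auto simp: rat_pabs_def prime_gt_0_nat)

lemma rat_pabs_fraction:
  assumes p: "prime p" and ab: "a \<noteq> 0" "b \<noteq> 0"
  shows "rat_pabs p (of_int a / of_int b)
       = real p powi (int (multiplicity (int p) b) - int (multiplicity (int p) a))"
proof -
  obtain c d where cd: "quotient_of (of_int a / of_int b) = (c, d)"
    by force
  have d: "d \<noteq> 0"
    using quotient_of_denom_pos[OF cd] by simp
  have eq: "(of_int a / of_int b :: rat) = of_int c / of_int d"
    using quotient_of_div[OF cd] .
  have c: "c \<noteq> 0"
    using eq ab by auto
  have "(of_int (a * d) :: rat) = of_int (c * b)"
    using eq ab d by (simp add: field_simps)
  hence "a * d = c * b"
    by (simp only: of_int_eq_iff)
  hence "multiplicity (int p) (a * d) = multiplicity (int p) (c * b)"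
    by simp
  moreover have "prime_elem (int p)"
    using p by auto
  ultimately have "multiplicity (int p) a + multiplicity (int p) d
      = multiplicity (int p) c + multiplicity (int p) b"
    using ab c d by (simp add: prime_elem_multiplicity_mult_distrib)
  hence "int (multiplicity (int p) d) - int (multiplicity (int p) c)
      = int (multiplicity (int p) b) - int (multiplicity (int p) a)"
    by linarith
  thus ?thesis
    using ab by (simp add: rat_pabs_def rat_pval_def cd)
qed

lemma rat_pabs_mult:
  assumes p: "prime p"
  shows "rat_pabs p (r * s) = rat_pabs p r * rat_pabs p s"
proof (cases "r = 0 \<or> s = 0")
  case False
  obtain a b where r: "r = of_int a / of_int b" "b \<noteq> 0"
    by (metis quotient_of_div quotient_of_denom_pos surj_pair less_irrefl)
  obtain c d where s: "s = of_int c / of_int d" "d \<noteq> 0"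
    by (metis quotient_of_div quotient_of_denom_pos surj_pair less_irrefl)
  have nz: "a \<noteq> 0" "c \<noteq> 0"
    using False r s by auto
  have pe: "prime_elem (int p)"
    using p by auto
  have p0: "real p \<noteq> 0"
    using p prime_gt_0_nat by auto
  have "r * s = of_int (a * c) / of_int (b * d)"
    by (simp add: r s)
  hence "rat_pabs p (r * s) = real p powi (int (multiplicity (int p) (b * d))
      - int (multiplicity (int p) (a * c)))"
    using rat_pabs_fraction[OF p, of "a * c" "b * d"] nz r s by simp
  also have "\<dots> = rat_pabs p r * rat_pabs p s"
    using nz r s p0 pe
    by (simp add: rat_pabs_fraction[OF p] prime_elem_multiplicity_mult_distrib
        flip: power_int_add) (simp add: algebra_simps)
  finally show ?thesis .
qed auto

lemma rat_pabs_1 [simp]: "prime p \<Longrightarrow> rat_pabs p 1 = 1"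
  by (simp add: rat_pabs_def rat_pval_def)

lemma rat_pabs_minus [simp]: "rat_pabs p (- r) = rat_pabs p r"
proof -
  have "multiplicity (int p) (- a) = multiplicity (int p) a" for a
    by (simp add: multiplicity_def)
  thus ?thesis
    by (simp add: rat_pabs_def rat_pval_def rat_uminus_code Let_def case_prod_beta)
qed

lemma rat_pabs_inverse: "prime p \<Longrightarrow> rat_pabs p (inverse r) = inverse (rat_pabs p r)"
proof (cases "r = 0")
  case False
  assume p: "prime p"
  have "rat_pabs p r * rat_pabs p (inverse r) = 1"
    using False p by (simp flip: rat_pabs_mult)
  thus ?thesis
    by (metis inverse_unique)
qed auto

lemma rat_pabs_ultra:
  assumes p: "prime p"
  shows "rat_pabs p (r + s) \<le> max (rat_pabs p r) (rat_pabs p s)"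
proof (cases "r = 0 \<or> s = 0 \<or> r + s = 0")
  case False
  obtain a b where r: "r = of_int a / of_int b" "b \<noteq> 0"
    by (metis quotient_of_div quotient_of_denom_pos surj_pair less_irrefl)
  obtain c d where s: "s = of_int c / of_int d" "d \<noteq> 0"
    by (metis quotient_of_div quotient_of_denom_pos surj_pair less_irrefl)
  let ?m = "multiplicity (int p)"
  have r': "r = of_int (a * d) / of_int (b * d)" and s': "s = of_int (c * b) / of_int (b * d)"
    and rs': "r + s = of_int (a * d + c * b) / of_int (b * d)"
    using r s by (auto simp: field_simps)
  have nz: "a * d \<noteq> 0" "c * b \<noteq> 0" "b * d \<noteq> 0" "a * d + c * b \<noteq> 0"
  proof -
    show "a * d \<noteq> 0" "c * b \<noteq> 0" "b * d \<noteq> 0"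
      using False r s by auto
    show "a * d + c * b \<noteq> 0"
    proof
      assume "a * d + c * b = 0"
      hence "r + s = 0"
        by (simp only: rs' of_int_0 div_0)
      thus False
        using False by simp
    qed
  qed
  have "int p ^ min (?m (a * d)) (?m (c * b)) dvd a * d + c * b"
    by (intro dvd_add multiplicity_dvd') auto
  hence "min (?m (a * d)) (?m (c * b)) \<le> ?m (a * d + c * b)"
    using nz p by (intro multiplicity_geI) (auto simp: not_prime_unit prime_gt_1_nat
      dest: prime_gt_1_nat)
  moreover have "real p \<ge> 1"
    using prime_gt_1_nat[OF p] by simp
  moreover have "rat_pabs p r = real p powi (int (?m (b * d)) - int (?m (a * d)))"
    "rat_pabs p s = real p powi (int (?m (b * d)) - int (?m (c * b)))"
    "rat_pabs p (r + s) = real p powi (int (?m (b * d)) - int (?m (a * d + c * b)))"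
    by (subst r', intro rat_pabs_fraction p nz)
       (subst s', intro rat_pabs_fraction p nz, subst rs', intro rat_pabs_fraction p nz)
  ultimately show ?thesis
    by (simp only: le_max_iff_disj min_le_iff_disj) (auto intro!: power_int_increasing)
qed (auto simp: le_max_iff_disj)

lemma rat_pabs_triangle:
  "prime p \<Longrightarrow> rat_pabs p (r + s) \<le> rat_pabs p r + rat_pabs p s"
  using rat_pabs_ultra[of p r s] rat_pabs_nonneg[of p r] rat_pabs_nonneg[of p s] by linarith

lemma rat_pabs_diff_commute: "rat_pabs p (r - s) = rat_pabs p (s - r)"
  by (metis minus_diff_eq rat_pabs_minus)

lemma rat_pabs_diff_le:
  "prime p \<Longrightarrow> \<bar>rat_pabs p r - rat_pabs p s\<bar> \<le> rat_pabs p (r - s)"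
  using rat_pabs_triangle[of p "r - s" s] rat_pabs_triangle[of p "s - r" r]
  by (simp add: rat_pabs_diff_commute abs_le_iff)


section \<open>Cauchy sequences of rationals for the \<open>p\<close>-adic absolute value\<close>

definition pvanishes :: "nat \<Rightarrow> (nat \<Rightarrow> rat) \<Rightarrow> bool" where
  "pvanishes p X \<longleftrightarrow> (\<lambda>n. rat_pabs p (X n)) \<longlonglongrightarrow> 0"

definition pcauchy :: "nat \<Rightarrow> (nat \<Rightarrow> rat) \<Rightarrow> bool" where
  "pcauchy p X \<longleftrightarrow> (\<forall>e>0. \<exists>k. \<forall>m\<ge>k. \<forall>n\<ge>k. rat_pabs p (X m - X n) < e)"

lemma pvanishes_const [simp]: "prime p \<Longrightarrow> pvanishes p (\<lambda>n. c) \<longleftrightarrow> c = 0"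
  by (auto simp: pvanishes_def LIMSEQ_const_iff)

lemma pvanishes_le:
  assumes "pvanishes p X" "\<And>n. rat_pabs p (Y n) \<le> K * rat_pabs p (X n)"
  shows "pvanishes p Y"
  unfolding pvanishes_def
proof (rule tendsto_sandwich[OF _ _ tendsto_const])
  show "(\<lambda>n. K * rat_pabs p (X n)) \<longlonglongrightarrow> 0"
    using assms(1) tendsto_mult_right_zero by (auto simp: pvanishes_def)
qed (use assms in auto)

lemma pvanishes_minus: "pvanishes p X \<Longrightarrow> pvanishes p (\<lambda>n. - X n)"
  by (simp add: pvanishes_def)

lemma pvanishes_add:
  assumes "prime p" "pvanishes p X" "pvanishes p Y"
  shows "pvanishes p (\<lambda>n. X n + Y n)"
  unfolding pvanishes_def
proof (rule tendsto_sandwich[OF _ _ tendsto_const])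
  show "(\<lambda>n. rat_pabs p (X n) + rat_pabs p (Y n)) \<longlonglongrightarrow> 0"
    using assms(2,3) tendsto_add_zero by (auto simp: pvanishes_def)
qed (use assms rat_pabs_triangle in auto)

lemma pcauchy_const [simp]: "pcauchy p (\<lambda>n. c)"
  by (simp add: pcauchy_def)

lemma pcauchy_minus [simp]: "pcauchy p X \<Longrightarrow> pcauchy p (\<lambda>n. - X n)"
  unfolding pcauchy_def minus_diff_minus rat_pabs_minus .

lemma pcauchy_add:
  assumes p: "prime p" and X: "pcauchy p X" and Y: "pcauchy p Y"
  shows "pcauchy p (\<lambda>n. X n + Y n)"
  unfolding pcauchy_def
proof safe
  fix e :: real assume "e > 0"
  then obtain i j where ij: "\<forall>m\<ge>i. \<forall>n\<ge>i. rat_pabs p (X m - X n) < e"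
      "\<forall>m\<ge>j. \<forall>n\<ge>j. rat_pabs p (Y m - Y n) < e"
    using X Y unfolding pcauchy_def by metis
  show "\<exists>k. \<forall>m\<ge>k. \<forall>n\<ge>k. rat_pabs p (X m + Y m - (X n + Y n)) < e"
  proof (intro exI[of _ "max i j"] allI impI)
    fix m n assume "max i j \<le> m" "max i j \<le> n"
    hence "max (rat_pabs p (X m - X n)) (rat_pabs p (Y m - Y n)) < e"
      using ij by auto
    thus "rat_pabs p (X m + Y m - (X n + Y n)) < e"
      using rat_pabs_ultra[OF p, of "X m - X n" "Y m - Y n"]
      by (simp add: algebra_simps) linarith
  qed
qed

lemma pcauchy_bounded:
  assumes p: "prime p" and X: "pcauchy p X"
  shows "\<exists>b>0. \<forall>n. rat_pabs p (X n) \<le> b"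
proof -
  obtain k where k: "\<forall>m\<ge>k. \<forall>n\<ge>k. rat_pabs p (X m - X n) < 1"
    using X zero_less_one unfolding pcauchy_def by blast
  let ?M = "\<Sum>i\<le>k. rat_pabs p (X i)"
  have le: "rat_pabs p (X i) \<le> ?M" if "i \<le> k" for i
    using that by (intro member_le_sum) auto
  have "rat_pabs p (X n) \<le> ?M + 1" for n
  proof (cases "n \<le> k")
    case False
    have "rat_pabs p (X n) \<le> rat_pabs p (X n - X k) + rat_pabs p (X k)"
      using rat_pabs_triangle[OF p, of "X n - X k" "X k"] by simp
    moreover have "rat_pabs p (X n - X k) < 1"
      using k False by simp
    ultimately show ?thesis
      using le[of k] by linarith
  qed (use le in fastforce)
  moreover have "?M + 1 > 0"
    by (simp add: add_nonneg_pos sum_nonneg)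
  ultimately show ?thesis
    by blast
qed

lemma pcauchy_mult:
  assumes p: "prime p" and X: "pcauchy p X" and Y: "pcauchy p Y"
  shows "pcauchy p (\<lambda>n. X n * Y n)"
  unfolding pcauchy_def
proof safe
  fix e :: real assume e: "e > 0"
  obtain a where a: "a > 0" "\<And>n. rat_pabs p (X n) \<le> a"
    using pcauchy_bounded[OF p X] by blast
  obtain b where b: "b > 0" "\<And>n. rat_pabs p (Y n) \<le> b"
    using pcauchy_bounded[OF p Y] by blast
  obtain i where i: "\<forall>m\<ge>i. \<forall>n\<ge>i. rat_pabs p (X m - X n) < e / b"
    using X e b unfolding pcauchy_def by (meson divide_pos_pos)
  obtain j where j: "\<forall>m\<ge>j. \<forall>n\<ge>j. rat_pabs p (Y m - Y n) < e / a"
    using Y e a unfolding pcauchy_def by (meson divide_pos_pos)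
  show "\<exists>k. \<forall>m\<ge>k. \<forall>n\<ge>k. rat_pabs p (X m * Y m - X n * Y n) < e"
  proof (intro exI[of _ "max i j"] allI impI)
    fix m n assume mn: "max i j \<le> m" "max i j \<le> n"
    have "rat_pabs p (X m) * rat_pabs p (Y m - Y n) < e"
    proof -
      have "rat_pabs p (X m) * rat_pabs p (Y m - Y n) \<le> a * rat_pabs p (Y m - Y n)"
        using a by (intro mult_right_mono) auto
      also have "\<dots> < a * (e / a)"
        using j mn a by (intro mult_strict_left_mono) auto
      finally show ?thesis using a by simp
    qed
    moreover have "rat_pabs p (X m - X n) * rat_pabs p (Y n) < e"
    proof -
      have "rat_pabs p (X m - X n) * rat_pabs p (Y n) \<le> rat_pabs p (X m - X n) * b"
        using b by (intro mult_left_mono) auto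
      also have "\<dots> < (e / b) * b"
        using i mn b by (intro mult_strict_right_mono) auto
      finally show ?thesis using b by simp
    qed
    ultimately show "rat_pabs p (X m * Y m - X n * Y n) < e"
      using rat_pabs_ultra[OF p, of "X m * (Y m - Y n)" "(X m - X n) * Y n"]
      by (simp add: rat_pabs_mult[OF p] mult_diff_mult)
  qed
qed

lemma pcauchy_convergent:
  assumes p: "prime p" and X: "pcauchy p X"
  shows "convergent (\<lambda>n. rat_pabs p (X n))"
proof -
  have "Cauchy (\<lambda>n. rat_pabs p (X n))"
  proof (rule CauchyI)
    fix e :: real assume "e > 0"
    then obtain k where "\<forall>m\<ge>k. \<forall>n\<ge>k. rat_pabs p (X m - X n) < e"
      using X unfolding pcauchy_def by blast
    thus "\<exists>k. \<forall>m\<ge>k. \<forall>n\<ge>k. norm (rat_pabs p (X m) - rat_pabs p (X n)) < e"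
      by (metis le_less_trans rat_pabs_diff_le[OF p] real_norm_def)
  qed
  thus ?thesis
    by (simp add: Cauchy_convergent_iff)
qed

lemma pcauchy_not_vanishes:
  assumes p: "prime p" and X: "pcauchy p X" and nv: "\<not> pvanishes p X"
  shows "\<exists>b>0. \<exists>k. \<forall>n\<ge>k. b < rat_pabs p (X n)"
proof -
  obtain L where L: "(\<lambda>n. rat_pabs p (X n)) \<longlonglongrightarrow> L"
    using pcauchy_convergent[OF p X] by (auto simp: convergent_def)
  have "L \<ge> 0"
    using L by (rule LIMSEQ_le_const) auto
  moreover have "L \<noteq> 0"
    using nv L by (auto simp: pvanishes_def)
  ultimately have "L > 0" by simp
  hence "\<forall>\<^sub>F n in sequentially. rat_pabs p (X n) > L / 2"
    by (intro order_tendstoD(1)[OF L]) auto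
  thus ?thesis
    using \<open>L > 0\<close> unfolding eventually_sequentially by (intro exI[of _ "L / 2"]) auto
qed

lemma pcauchy_inverse:
  assumes p: "prime p" and X: "pcauchy p X" and nv: "\<not> pvanishes p X"
  shows "pcauchy p (\<lambda>n. inverse (X n))"
  unfolding pcauchy_def
proof safe
  fix e :: real assume e: "e > 0"
  obtain b i where b: "b > 0" "\<And>n. n \<ge> i \<Longrightarrow> b < rat_pabs p (X n)"
    using pcauchy_not_vanishes[OF assms] by blast
  obtain j where j: "\<forall>m\<ge>j. \<forall>n\<ge>j. rat_pabs p (X m - X n) < b * e * b"
    using X e b unfolding pcauchy_def by (meson mult_pos_pos)
  show "\<exists>k. \<forall>m\<ge>k. \<forall>n\<ge>k. rat_pabs p (inverse (X m) - inverse (X n)) < e"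
  proof (intro exI[of _ "max i j"] allI impI)
    fix m n assume mn: "max i j \<le> m" "max i j \<le> n"
    have gt: "b < rat_pabs p (X m)" "b < rat_pabs p (X n)"
      using b mn by auto
    hence nz: "X m \<noteq> 0" "X n \<noteq> 0"
      using b by auto
    have "rat_pabs p (inverse (X m) - inverse (X n))
        = inverse (rat_pabs p (X m)) * rat_pabs p (X m - X n) * inverse (rat_pabs p (X n))"
      using p nz by (simp add: inverse_diff_inverse rat_pabs_mult rat_pabs_inverse)
    also have "\<dots> \<le> inverse b * rat_pabs p (X m - X n) * inverse b"
      using gt b by (intro mult_mono) (auto simp: le_imp_inverse_le)
    also have "\<dots> < inverse b * (b * e * b) * inverse b"
      using j mn b by (intro mult_strict_right_mono mult_strict_left_mono) auto
    also have "\<dots> = e"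
      using b(1) by (simp add: field_simps)
    finally show "rat_pabs p (inverse (X m) - inverse (X n)) < e" .
  qed
qed

lemma pvanishes_mult:
  assumes p: "prime p" and X: "pcauchy p X" and Y: "pvanishes p Y"
  shows "pvanishes p (\<lambda>n. X n * Y n)"
proof -
  obtain b where b: "b > 0" "\<And>n. rat_pabs p (X n) \<le> b"
    using pcauchy_bounded[OF p X] by blast
  show ?thesis
    by (rule pvanishes_le[OF Y, of _ b]) (auto simp: rat_pabs_mult[OF p] b intro!: mult_right_mono)
qed

lemma pvanishes_diff_inverse:
  assumes p: "prime p" and X: "pcauchy p X" "\<not> pvanishes p X"
    and Y: "pcauchy p Y" "\<not> pvanishes p Y" and XY: "pvanishes p (\<lambda>n. X n - Y n)"
  shows "pvanishes p (\<lambda>n. inverse (X n) - inverse (Y n))"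
proof -
  have 1: "pvanishes p (\<lambda>n. - (inverse (X n) * (inverse (Y n) * (X n - Y n))))"
    by (intro pvanishes_minus pvanishes_mult pcauchy_inverse assms)
  have "\<forall>\<^sub>F n in sequentially. X n \<noteq> 0" "\<forall>\<^sub>F n in sequentially. Y n \<noteq> 0"
    using pcauchy_not_vanishes[OF p X] pcauchy_not_vanishes[OF p Y]
    by (force simp: eventually_sequentially)+
  hence "\<forall>\<^sub>F n in sequentially. rat_pabs p (- (inverse (X n) * (inverse (Y n) * (X n - Y n))))
      = rat_pabs p (inverse (X n) - inverse (Y n))"
    by eventually_elim (simp add: inverse_diff_inverse mult_ac)
  thus ?thesis
    using 1 unfolding pvanishes_def by (rule Lim_transform_eventually[rotated])
qed


section \<open>The field of \<open>p\<close>-adic numbers\<close>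

text \<open>The prime is carried by a type argument: for \<open>'p :: prime_card\<close>, the type \<open>'p padic\<close>
  is \<open>\<rat>\<^sub>p\<close> with \<open>p = CARD('p)\<close>, the completion of the rationals for \<open>rat_pabs p\<close>.\<close>

definition padic_rel :: "nat \<Rightarrow> ((nat \<Rightarrow> rat) \<times> (nat \<Rightarrow> rat)) set" where
  "padic_rel p = {(X, Y). pcauchy p X \<and> pcauchy p Y \<and> pvanishes p (\<lambda>n. X n - Y n)}"

lemma equiv_padic_rel:
  assumes p: "prime p"
  shows "equiv {X. pcauchy p X} (padic_rel p)"
proof (rule equivI)
  show "padic_rel p \<subseteq> {X. pcauchy p X} \<times> {X. pcauchy p X}"
    by (auto simp: padic_rel_def)
  show "refl_on {X. pcauchy p X} (padic_rel p)"
    by (auto simp: refl_on_def padic_rel_def pvanishes_def)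
  show "sym (padic_rel p)"
    by (auto simp: sym_def padic_rel_def pvanishes_def rat_pabs_diff_commute)
  show "trans (padic_rel p)"
    unfolding trans_def padic_rel_def using pvanishes_add[OF p] by fastforce
qed

typedef (overloaded) ('p::prime_card) padic =
  "{X. pcauchy CARD('p) X} // padic_rel CARD('p)"
  morphisms padic_class Abs_padic
proof
  show "padic_rel CARD('p) `` {\<lambda>_. 0} \<in> {X. pcauchy CARD('p) X} // padic_rel CARD('p)"
    by (intro quotientI) simp
qed

definition Padic :: "(nat \<Rightarrow> rat) \<Rightarrow> 'p::prime_card padic" where
  "Padic X = Abs_padic (padic_rel CARD('p) `` {X})"

definition padic_rep :: "'p::prime_card padic \<Rightarrow> nat \<Rightarrow> rat" where
  "padic_rep x = (SOME X. X \<in> padic_class x)"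

lemma Padic_eq_iff:
  assumes "pcauchy CARD('p) X" "pcauchy CARD('p) Y"
  shows "(Padic X :: 'p::prime_card padic) = Padic Y \<longleftrightarrow> pvanishes CARD('p) (\<lambda>n. X n - Y n)"
proof -
  have "(Padic X :: 'p padic) = Padic Y \<longleftrightarrow>
      padic_rel CARD('p) `` {X} = padic_rel CARD('p) `` {Y}"
    unfolding Padic_def using assms by (intro Abs_padic_inject quotientI) auto
  also have "\<dots> \<longleftrightarrow> (X, Y) \<in> padic_rel CARD('p)"
    using assms by (intro eq_equiv_class_iff[OF equiv_padic_rel[OF prime_card]]) auto
  finally show ?thesis
    using assms by (simp add: padic_rel_def)
qed

lemma
  fixes x :: "'p::prime_card padic"
  shows pcauchy_padic_rep [simp]: "pcauchy CARD('p) (padic_rep x)"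
    and Padic_padic_rep [simp]: "Padic (padic_rep x) = x"
proof -
  obtain X where X: "pcauchy CARD('p) X" "padic_class x = padic_rel CARD('p) `` {X}"
    using padic_class[of x] by (auto elim: quotientE)
  hence "X \<in> padic_class x"
    by (auto simp: padic_rel_def pvanishes_def)
  hence *: "padic_rep x \<in> padic_class x"
    unfolding padic_rep_def by (rule someI[of "\<lambda>X. X \<in> padic_class x"])
  thus cau: "pcauchy CARD('p) (padic_rep x)"
    unfolding X(2) by (simp add: padic_rel_def)
  have "Padic X = x"
    by (metis Padic_def X(2) padic_class_inverse)
  moreover have "(Padic X :: 'p padic) = Padic (padic_rep x)"
    using * X cau by (simp add: Padic_eq_iff padic_rel_def)
  ultimately show "Padic (padic_rep x) = x"
    by simp
qed

lemma Padic_cases [cases type: padic]: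
  obtains X where "(x :: 'p::prime_card padic) = Padic X" "pcauchy CARD('p) X"
  by (metis Padic_padic_rep pcauchy_padic_rep)

lemma pvanishes_padic_rep_Padic:
  assumes "pcauchy CARD('p) X"
  shows "pvanishes CARD('p) (\<lambda>n. padic_rep (Padic X :: 'p::prime_card padic) n - X n)"
  using assms by (simp flip: Padic_eq_iff)

instantiation padic :: (prime_card) field
begin

definition "0 = Padic (\<lambda>n. 0)"
definition "1 = Padic (\<lambda>n. 1)"
definition "x + y = Padic (\<lambda>n. padic_rep x n + padic_rep y n)"
definition "x * y = Padic (\<lambda>n. padic_rep x n * padic_rep y n)"
definition "- x = Padic (\<lambda>n. - padic_rep x n)" for x :: "'a padic"
definition "inverse x = (if x = 0 then 0 else Padic (\<lambda>n. inverse (padic_rep x n)))"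
  for x :: "'a padic"
definition "x - y = x + - y" for x y :: "'a padic"
definition "x div y = x * inverse y" for x y :: "'a padic"

lemma add_Padic:
  assumes X: "pcauchy CARD('a) X" and Y: "pcauchy CARD('a) Y"
  shows "Padic X + Padic Y = (Padic (\<lambda>n. X n + Y n) :: 'a padic)"
proof -
  let ?X = "padic_rep (Padic X :: 'a padic)" and ?Y = "padic_rep (Padic Y :: 'a padic)"
  have "pvanishes CARD('a) (\<lambda>n. (?X n - X n) + (?Y n - Y n))"
    by (intro pvanishes_add pvanishes_padic_rep_Padic prime_card assms)
  thus ?thesis
    unfolding plus_padic_def
    by (subst Padic_eq_iff) (simp_all add: X Y pcauchy_add prime_card algebra_simps)
qed

lemma minus_Padic:
  assumes X: "pcauchy CARD('a) X"
  shows "- Padic X = (Padic (\<lambda>n. - X n) :: 'a padic)"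
proof -
  let ?X = "padic_rep (Padic X :: 'a padic)"
  have "pvanishes CARD('a) (\<lambda>n. - (?X n - X n))"
    by (intro pvanishes_minus pvanishes_padic_rep_Padic assms)
  thus ?thesis
    unfolding uminus_padic_def
    by (subst Padic_eq_iff) (simp_all add: X)
qed

lemma diff_Padic:
  assumes X: "pcauchy CARD('a) X" and Y: "pcauchy CARD('a) Y"
  shows "Padic X - Padic Y = (Padic (\<lambda>n. X n - Y n) :: 'a padic)"
  using assms by (simp add: minus_padic_def minus_Padic add_Padic)

lemma mult_Padic:
  assumes X: "pcauchy CARD('a) X" and Y: "pcauchy CARD('a) Y"
  shows "Padic X * Padic Y = (Padic (\<lambda>n. X n * Y n) :: 'a padic)"
proof -
  let ?X = "padic_rep (Padic X :: 'a padic)" and ?Y = "padic_rep (Padic Y :: 'a padic)"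
  have "pvanishes CARD('a) (\<lambda>n. ?X n * (?Y n - Y n) + Y n * (?X n - X n))"
    by (intro pvanishes_add pvanishes_mult pvanishes_padic_rep_Padic prime_card assms
        pcauchy_padic_rep)
  thus ?thesis
    unfolding times_padic_def
    by (subst Padic_eq_iff) (simp_all add: X Y pcauchy_mult prime_card algebra_simps)
qed

lemma Padic_eq_0_iff:
  assumes X: "pcauchy CARD('a) X"
  shows "(Padic X :: 'a padic) = 0 \<longleftrightarrow> pvanishes CARD('a) X"
  using assms by (simp add: zero_padic_def Padic_eq_iff)

lemma inverse_Padic:
  assumes X: "pcauchy CARD('a) X" "\<not> pvanishes CARD('a) X"
  shows "inverse (Padic X) = (Padic (\<lambda>n. inverse (X n)) :: 'a padic)"
proof -
  let ?X = "padic_rep (Padic X :: 'a padic)"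
  have nz: "(Padic X :: 'a padic) \<noteq> 0"
    using X by (simp add: Padic_eq_0_iff)
  hence nv: "\<not> pvanishes CARD('a) ?X"
    by (metis Padic_eq_0_iff Padic_padic_rep pcauchy_padic_rep)
  have "pvanishes CARD('a) (\<lambda>n. inverse (?X n) - inverse (X n))"
    by (intro pvanishes_diff_inverse pvanishes_padic_rep_Padic prime_card assms nv
        pcauchy_padic_rep)
  thus ?thesis
    unfolding inverse_padic_def using nz nv X
    by (simp add: Padic_eq_iff pcauchy_inverse prime_card)
qed

instance
proof
  fix a b c :: "'a padic"
  note [simp] = add_Padic mult_Padic minus_Padic pcauchy_add pcauchy_mult prime_card
    zero_padic_def one_padic_def
  show "a + b = b + a" "(a + b) + c = a + (b + c)" "0 + a = a" "- a + a = 0"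
    "(a * b) * c = a * (b * c)" "a * b = b * a" "1 * a = a" "(a + b) * c = a * c + b * c"
    by (cases a; cases b; cases c; simp add: algebra_simps)+
  show "(0 :: 'a padic) \<noteq> 1"
    by (simp add: Padic_eq_iff)
  show "a - b = a + - b" "a div b = a * inverse b"
    by (simp_all only: minus_padic_def divide_padic_def)
  show "inverse (0 :: 'a padic) = 0"
    unfolding inverse_padic_def by (rule if_P) (rule refl)
  show "inverse a * a = 1" if "a \<noteq> 0"
  proof (cases a)
    case (1 X)
    hence nv: "\<not> pvanishes CARD('a) X"
      using that Padic_eq_0_iff[OF 1(2)] by (simp only: simp_thms)
    have "\<forall>\<^sub>F n in sequentially. X n \<noteq> 0"
      using pcauchy_not_vanishes[OF prime_card 1(2) nv] by (force simp: eventually_sequentially)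
    hence "\<forall>\<^sub>F n in sequentially. rat_pabs CARD('a) (inverse (X n) * X n - 1) = 0"
      by eventually_elim simp
    hence "pvanishes CARD('a) (\<lambda>n. inverse (X n) * X n - 1)"
      unfolding pvanishes_def by (rule tendsto_eventually)
    thus ?thesis
      using 1 nv by (simp add: inverse_Padic pcauchy_inverse Padic_eq_iff)
  qed
qed

end

lemma of_nat_Padic: "of_nat n = Padic (\<lambda>_. of_nat n)"
  by (induction n) (simp_all add: zero_padic_def one_padic_def add_Padic)

instance padic :: (prime_card) field_char_0
proof
  show "inj (of_nat :: nat \<Rightarrow> 'a padic)"
    by (rule injI) (simp add: of_nat_Padic Padic_eq_iff prime_card)
qed

lemma of_int_Padic: "of_int n = Padic (\<lambda>_. of_int n)"
  by (cases n) (simp_all add: of_nat_Padic one_padic_def add_Padic minus_Padic diff_Padic)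

lemma of_rat_Padic: "of_rat r = (Padic (\<lambda>_. r) :: 'p::prime_card padic)"
proof (cases r)
  case (Fract a b)
  hence "(of_rat r :: 'p padic) = of_int a / of_int b"
    by (simp add: of_rat_rat)
  also have "\<dots> = Padic (\<lambda>_. r)"
    using Fract by (simp add: of_int_Padic divide_inverse inverse_Padic mult_Padic prime_card
        Fract_of_int_quotient)
  finally show ?thesis .
qed


section \<open>The \<open>p\<close>-adic absolute value and metric\<close>

definition padic_abs :: "'p::prime_card padic \<Rightarrow> real" where
  "padic_abs x = lim (\<lambda>n. rat_pabs CARD('p) (padic_rep x n))"

lemma padic_abs_Padic:
  assumes X: "pcauchy CARD('p) X"
  shows "(\<lambda>n. rat_pabs CARD('p) (X n)) \<longlonglongrightarrow> padic_abs (Padic X :: 'p::prime_card padic)"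
proof -
  let ?X = "padic_rep (Padic X :: 'p padic)" and ?a = "rat_pabs CARD('p)"
  have lim: "(\<lambda>n. ?a (?X n)) \<longlonglongrightarrow> padic_abs (Padic X :: 'p padic)"
    unfolding padic_abs_def
    by (intro convergent_LIMSEQ_iff[THEN iffD1] pcauchy_convergent prime_card pcauchy_padic_rep)
  have "(\<lambda>n. ?a (X n) - ?a (?X n)) \<longlonglongrightarrow> 0"
  proof (rule Lim_null_comparison)
    show "(\<lambda>n. ?a (?X n - X n)) \<longlonglongrightarrow> 0"
      using pvanishes_padic_rep_Padic[OF X] by (simp add: pvanishes_def)
    show "\<forall>\<^sub>F n in sequentially. norm (?a (X n) - ?a (?X n)) \<le> ?a (?X n - X n)"
      using rat_pabs_diff_le[OF prime_card[where 'a='p]]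
      by (auto simp: rat_pabs_diff_commute)
  qed
  from tendsto_add[OF this lim] show ?thesis
    by simp
qed

lemma padic_abs_of_rat [simp]:
  "padic_abs (of_rat r :: 'p::prime_card padic) = rat_pabs CARD('p) r"
  using padic_abs_Padic[of "\<lambda>_. r", where 'p='p]
  by (simp add: of_rat_Padic LIMSEQ_const_iff)

lemma padic_abs_nonneg [simp]: "0 \<le> padic_abs x"
  by (cases x) (auto intro!: LIMSEQ_le_const[OF padic_abs_Padic])

lemma padic_abs_eq_0_iff [simp]: "padic_abs x = 0 \<longleftrightarrow> x = 0"
proof (cases x)
  case (1 X)
  thus ?thesis
    using padic_abs_Padic[OF 1(2)]
    by (auto simp: Padic_eq_0_iff pvanishes_def dest: LIMSEQ_unique)
qed

lemma padic_abs_0 [simp]: "padic_abs 0 = 0"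
  by simp

lemma padic_abs_mult: "padic_abs (x * y) = padic_abs x * padic_abs (y :: 'p::prime_card padic)"
proof (cases x; cases y)
  fix X Y assume "x = Padic X" "pcauchy CARD('p) X" "y = Padic Y" "pcauchy CARD('p) Y"
  thus ?thesis
    using padic_abs_Padic[of "\<lambda>n. X n * Y n", where 'p='p]
      tendsto_mult[OF padic_abs_Padic[of X, where 'p='p] padic_abs_Padic[of Y, where 'p='p]]
    by (auto simp: mult_Padic pcauchy_mult rat_pabs_mult prime_card dest: LIMSEQ_unique)
qed

lemma padic_abs_minus [simp]: "padic_abs (- x) = padic_abs (x :: 'p::prime_card padic)"
proof (cases x)
  case (1 X)
  thus ?thesis
    using padic_abs_Padic[of "\<lambda>n. - X n", where 'p='p] padic_abs_Padic[OF 1(2)]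
    by (auto simp: minus_Padic dest: LIMSEQ_unique)
qed

lemma padic_abs_1 [simp]: "padic_abs (1 :: 'p::prime_card padic) = 1"
  using padic_abs_of_rat[of 1, where 'p='p] by (simp add: prime_card)

lemma padic_abs_ultra:
  "padic_abs (x + y) \<le> max (padic_abs x) (padic_abs (y :: 'p::prime_card padic))"
proof (cases x; cases y)
  fix X Y assume *: "x = Padic X" "pcauchy CARD('p) X" "y = Padic Y" "pcauchy CARD('p) Y"
  show ?thesis
    unfolding *(1,3) add_Padic[OF *(2,4)]
  proof (rule LIMSEQ_le)
    show "(\<lambda>n. rat_pabs CARD('p) (X n + Y n)) \<longlonglongrightarrow> padic_abs (Padic (\<lambda>n. X n + Y n) :: 'p padic)"
      by (intro padic_abs_Padic pcauchy_add prime_card *)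
    show "(\<lambda>n. max (rat_pabs CARD('p) (X n)) (rat_pabs CARD('p) (Y n)))
        \<longlonglongrightarrow> max (padic_abs (Padic X :: 'p padic)) (padic_abs (Padic Y :: 'p padic))"
      by (intro tendsto_max padic_abs_Padic *)
  qed (use rat_pabs_ultra[OF prime_card[where 'a='p]] in auto)
qed

lemma padic_abs_triangle:
  "padic_abs (x + y) \<le> padic_abs x + padic_abs (y :: 'p::prime_card padic)"
  using padic_abs_ultra[of x y] padic_abs_nonneg[of x] padic_abs_nonneg[of y] by linarith

lemma padic_abs_diff_commute: "padic_abs (x - y) = padic_abs (y - x :: 'p::prime_card padic)"
  by (metis minus_diff_eq padic_abs_minus)

instantiation padic :: (prime_card) metric_space
begin

definition dist_padic :: "'a padic \<Rightarrow> 'a padic \<Rightarrow> real" where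
  "dist x y = padic_abs (x - y)"

definition uniformity_padic :: "('a padic \<times> 'a padic) filter" where
  "uniformity_padic = (INF e\<in>{0 <..}. principal {(x, y). dist x y < e})"

definition open_padic :: "'a padic set \<Rightarrow> bool" where
  "open_padic U \<longleftrightarrow> (\<forall>x\<in>U. eventually (\<lambda>(x', y). x' = x \<longrightarrow> y \<in> U) uniformity)"

instance
proof
  fix x y z :: "'a padic"
  show "dist x y = 0 \<longleftrightarrow> x = y"
    by (simp add: dist_padic_def)
  show "dist x y \<le> dist x z + dist y z"
    using padic_abs_triangle[of "x - z" "z - y"]
    by (simp add: dist_padic_def padic_abs_diff_commute)
qed (simp_all only: uniformity_padic_def open_padic_def)

end

lemma padic_rat_dense:
  fixes x :: "'p::prime_card padic"
  assumes e: "e > 0"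
  shows "\<exists>r. dist x (of_rat r) < e"
proof (cases x)
  case (1 X)
  obtain k where k: "\<And>m n. m \<ge> k \<Longrightarrow> n \<ge> k \<Longrightarrow> rat_pabs CARD('p) (X m - X n) < e / 2"
    using 1(2) e unfolding pcauchy_def by (meson half_gt_zero)
  have "pcauchy CARD('p) (\<lambda>n. X n - X k)"
    using pcauchy_add[OF prime_card[where 'a='p] 1(2), of "\<lambda>_. - X k"] by simp
  from padic_abs_Padic[OF this]
  have "padic_abs (Padic (\<lambda>n. X n - X k) :: 'p padic) \<le> e / 2"
    by (rule LIMSEQ_le_const2) (use k in \<open>auto intro!: exI[of _ k] less_imp_le\<close>)
  hence "dist x (of_rat (X k)) < e"
    using 1 e by (simp add: dist_padic_def of_rat_Padic diff_Padic)
  thus ?thesis ..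
qed

lemma Padic_LIMSEQ:
  assumes X: "pcauchy CARD('p) X"
  shows "(\<lambda>n. of_rat (X n)) \<longlonglongrightarrow> (Padic X :: 'p::prime_card padic)"
proof (rule metric_LIMSEQ_I)
  fix e :: real assume e: "e > 0"
  obtain k where k: "\<And>m n. m \<ge> k \<Longrightarrow> n \<ge> k \<Longrightarrow> rat_pabs CARD('p) (X m - X n) < e / 2"
    using X e unfolding pcauchy_def by (meson half_gt_zero)
  have "dist (of_rat (X m)) (Padic X :: 'p padic) < e" if m: "m \<ge> k" for m
  proof -
    have "pcauchy CARD('p) (\<lambda>n. X m - X n)"
      using pcauchy_add[OF prime_card[where 'a='p] pcauchy_const[of _ "X m"] pcauchy_minus[OF X]]
      by simp
    from padic_abs_Padic[OF this]
    have "padic_abs (Padic (\<lambda>n. X m - X n) :: 'p padic) \<le> e / 2"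
      by (rule LIMSEQ_le_const2) (use k m in \<open>auto intro!: exI[of _ k] less_imp_le\<close>)
    thus ?thesis
      using X e by (simp add: dist_padic_def of_rat_Padic diff_Padic)
  qed
  thus "\<exists>N. \<forall>n\<ge>N. dist (of_rat (X n)) (Padic X :: 'p padic) < e"
    by blast
qed

instance padic :: (prime_card) complete_space
proof
  fix S :: "nat \<Rightarrow> 'a padic" assume S: "Cauchy S"
  have "\<exists>r. dist (S n) (of_rat r) < inverse (real (Suc n))" for n
    by (rule padic_rat_dense) simp
  then obtain X where X: "\<And>n. dist (S n) (of_rat (X n)) < inverse (real (Suc n))"
    by metis
  have "pcauchy CARD('a) X"
    unfolding pcauchy_def
  proof safe
    fix e :: real assume e: "e > 0"
    obtain k where k: "\<And>m n. m \<ge> k \<Longrightarrow> n \<ge> k \<Longrightarrow> dist (S m) (S n) < e / 3"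
      using metric_CauchyD[OF S, of "e / 3"] e by auto
    obtain l where l: "inverse (real (Suc l)) < e / 3"
      using reals_Archimedean[of "e / 3"] e by auto
    have small: "inverse (real (Suc n)) < e / 3" if "n \<ge> l" for n
    proof -
      have "inverse (real (Suc n)) \<le> inverse (real (Suc l))"
        using that by (intro le_imp_inverse_le) auto
      thus ?thesis using l by (rule le_less_trans)
    qed
    show "\<exists>k. \<forall>m\<ge>k. \<forall>n\<ge>k. rat_pabs CARD('a) (X m - X n) < e"
    proof (intro exI[of _ "max k l"] allI impI)
      fix m n assume mn: "max k l \<le> m" "max k l \<le> n"
      have "rat_pabs CARD('a) (X m - X n) = dist (of_rat (X m)) (of_rat (X n) :: 'a padic)"
        by (simp add: dist_padic_def flip: of_rat_diff)
      also have "\<dots> \<le> dist (S m) (of_rat (X m)) + dist (S m) (S n) + dist (S n) (of_rat (X n))"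
        by metric
      also have "\<dots> < e / 3 + e / 3 + e / 3"
        using mn by (intro add_strict_mono k less_trans[OF X small]) auto
      finally show "rat_pabs CARD('a) (X m - X n) < e" by simp
    qed
  qed
  hence lim: "(\<lambda>n. of_rat (X n)) \<longlonglongrightarrow> (Padic X :: 'a padic)"
    by (rule Padic_LIMSEQ)
  have "(\<lambda>n. dist (S n) (of_rat (X n))) \<longlonglongrightarrow> 0"
    by (rule tendsto_sandwich[OF _ _ tendsto_const LIMSEQ_inverse_real_of_nat];
        rule always_eventually, rule allI, rule zero_le_dist less_imp_le[OF X])
  moreover have "(\<lambda>n. dist (of_rat (X n)) (Padic X :: 'a padic)) \<longlonglongrightarrow> 0"
    by (rule iffD1[OF tendsto_dist_iff lim])
  ultimately have *: "(\<lambda>n. dist (S n) (of_rat (X n)) + dist (of_rat (X n)) (Padic X :: 'a padic)) \<longlonglongrightarrow> 0"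
    by (rule tendsto_add_zero)
  have "S \<longlonglongrightarrow> Padic X"
    by (rule iffD2[OF tendsto_dist_iff], rule tendsto_sandwich[OF _ _ tendsto_const *];
        rule always_eventually, rule allI, rule zero_le_dist dist_triangle)
  thus "convergent S"
    by (auto simp: convergent_def)
qed

subsection \<open>Expansions in powers of \<open>p\<close> and the fractional part\<close>

definition padic_expansion :: "(int \<Rightarrow> nat) \<Rightarrow> 'p::prime_card padic \<Rightarrow> bool" where
  "padic_expansion c x \<longleftrightarrow> (\<forall>j. c j < CARD('p)) \<and>
     (\<exists>M. (\<forall>j<M. c j = 0) \<and>
          (\<lambda>n. \<Sum>j\<in>{M..<M + int n}. of_nat (c j) * of_nat CARD('p) powi j) \<longlonglongrightarrow> x)"

lemma rat_pabs_of_int: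
  assumes "prime p" "n \<noteq> 0"
  shows "rat_pabs p (of_int n) = real p powi (- int (multiplicity (int p) n))"
  using rat_pabs_fraction[of p n 1] assms by simp

lemma rat_pabs_of_int_le_1:
  assumes p: "prime p"
  shows "rat_pabs p (of_int n) \<le> 1"
proof (cases "n = 0")
  case False
  have "real p \<ge> 1"
    using prime_ge_1_nat[OF p] by simp
  hence "real p powi (- int (multiplicity (int p) n)) \<le> real p powi 0"
    by (intro power_int_increasing) auto
  thus ?thesis
    using False p by (simp add: rat_pabs_of_int)
qed auto

lemma rat_pabs_of_int_le_inverse_iff:
  assumes p: "prime p"
  shows "rat_pabs p (of_int n) \<le> inverse (real p) \<longleftrightarrow> int p dvd n"
proof (cases "n = 0")
  case False
  have p1: "real p > 1"
    using prime_gt_1_nat[OF p] by simp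
  have "rat_pabs p (of_int n) \<le> inverse (real p) \<longleftrightarrow>
      real p powi (- int (multiplicity (int p) n)) \<le> real p powi (- 1)"
    using False p by (simp add: rat_pabs_of_int power_int_minus)
  also have "\<dots> \<longleftrightarrow> multiplicity (int p) n \<ge> 1"
  proof
    assume "multiplicity (int p) n \<ge> 1"
    thus "real p powi (- int (multiplicity (int p) n)) \<le> real p powi (- 1)"
      using p1 by (intro power_int_increasing) auto
  next
    assume *: "real p powi (- int (multiplicity (int p) n)) \<le> real p powi (- 1)"
    show "multiplicity (int p) n \<ge> 1"
    proof (rule ccontr)
      assume "\<not> multiplicity (int p) n \<ge> 1"
      hence "real p powi (- int (multiplicity (int p) n)) > real p powi (- 1)"
        using p1 by (intro power_int_strict_increasing) auto
      with * show False
        by simp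
    qed
  qed
  also have "\<dots> \<longleftrightarrow> int p dvd n"
    using False p by (simp add: Suc_le_eq prime_multiplicity_gt_zero_iff)
  finally show ?thesis .
qed auto

lemma padic_abs_of_int [simp]:
  "padic_abs (of_int n :: 'p::prime_card padic) = rat_pabs CARD('p) (of_int n)"
  using padic_abs_of_rat[of "of_int n", where 'p='p] by simp

lemma padic_abs_of_nat_le_1: "padic_abs (of_nat n :: 'p::prime_card padic) \<le> 1"
  using rat_pabs_of_int_le_1[of "CARD('p)" "int n"] padic_abs_of_int[of "int n", where 'p='p]
  by (simp add: prime_card del: padic_abs_of_int)

lemma padic_abs_inverse: "padic_abs (inverse x) = inverse (padic_abs (x :: 'p::prime_card padic))"
proof (cases "x = 0")
  case False
  hence "padic_abs x * padic_abs (inverse x) = 1"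
    by (simp flip: padic_abs_mult)
  thus ?thesis
    by (metis inverse_unique)
qed auto

lemma padic_abs_power: "padic_abs (x ^ n) = padic_abs (x :: 'p::prime_card padic) ^ n"
  by (induction n) (simp_all add: padic_abs_mult)

lemma padic_abs_power_int:
  "padic_abs (x powi n) = padic_abs (x :: 'p::prime_card padic) powi n"
  by (simp add: power_int_def padic_abs_power padic_abs_inverse)

lemma padic_abs_p:
  "padic_abs (of_nat CARD('p) :: 'p::prime_card padic) = inverse (real CARD('p))"
proof -
  have "padic_abs (of_int (int CARD('p)) :: 'p padic)
      = real CARD('p) powi (- int (multiplicity (int CARD('p)) (int CARD('p))))"
    unfolding padic_abs_of_int
    by (rule rat_pabs_of_int) (use prime_card[where 'a='p] prime_gt_0_nat in auto)
  also have "multiplicity (int CARD('p)) (int CARD('p)) = 1"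
    using prime_card[where 'a='p] prime_gt_1_nat
    by (intro multiplicity_self) (auto simp: not_prime_unit)
  finally show ?thesis
    by (simp add: power_int_minus del: padic_abs_of_int)
qed

lemma padic_abs_p_powi:
  "padic_abs (of_nat CARD('p) powi j :: 'p::prime_card padic) = real CARD('p) powi (- j)"
  by (simp add: padic_abs_power_int padic_abs_p power_int_minus power_int_inverse)

lemma padic_digit_ex:
  fixes y :: "'p::prime_card padic"
  assumes y: "padic_abs y \<le> 1"
  shows "\<exists>d<CARD('p). padic_abs (y - of_nat d) \<le> inverse (real CARD('p))"
proof -
  let ?p = "CARD('p)"
  have p: "prime ?p" by (rule prime_card)
  have p1: "?p > 1" using prime_gt_1_nat[OF p] .
  obtain r where r: "dist y (of_rat r) < inverse (real ?p)"
    using padic_rat_dense[of "inverse (real ?p)" y] p1 by auto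
  have "inverse (real ?p) \<le> 1"
    using p1 by (simp add: field_simps)
  hence "rat_pabs ?p r \<le> 1"
    using padic_abs_ultra[of y "of_rat r - y"] r y
    by (simp add: dist_padic_def padic_abs_diff_commute)
  obtain a b where ab: "quotient_of r = (a, b)"
    by force
  have b: "b > 0" and cop: "coprime a b" and rab: "r = of_int a / of_int b"
    using ab quotient_of_denom_pos quotient_of_coprime quotient_of_div by blast+
  have ndvd: "\<not> int ?p dvd b"
  proof
    assume dvd: "int ?p dvd b"
    have "of_int a = r * of_int b"
      using rab b by simp
    hence "rat_pabs ?p (of_int a) = rat_pabs ?p r * rat_pabs ?p (of_int b)"
      using rat_pabs_mult[OF p] by simp
    also have "\<dots> \<le> 1 * inverse (real ?p)"
      using dvd \<open>rat_pabs ?p r \<le> 1\<close> rat_pabs_of_int_le_inverse_iff[OF p, of b]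
      by (intro mult_mono) auto
    finally have "int ?p dvd a"
      using rat_pabs_of_int_le_inverse_iff[OF p] by simp
    with dvd cop have "is_unit (int ?p)"
      using coprime_common_divisor by blast
    thus False using p1 by simp
  qed
  hence "coprime b (int ?p)"
    using p by (metis coprime_commute prime_imp_coprime prime_nat_int_transfer)
  then obtain u where u: "[b * u = 1] (mod int ?p)"
    using cong_solve_coprime_int by blast
  define d where "d = nat ((a * u) mod int ?p)"
  have d: "int d = (a * u) mod int ?p"
    using p1 by (simp add: d_def)
  have "d < ?p"
    using p1 unfolding d_def by (simp add: nat_less_iff)
  moreover have "int ?p dvd a - int d * b"
  proof -
    have "[int d * b = a * u * b] (mod int ?p)"
      unfolding d by (intro cong_mult) (auto simp: cong_def)
    also have "a * u * b = a * (b * u)"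
      by simp
    also have "[\<dots> = a * 1] (mod int ?p)"
      by (intro cong_mult u) auto
    finally show ?thesis
      by (simp add: cong_iff_dvd_diff dvd_diff_commute)
  qed
  have "rat_pabs ?p (r - of_nat d) \<le> inverse (real ?p)"
  proof -
    have "rat_pabs ?p (of_int b) = 1"
      using b ndvd p by (simp add: rat_pabs_of_int not_dvd_imp_multiplicity_0)
    moreover have "(r - of_nat d) * of_int b = of_int (a - int d * b)"
      using b by (simp add: rab field_simps)
    ultimately have "rat_pabs ?p (r - of_nat d) = rat_pabs ?p (of_int (a - int d * b))"
      by (metis mult.right_neutral p rat_pabs_mult)
    thus ?thesis
      using rat_pabs_of_int_le_inverse_iff[OF p, of "a - int d * b"]
        \<open>int ?p dvd a - int d * b\<close> by (simp only:)
  qed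
  moreover have "of_rat r - of_nat d = (of_rat (r - of_nat d) :: 'p padic)"
    by (simp add: of_rat_diff)
  ultimately have "padic_abs (of_rat r - of_nat d :: 'p padic) \<le> inverse (real ?p)"
    by (simp only: padic_abs_of_rat)
  hence "padic_abs (y - of_nat d) \<le> inverse (real ?p)"
    using padic_abs_ultra[of "y - of_rat r" "of_rat r - of_nat d"] r
    by (simp add: dist_padic_def)
  thus ?thesis
    using \<open>d < ?p\<close> by blast
qed

lemma padic_expansion_ex:
  fixes x :: "'p::prime_card padic"
  assumes x: "padic_abs x \<le> real CARD('p) powi (- M)"
  shows "\<exists>c. padic_expansion c x \<and> (\<forall>j<M. c j = 0)"
proof -
  let ?p = "CARD('p)" and ?P = "of_nat CARD('p) :: 'p padic"
  have p: "prime ?p" by (rule prime_card)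
  have p1: "?p > 1" using prime_gt_1_nat[OF p] .
  have P0: "?P \<noteq> 0"
    using p1 by simp
  obtain dig :: "'p padic \<Rightarrow> nat" where dig:
    "\<And>y. padic_abs y \<le> 1 \<Longrightarrow> dig y < ?p \<and> padic_abs (y - of_nat (dig y)) \<le> inverse (real ?p)"
    using padic_digit_ex[where 'p='p] by metis
  define y where "y = rec_nat (x / ?P powi M) (\<lambda>_ z. (z - of_nat (dig z)) / ?P)"
  have y0: "y 0 = x / ?P powi M" and ySuc: "y (Suc n) = (y n - of_nat (dig (y n))) / ?P" for n
    by (simp_all add: y_def)
  have y_le: "padic_abs (y n) \<le> 1" for n
  proof (induction n)
    case 0
    have "real ?p powi (- M) > 0"
      using p1 by simp
    hence "padic_abs x * inverse (real ?p powi (- M)) \<le> 1"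
      using x by (simp only: divide_inverse[symmetric] divide_le_eq_1_pos)
    thus ?case
      by (simp only: y0 divide_inverse padic_abs_mult padic_abs_inverse padic_abs_p_powi)
  next
    case (Suc n)
    have "padic_abs (y n - of_nat (dig (y n))) * real ?p \<le> inverse (real ?p) * real ?p"
      using dig[OF Suc] by (intro mult_right_mono) auto
    thus ?case
      using p1 by (simp add: ySuc divide_inverse padic_abs_mult padic_abs_inverse padic_abs_p)
  qed
  define c where "c j = (if j < M then 0 else dig (y (nat (j - M))))" for j
  have x_eq: "x = (\<Sum>j\<in>{M..<M + int n}. of_nat (c j) * ?P powi j) + ?P powi (M + int n) * y n" for n
  proof (induction n)
    case 0
    show ?case using P0 by (simp add: y0)
  next
    case (Suc n)
    have "{M..<M + int (Suc n)} = insert (M + int n) {M..<M + int n}"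
      by auto
    moreover have "?P powi (M + int n) * y n
        = of_nat (c (M + int n)) * ?P powi (M + int n) + ?P powi (M + int (Suc n)) * y (Suc n)"
    proof -
      have "?P powi (M + int (Suc n)) * y (Suc n)
          = ?P powi (M + int n) * (y n - of_nat (dig (y n)))"
        using P0 power_int_add_1[of ?P "M + int n"] by (simp add: ySuc add_ac)
      thus ?thesis by (simp add: c_def algebra_simps)
    qed
    ultimately show ?case
      using Suc by (simp add: algebra_simps)
  qed
  have "(\<lambda>n. \<Sum>j\<in>{M..<M + int n}. of_nat (c j) * ?P powi j) \<longlonglongrightarrow> x"
  proof (rule metric_tendsto_imp_tendsto)
    show "(\<lambda>n. real ?p powi (- M) * inverse (real ?p) ^ n) \<longlonglongrightarrow> 0"
      using p1 by (intro tendsto_mult_right_zero LIMSEQ_power_zero) (auto simp: field_simps)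
    show "\<forall>\<^sub>F n in sequentially. dist (\<Sum>j\<in>{M..<M + int n}. of_nat (c j) * ?P powi j) x
        \<le> dist (real ?p powi (- M) * inverse (real ?p) ^ n) 0"
    proof (intro always_eventually allI)
      fix n
      have "x - (\<Sum>j\<in>{M..<M + int n}. of_nat (c j) * ?P powi j) = ?P powi (M + int n) * y n"
        by (subst x_eq[of n]) simp
      hence "dist x (\<Sum>j\<in>{M..<M + int n}. of_nat (c j) * ?P powi j)
          = real ?p powi (- (M + int n)) * padic_abs (y n)"
        by (simp only: dist_padic_def padic_abs_mult padic_abs_p_powi)
      also have "\<dots> \<le> real ?p powi (- (M + int n)) * 1"
        using y_le by (intro mult_left_mono) auto
      also have "\<dots> = real ?p powi (- M) * inverse (real ?p) ^ n"
        using p1 by (simp add: power_int_minus power_int_diff power_inverse divide_inverse)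
      finally show "dist (\<Sum>j\<in>{M..<M + int n}. of_nat (c j) * ?P powi j) x
          \<le> dist (real ?p powi (- M) * inverse (real ?p) ^ n) 0"
        using p1 by (simp add: dist_commute)
    qed
  qed
  moreover have "c j < ?p" for j
    using dig y_le p1 by (auto simp: c_def)
  moreover have "\<forall>j<M. c j = 0"
    by (simp add: c_def)
  ultimately show ?thesis
    unfolding padic_expansion_def by blast
qed

lemma padic_abs_sum_le:
  assumes "finite A" "\<And>i. i \<in> A \<Longrightarrow> padic_abs (f i :: 'p::prime_card padic) \<le> B" "B \<ge> 0"
  shows "padic_abs (sum f A) \<le> B"
  using assms
proof (induction A rule: finite_induct)
  case (insert i A)
  thus ?case
    using padic_abs_ultra[of "f i" "sum f A"] by force
qed auto

lemma padic_expansion_tail: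
  fixes x :: "'p::prime_card padic"
  assumes M: "\<forall>j<M. c j = 0"
    and lim: "(\<lambda>n. \<Sum>j\<in>{M..<M + int n}. of_nat (c j) * of_nat CARD('p) powi j) \<longlonglongrightarrow> x"
    and L: "L \<le> M" "L \<le> N"
  shows "padic_abs (x - (\<Sum>j\<in>{L..<N}. of_nat (c j) * of_nat CARD('p) powi j))
      \<le> real CARD('p) powi (- N)"
proof -
  let ?f = "\<lambda>j. of_nat (c j) * of_nat CARD('p) powi j :: 'p padic"
  let ?s = "sum ?f {L..<N}"
  have p1: "real CARD('p) \<ge> 1"
    using prime_ge_1_nat[OF prime_card[where 'a='p]] by simp
  have "(\<lambda>n. dist (sum ?f {M..<M + int n}) ?s) \<longlonglongrightarrow> dist x ?s"
    by (intro tendsto_dist lim tendsto_const)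
  moreover have "\<exists>n0. \<forall>n\<ge>n0. dist (sum ?f {M..<M + int n}) ?s \<le> real CARD('p) powi (- N)"
  proof (intro exI[of _ "nat (N - M)"] allI impI)
    fix n assume n: "n \<ge> nat (N - M)"
    have "sum ?f {M..<M + int n} = sum ?f {L..<M + int n}"
      using L M by (intro sum.mono_neutral_left) auto
    also have "\<dots> - ?s = sum ?f {N..<M + int n}"
    proof -
      have "{L..<M + int n} = {L..<N} \<union> {N..<M + int n}"
        using L n by auto
      hence "sum ?f {L..<M + int n} = ?s + sum ?f {N..<M + int n}"
        by (simp only:) (intro sum.union_disjoint; auto)
      thus ?thesis by simp
    qed
    finally have "sum ?f {M..<M + int n} - ?s = sum ?f {N..<M + int n}" .
    moreover have "padic_abs (sum ?f {N..<M + int n}) \<le> real CARD('p) powi (- N)"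
    proof (rule padic_abs_sum_le)
      fix j assume j: "j \<in> {N..<M + int n}"
      have "padic_abs (?f j) \<le> 1 * real CARD('p) powi (- j)"
        unfolding padic_abs_mult padic_abs_p_powi
        by (intro mult_right_mono padic_abs_of_nat_le_1) auto
      also have "\<dots> \<le> real CARD('p) powi (- N)"
        using j p1 by (auto intro!: power_int_increasing)
      finally show "padic_abs (?f j) \<le> real CARD('p) powi (- N)" .
    qed auto
    ultimately show "dist (sum ?f {M..<M + int n}) ?s \<le> real CARD('p) powi (- N)"
      by (simp add: dist_padic_def)
  qed
  ultimately have "dist x ?s \<le> real CARD('p) powi (- N)"
    by (rule LIMSEQ_le_const2)
  thus ?thesis
    by (simp add: dist_padic_def)
qed

lemma padic_expansion_unique:
  fixes x :: "'p::prime_card padic"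
  assumes c: "padic_expansion c x" and c': "padic_expansion c' x"
  shows "c = c'"
proof (rule ccontr)
  assume "c \<noteq> c'"
  then obtain k0 where k0: "c k0 \<noteq> c' k0"
    by blast
  let ?p = "CARD('p)" and ?P = "of_nat CARD('p) :: 'p padic"
  have p: "prime ?p" by (rule prime_card)
  have p1: "?p > 1" using prime_gt_1_nat[OF p] .
  obtain M where M: "\<forall>j<M. c j = 0"
      "(\<lambda>n. \<Sum>j\<in>{M..<M + int n}. of_nat (c j) * ?P powi j) \<longlonglongrightarrow> x"
    using c by (auto simp: padic_expansion_def)
  obtain M' where M': "\<forall>j<M'. c' j = 0"
      "(\<lambda>n. \<Sum>j\<in>{M'..<M' + int n}. of_nat (c' j) * ?P powi j) \<longlonglongrightarrow> x"
    using c' by (auto simp: padic_expansion_def)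
  define L where "L = min M M'"
  have L: "L \<le> M" "L \<le> M'"
    by (auto simp: L_def)
  have ge: "L \<le> k" if "c k \<noteq> c' k" for k
  proof (rule ccontr)
    assume "\<not> L \<le> k"
    hence "k < M" "k < M'"
      by (auto simp: L_def)
    thus False
      using that M(1) M'(1) by simp
  qed
  define m where "m = (LEAST m. c (L + int m) \<noteq> c' (L + int m))"
  have ex: "c (L + int (nat (k0 - L))) \<noteq> c' (L + int (nat (k0 - L)))"
    using k0 ge[OF k0] by simp
  define k where "k = L + int m"
  have k: "c k \<noteq> c' k"
    unfolding k_def m_def by (rule LeastI[of "\<lambda>m. c (L + int m) \<noteq> c' (L + int m)", OF ex])
  have less: "c j = c' j" if "L \<le> j" "j < k" for j
  proof (rule ccontr)
    assume "c j \<noteq> c' j"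
    hence "m \<le> nat (j - L)"
      unfolding m_def using that by (intro Least_le) simp
    thus False using that by (simp add: k_def)
  qed
  have Lk: "L \<le> k"
    by (simp add: k_def)
  let ?s = "\<Sum>j\<in>{L..<k}. of_nat (c j) * ?P powi j"
  have split: "(\<Sum>j\<in>{L..<k + 1}. of_nat (b j) * ?P powi j)
      = (\<Sum>j\<in>{L..<k}. of_nat (b j) * ?P powi j) + of_nat (b k) * ?P powi k" for b :: "int \<Rightarrow> nat"
  proof -
    have "{L..<k + 1} = insert k {L..<k}"
      using Lk by auto
    thus ?thesis by (simp add: add.commute)
  qed
  have s': "(\<Sum>j\<in>{L..<k}. of_nat (c' j) * ?P powi j) = ?s"
    using less by (intro sum.cong) auto
  have 1: "padic_abs (x - (?s + of_nat (c k) * ?P powi k)) \<le> real ?p powi (- (k + 1))"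
    using padic_expansion_tail[OF M, of L "k + 1"] L Lk unfolding split by simp
  have 2: "padic_abs (x - (?s + of_nat (c' k) * ?P powi k)) \<le> real ?p powi (- (k + 1))"
    using padic_expansion_tail[OF M', of L "k + 1"] L Lk unfolding split s' by simp
  have "(x - (?s + of_nat (c' k) * ?P powi k)) + - (x - (?s + of_nat (c k) * ?P powi k))
      = of_int (int (c k) - int (c' k)) * ?P powi k"
    by (simp add: algebra_simps)
  hence "padic_abs (of_int (int (c k) - int (c' k)) * ?P powi k) \<le> real ?p powi (- (k + 1))"
    using padic_abs_ultra[of "x - (?s + of_nat (c' k) * ?P powi k)"
        "- (x - (?s + of_nat (c k) * ?P powi k))"] 1 2
    by (simp only: padic_abs_minus)
  hence "rat_pabs ?p (of_int (int (c k) - int (c' k))) * real ?p powi (- k)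
      \<le> inverse (real ?p) * real ?p powi (- k)"
  proof -
    have "real ?p powi (- (k + 1)) = inverse (real ?p) * real ?p powi (- k)"
      using power_int_add[of "real ?p" "- 1" "- k"] p1 by (simp add: power_int_minus add.commute)
    thus ?thesis
      using \<open>padic_abs (of_int (int (c k) - int (c' k)) * ?P powi k) \<le> real ?p powi (- (k + 1))\<close>
      by (simp only: padic_abs_mult padic_abs_p_powi padic_abs_of_int)
  qed
  hence "rat_pabs ?p (of_int (int (c k) - int (c' k))) \<le> inverse (real ?p)"
    using p1 by (subst (asm) mult_le_cancel_right_pos) auto
  hence "int ?p dvd int (c k) - int (c' k)"
    using rat_pabs_of_int_le_inverse_iff[OF p] by blast
  hence "int (c k) mod int ?p = int (c' k) mod int ?p"
    by (simp add: mod_eq_dvd_iff)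
  moreover have "c k < ?p" "c' k < ?p"
    using c c' by (auto simp: padic_expansion_def)
  ultimately show False
    using k by simp
qed

lemma padic_expansion_ex1: "\<exists>!c. padic_expansion c (x :: 'p::prime_card padic)"
proof -
  have p1: "real CARD('p) > 1"
    using prime_gt_1_nat[OF prime_card[where 'a='p]] by simp
  obtain n where "padic_abs x < real CARD('p) ^ n"
    using real_arch_pow[OF p1] by blast
  hence "padic_abs x \<le> real CARD('p) powi (- (- int n))"
    by simp
  thus ?thesis
    using padic_expansion_ex padic_expansion_unique by metis
qed

definition padic_digit :: "'p::prime_card padic \<Rightarrow> int \<Rightarrow> nat" where
  "padic_digit x = (THE c. padic_expansion c x)"

lemma padic_expansion_digit: "padic_expansion (padic_digit x) x"
  unfolding padic_digit_def by (rule theI'[OF padic_expansion_ex1])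

definition padic_frac :: "'p::prime_card padic \<Rightarrow> real" where
  "padic_frac x = (\<Sum>j | j < 0 \<and> padic_digit x j \<noteq> 0. real (padic_digit x j) * real CARD('p) powi j)"

lemma padic_frac_integral:
  assumes "padic_abs (x :: 'p::prime_card padic) \<le> 1"
  shows "padic_frac x = 0"
proof -
  obtain c where c: "padic_expansion c x" "\<forall>j<0. c j = 0"
    using padic_expansion_ex[of x 0] assms by auto
  have "padic_digit x = c"
    using padic_expansion_unique padic_expansion_digit c(1) by blast
  with c(2) show ?thesis
    by (auto simp: padic_frac_def intro: sum.neutral)
qed


lemma padic_expansionI:
  fixes x :: "'p::prime_card padic"
  assumes c: "\<And>j. c j < CARD('p)" "\<forall>j<L. c j = 0"
    and le: "\<And>N. N \<ge> K \<Longrightarrow>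
      padic_abs (x - (\<Sum>j\<in>{L..<N}. of_nat (c j) * of_nat CARD('p) powi j)) \<le> real CARD('p) powi (- N)"
  shows "padic_expansion c x"
proof -
  let ?s = "\<lambda>n. \<Sum>j\<in>{L..<L + int n}. of_nat (c j) * of_nat CARD('p) powi j :: 'p padic"
  have p1: "real CARD('p) > 1"
    using prime_gt_1_nat[OF prime_card[where 'a='p]] by simp
  have "(\<lambda>n. real CARD('p) powi (- L) * inverse (real CARD('p)) ^ n) \<longlonglongrightarrow> 0"
    using p1 by (intro tendsto_mult_right_zero LIMSEQ_power_zero) (auto simp: field_simps)
  moreover have "\<forall>\<^sub>F n in sequentially. dist (?s n) x
      \<le> dist (real CARD('p) powi (- L) * inverse (real CARD('p)) ^ n) 0"
    using eventually_ge_at_top[of "nat (K - L)"]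
  proof eventually_elim
    case (elim n)
    have "dist (?s n) x \<le> real CARD('p) powi (- (L + int n))"
      using le[of "L + int n"] elim by (simp add: dist_padic_def padic_abs_diff_commute)
    also have "\<dots> = real CARD('p) powi (- L) * inverse (real CARD('p)) ^ n"
      using p1 by (simp add: power_int_minus power_int_diff power_inverse divide_inverse)
    finally show ?case
      using p1 by simp
  qed
  ultimately have "?s \<longlonglongrightarrow> x"
    by (rule metric_tendsto_imp_tendsto)
  thus ?thesis
    using c unfolding padic_expansion_def by blast
qed

lemma padic_frac_add_integral:
  fixes x h :: "'p::prime_card padic"
  assumes h: "padic_abs h \<le> 1"
  shows "padic_frac (x + h) = padic_frac x"
proof -
  let ?f = "\<lambda>c j. of_nat (c j) * of_nat CARD('p) powi j :: 'p padic"
  define c where "c = padic_digit x"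
  have "padic_expansion c x"
    unfolding c_def by (rule padic_expansion_digit)
  then obtain M where c: "\<And>j. c j < CARD('p)" and M: "\<forall>j<M. c j = 0"
    "(\<lambda>n. sum (?f c) {M..<M + int n}) \<longlonglongrightarrow> x"
    unfolding padic_expansion_def by blast
  define L where "L = min M 0"
  have L: "L \<le> M" "L \<le> 0"
    by (auto simp: L_def)
  define z where "z = sum (?f c) {L..<0}"
  have "padic_abs (x - z) \<le> 1"
    using padic_expansion_tail[OF M L] by (simp add: z_def)
  hence "padic_abs ((x - z) + h) \<le> 1"
    using h by (intro order_trans[OF padic_abs_ultra]) simp
  hence "padic_abs (x + h - z) \<le> real CARD('p) powi (- 0)"
    by (simp add: diff_add_eq)
  from padic_expansion_ex[OF this]
  obtain d where d: "padic_expansion d (x + h - z)" "\<forall>j<0. d j = 0"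
    by blast
  obtain M' where M': "\<And>j. d j < CARD('p)" "\<forall>j<M'. d j = 0"
    "(\<lambda>n. sum (?f d) {M'..<M' + int n}) \<longlonglongrightarrow> x + h - z"
    using d(1) unfolding padic_expansion_def by blast
  define b where "b j = (if j < 0 then c j else d j)" for j :: int
  have "padic_expansion b (x + h)"
  proof (rule padic_expansionI)
    show "b j < CARD('p)" for j
      using c M' by (simp add: b_def)
    show "\<forall>j<L. b j = 0"
      using M(1) L by (simp add: b_def)
    fix N :: int assume N: "N \<ge> 0"
    define K where "K = min M' 0"
    have "sum (?f b) {L..<N} = sum (?f b) {L..<0} + sum (?f b) {0..<N}"
    proof -
      have "{L..<N} = {L..<0} \<union> {0..<N}"
        using L N by auto
      thus ?thesis
        by (simp only:) (intro sum.union_disjoint; auto)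
    qed
    also have "sum (?f b) {L..<0} = z"
      unfolding z_def by (intro sum.cong) (auto simp: b_def)
    also have "sum (?f b) {0..<N} = sum (?f d) {0..<N}"
      by (intro sum.cong) (auto simp: b_def)
    also have "\<dots> = sum (?f d) {K..<N}"
      using d(2) by (intro sum.mono_neutral_left) (auto simp: K_def)
    finally have "x + h - sum (?f b) {L..<N} = x + h - z - sum (?f d) {K..<N}"
      by simp
    moreover have "padic_abs (x + h - z - sum (?f d) {K..<N}) \<le> real CARD('p) powi (- N)"
      by (rule padic_expansion_tail[OF M'(2,3)]) (use N in \<open>auto simp: K_def\<close>)
    ultimately show "padic_abs (x + h - sum (?f b) {L..<N}) \<le> real CARD('p) powi (- N)"
      by (simp only:)
  qed
  hence "padic_digit (x + h) = b"
    by (rule padic_expansion_unique[OF padic_expansion_digit])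
  moreover have "b j = c j" if "j < 0" for j
    using that by (simp add: b_def)
  ultimately show ?thesis
    by (auto simp: padic_frac_def c_def intro!: sum.cong)
qed

lemma continuous_on_padic_frac: "continuous_on UNIV (padic_frac :: 'p::prime_card padic \<Rightarrow> real)"
  unfolding continuous_on_iff
proof safe
  fix x :: "'p padic" and e :: real assume e: "e > 0"
  show "\<exists>d>0. \<forall>y\<in>UNIV. dist y x < d \<longrightarrow> dist (padic_frac y) (padic_frac x) < e"
  proof (intro exI[of _ 1] conjI ballI impI)
    fix y assume "dist y x < 1"
    hence "padic_frac y = padic_frac x"
      using padic_frac_add_integral[of "y - x" x] by (simp add: dist_padic_def)
    thus "dist (padic_frac y) (padic_frac x) < e"
      using e by simp
  qed simp
qed

lemma continuous_on_padic_mult_right: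
  "continuous_on UNIV (\<lambda>x. x * y :: 'p::prime_card padic)"
  unfolding continuous_on_iff
proof safe
  fix x :: "'p padic" and e :: real assume e: "e > 0"
  show "\<exists>d>0. \<forall>x'\<in>UNIV. dist x' x < d \<longrightarrow> dist (x' * y) (x * y) < e"
  proof (intro exI[of _ "e / (padic_abs y + 1)"] conjI ballI impI)
    have pos: "padic_abs y + 1 > 0"
      using padic_abs_nonneg[of y] by linarith
    thus "e / (padic_abs y + 1) > 0"
      using e by simp
    fix x' assume "dist x' x < e / (padic_abs y + 1)"
    hence "dist x' x * (padic_abs y + 1) < e"
      using pos by (simp add: pos_less_divide_eq)
    moreover have "dist (x' * y) (x * y) = dist x' x * padic_abs y"
      by (simp add: dist_padic_def padic_abs_mult flip: left_diff_distrib)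
    ultimately show "dist (x' * y) (x * y) < e"
      using zero_le_dist[of x' x] by (simp only: distrib_left mult_1_right)
  qed
qed


section \<open>Hausdorff dimension\<close>

text \<open>The convention for \<open>s = 0\<close> is \<open>0\<^sup>0 = 1\<close> for nonempty sets, whereas \<open>0 powr 0 = 0\<close>.\<close>

definition hausdorff_weight :: "real \<Rightarrow> 'a::metric_space set \<Rightarrow> ennreal" where
  "hausdorff_weight s U =
     (if U = {} then 0 else if s = 0 then 1 else ennreal (diameter U powr s))"

definition hausdorff_premeasure :: "real \<Rightarrow> real \<Rightarrow> 'a::metric_space set \<Rightarrow> ennreal" where
  "hausdorff_premeasure s \<delta> A =
     (INF U \<in> {U :: nat \<Rightarrow> 'a set. A \<subseteq> (\<Union>i. U i) \<and> (\<forall>i. bounded (U i) \<and> diameter (U i) \<le> \<delta>)}.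
        \<Sum>i. hausdorff_weight s (U i))"

definition hausdorff_measure :: "real \<Rightarrow> 'a::metric_space set \<Rightarrow> ennreal" where
  "hausdorff_measure s A = (SUP \<delta> \<in> {0<..}. hausdorff_premeasure s \<delta> A)"

definition hausdorff_dim :: "'a::metric_space set \<Rightarrow> ennreal" where
  "hausdorff_dim A = (INF s \<in> {s. 0 \<le> s \<and> hausdorff_measure s A = 0}. ennreal s)"


section \<open>Fourier dimension and Salem sets\<close>

definition measure_support :: "'a::topological_space measure \<Rightarrow> 'a set" where
  "measure_support \<mu> = {x. \<forall>U. open U \<and> x \<in> U \<longrightarrow> emeasure \<mu> U > 0}"

definition padic_fourier :: "'p::prime_card padic measure \<Rightarrow> 'p padic \<Rightarrow> complex" where
  "padic_fourier \<mu> \<xi> = (LINT x|\<mu>. exp (2 * pi * \<i> * of_real (padic_frac (x * \<xi>))))"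

definition borel_prob :: "'a::topological_space measure \<Rightarrow> bool" where
  "borel_prob \<mu> \<longleftrightarrow> sets \<mu> = sets borel \<and> prob_space \<mu>"

definition compact_probs_on :: "'a::topological_space set \<Rightarrow> 'a measure set" where
  "compact_probs_on A =
     {\<mu>. borel_prob \<mu> \<and> compact (measure_support \<mu>) \<and> measure_support \<mu> \<subseteq> A}"

definition fourier_dim :: "'p::prime_card padic set \<Rightarrow> ennreal" where
  "fourier_dim A = (SUP \<beta> \<in> {\<beta>. 0 \<le> \<beta> \<and> \<beta> \<le> 1 \<and>
     (\<exists>\<mu>\<in>compact_probs_on A.
        bdd_above ((\<lambda>\<xi>. (cmod (padic_fourier \<mu> \<xi>))\<^sup>2 * padic_abs \<xi> powr \<beta>) ` (- {0})))}. ennreal \<beta>)"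

definition salem_set :: "'p::prime_card padic set \<Rightarrow> bool" where
  "salem_set A \<longleftrightarrow> hausdorff_dim A = fourier_dim A"


section \<open>Well-approximable \<open>p\<close>-adic integers\<close>

text \<open>At \<open>(q, r) = (0, 0)\<close> the bound reads \<open>0 \<le> 0 powr (- \<tau>)\<close> and holds; a single
  pair does not affect the set.\<close>

definition well_approximable :: "real \<Rightarrow> 'p::prime_card padic set" where
  "well_approximable \<tau> = {x. padic_abs x \<le> 1 \<and>
     infinite {(q :: int, r :: int).
       padic_abs (x * of_int q - of_int r) \<le> real_of_int (max \<bar>q\<bar> \<bar>r\<bar>) powr (- \<tau>)}}"


subsection \<open>Low frequencies\<close>

lemma AE_measure_support:
  fixes \<mu> :: "'p::prime_card padic measure"
  assumes \<mu>: "borel_prob \<mu>"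
  shows "AE x in \<mu>. x \<in> measure_support \<mu>"
proof -
  have sets: "sets \<mu> = sets borel" and prob: "prob_space \<mu>"
    using \<mu> by (auto simp: borel_prob_def)
  have space: "space \<mu> = UNIV"
    using sets_eq_imp_space_eq[OF sets] by simp
  define B where "B = (\<lambda>(r, n). ball (of_rat r :: 'p padic) (inverse (real (Suc n))))"
  define I where "I = {i. emeasure \<mu> (B i) = 0}"
  have Bmeas: "B i \<in> sets \<mu>" for i
    by (cases i) (simp add: sets B_def)
  have "(\<Union>i\<in>I. B i) \<in> null_sets \<mu>"
    by (rule null_sets_UN') (use Bmeas in \<open>auto simp: I_def null_sets_def\<close>)
  moreover have "{x \<in> space \<mu>. x \<notin> measure_support \<mu>} \<subseteq> (\<Union>i\<in>I. B i)"
  proof safe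
    fix x assume "x \<notin> measure_support \<mu>"
    then obtain U where U: "open U" "x \<in> U" "emeasure \<mu> U = 0"
      by (auto simp: measure_support_def)
    from U(1,2) obtain e where e: "e > 0" "ball x e \<subseteq> U"
      by (rule openE)
    obtain n where n: "inverse (real (Suc n)) < e / 2"
      using reals_Archimedean[of "e / 2"] e by auto
    obtain r where r: "dist x (of_rat r) < inverse (real (Suc n))"
      using padic_rat_dense[of "inverse (real (Suc n))" x] by auto
    have "B (r, n) \<subseteq> ball x e"
    proof
      fix z assume "z \<in> B (r, n)"
      hence "dist (of_rat r) z < inverse (real (Suc n))"
        by (simp add: B_def)
      thus "z \<in> ball x e"
        using r n dist_triangle[of x z "of_rat r"] by (simp del: of_nat_Suc)
    qed
    hence "B (r, n) \<subseteq> U"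
      using e(2) by (rule subset_trans)
    hence "emeasure \<mu> (B (r, n)) \<le> emeasure \<mu> U"
      using U(1) by (intro emeasure_mono) (simp_all add: sets)
    hence "(r, n) \<in> I"
      using U by (simp add: I_def)
    moreover have "x \<in> B (r, n)"
      using r by (simp add: B_def dist_commute del: of_nat_Suc)
    ultimately show "x \<in> (\<Union>i\<in>I. B i)"
      by blast
  qed
  ultimately show ?thesis
    by (rule AE_I')
qed

lemma padic_fourier_low_frequency:
  fixes \<mu> :: "'p::prime_card padic measure"
  assumes \<mu>: "borel_prob \<mu>" and supp: "measure_support \<mu> \<subseteq> well_approximable \<tau>"
    and \<xi>: "padic_abs \<xi> \<le> 1"
  shows "padic_fourier \<mu> \<xi> = 1"
proof -
  interpret prob_space \<mu>
    using \<mu> by (simp add: borel_prob_def)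
  have "AE x in \<mu>. exp (2 * pi * \<i> * of_real (padic_frac (x * \<xi>))) = (1 :: complex)"
    using AE_measure_support[OF \<mu>]
  proof eventually_elim
    case (elim x)
    hence "padic_abs (x * \<xi>) \<le> 1"
      unfolding padic_abs_mult
      using supp \<xi> by (intro mult_le_one) (auto simp: well_approximable_def)
    thus ?case
      by (simp add: padic_frac_integral)
  qed
  moreover have "(\<lambda>x. exp (2 * pi * \<i> * of_real (padic_frac (x * \<xi>))) :: complex) \<in> borel_measurable \<mu>"
  proof -
    have "continuous_on UNIV (\<lambda>x. padic_frac (x * \<xi>))"
      using continuous_on_padic_frac continuous_on_padic_mult_right
      by (rule continuous_on_compose2) auto
    hence "(\<lambda>x. exp (2 * pi * \<i> * of_real (padic_frac (x * \<xi>))) :: complex) \<in> borel_measurable borel"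
      by (intro borel_measurable_continuous_onI continuous_intros)
    thus ?thesis
      using \<mu> by (simp add: borel_prob_def cong: measurable_cong_sets)
  qed
  ultimately have "padic_fourier \<mu> \<xi> = (LINT x|\<mu>. 1)"
    unfolding padic_fourier_def by (intro integral_cong_AE) auto
  thus ?thesis
    by (simp add: prob_space)
qed

text \<open>Consequently a bound by \<open>padic_abs \<xi> powr (- 1 / \<tau>) * (ln (1 + padic_abs \<xi>))\<^sup>2\<close> up to a
  constant, which tends to \<open>0\<close> as \<open>\<xi> \<rightarrow> 0\<close> because it is of order \<open>padic_abs \<xi> powr (2 - 1 / \<tau>)\<close>,
  cannot hold at all nonzero frequencies, only for \<open>padic_abs \<xi>\<close> bounded below.\<close>

lemma padic_fourier_no_bound_near_0:
  fixes \<mu> :: "'p::prime_card padic measure"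
  assumes \<mu>: "borel_prob \<mu>" and supp: "measure_support \<mu> \<subseteq> well_approximable \<tau>"
    and \<tau>: "\<tau> > 2"
  shows "\<not> (\<forall>\<xi>. \<xi> \<noteq> 0 \<longrightarrow> cmod (padic_fourier \<mu> \<xi>)
      \<le> C * (padic_abs \<xi> powr (- 1 / \<tau>) * (ln (1 + padic_abs \<xi>))\<^sup>2))"
proof
  assume bound: "\<forall>\<xi>. \<xi> \<noteq> 0 \<longrightarrow> cmod (padic_fourier \<mu> \<xi>)
      \<le> C * (padic_abs \<xi> powr (- 1 / \<tau>) * (ln (1 + padic_abs \<xi>))\<^sup>2)"
  define q where "q = inverse (real CARD('p))"
  have q: "0 < q" "q < 1"
    using prime_gt_1_nat[OF prime_card[where 'a='p]] by (auto simp: q_def field_simps)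
  have le: "1 \<le> \<bar>C\<bar> * q ^ n" for n
  proof -
    let ?\<xi> = "of_nat CARD('p) ^ n :: 'p padic"
    have abs: "padic_abs ?\<xi> = q ^ n"
      by (simp add: padic_abs_power padic_abs_p q_def)
    have qn: "0 < q ^ n" "q ^ n \<le> 1"
      using q by (auto intro: power_le_one)
    have "1 = cmod (padic_fourier \<mu> ?\<xi>)"
      using padic_fourier_low_frequency[OF \<mu> supp, of ?\<xi>] abs qn by simp
    also have "\<dots> \<le> C * ((q ^ n) powr (- 1 / \<tau>) * (ln (1 + q ^ n))\<^sup>2)"
      using bound[rule_format, of ?\<xi>] abs by simp
    also have "\<dots> \<le> \<bar>C\<bar> * ((q ^ n) powr (- 1 / \<tau>) * (ln (1 + q ^ n))\<^sup>2)"
      by (intro mult_right_mono) auto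
    also have "\<dots> \<le> \<bar>C\<bar> * ((q ^ n) powr (- 1) * (q ^ n)\<^sup>2)"
    proof (intro mult_left_mono mult_mono power_mono)
      show "(q ^ n) powr (- 1 / \<tau>) \<le> (q ^ n) powr (- 1)"
        using qn \<tau> by (intro powr_mono') (auto simp: field_simps)
      show "ln (1 + q ^ n) \<le> q ^ n"
        using qn by (intro ln_add_one_self_le_self) auto
    qed (use qn in auto)
    also have "\<dots> = \<bar>C\<bar> * q ^ n"
      using qn by (simp add: powr_minus power2_eq_square field_simps)
    finally show ?thesis .
  qed
  have "(\<lambda>n. \<bar>C\<bar> * q ^ n) \<longlonglongrightarrow> 0"
    using q by (intro tendsto_mult_right_zero LIMSEQ_power_zero) auto
  hence "(1 :: real) \<le> 0"
    by (rule LIMSEQ_le_const) (use le in blast)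
  thus False
    by simp
qed

end

theory Submission
  imports Defs
begin

text \<open>The cover of \<open>W(\<tau>)\<close> by the balls around the fractions \<open>r / q\<close> with \<open>p\<close> not dividing \<open>q\<close> gives
  \<open>dim\<^sub>H \<le> 2 / \<tau>\<close>, and \<open>dim\<^sub>F \<le> dim\<^sub>H\<close> follows from Parseval's identity on \<open>\<int> / p\<^sup>n\<close>, which bounds
  the energy of a measure by its Fourier decay. For the lower bound take the law of a random
  point built in stages: given the point modulo \<open>p\<^sup>L\<close>, choose a random prime \<open>q\<close> between \<open>p\<close> to the
  \<open>k div 2\<close> and \<open>p\<^sup>k\<close>, with \<open>k\<close> much larger than \<open>L\<close>, and make the point congruent to
  \<open>(s + p\<^sup>L (v + w)) / q\<close> modulo \<open>p\<close> to the \<open>\<lceil>k \<tau>\<rceil>\<close>, where \<open>v\<close> and \<open>w\<close> are independent and uniform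
  below \<open>V = p\<close> to the \<open>k - 1 - L\<close> and \<open>s\<close> is forced by the earlier stages. At a frequency of absolute
  value \<open>p\<^sup>n\<close> belonging to this stage the Fourier coefficient is at most the average over \<open>q\<close> of the
  square of a normalised geometric sum of length \<open>V\<close>. It vanishes for \<open>n < k\<close>; for \<open>n \<ge> k\<close> a large term needs
  a small integer \<open>t \<equiv> a\<close> divisible by \<open>q\<close>, and only \<open>O(n / k)\<close> of the primes \<open>q\<close> divide a given \<open>t\<close>.
  Chebyshev's bound \<open>\<pi>(x) \<ge> c x / ln x\<close> then yields \<open>O(n p\<^sup>L / p\<^sup>k)\<close>, and \<open>p\<^sup>L \<le> k \<le> n\<close>. The second
  geometric sum is what saves a logarithm, and all constants are independent of \<open>\<tau>\<close>.\<close>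


section \<open>Characters, residues and frequencies\<close>

text \<open>A frequency of absolute value \<open>p ^ n\<close> sees a point only modulo
  \<open>p ^ n\<close>, so its coefficient is decided by the one stage whose levels surround
  \<open>n\<close>: later choices are invisible, and earlier ones enter only as a starting residue.
  The stage average is bounded uniformly in that residue, so nothing about the law of the past is
  used beyond its total mass. The two powers of the logarithm have separate origins: one factor
  \<open>n\<close> comes from counting prime divisors, the other from the price \<open>p ^ L\<close>
  of agreeing with the past. A single geometric sum would replace the weights
  \<open>(P / |j|)^2\<close> in the sum over \<open>t = a' + j m\<close> by \<open>P / |j|\<close>,
  whose sum over \<open>|j| \<le> p ^ k\<close> costs a further logarithm, of order
  \<open>k\<close>. Every outcome of the random choices, and not only almost every one, satisfies
  the approximations; being conditions of finite \<open>p\<close>-adic precision, they pass to the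
  closed support. The covering half has its own obstacle: a denominator divisible by
  \<open>p\<close> enlarges the neighbourhood of the fraction, and one fraction may recur through
  infinitely many multiples by powers of \<open>p\<close>.\<close>

lemma padic_abs_le_iff_dvd:
  "padic_abs (of_int b :: 'p::prime_card padic) \<le> inverse (real CARD('p)) ^ n \<longleftrightarrow> int CARD('p) ^ n dvd b"
proof (cases "b = 0")
  case False
  let ?p = "CARD('p)"
  have p: "prime ?p" by (rule prime_card)
  have p1: "real ?p > 1" using prime_gt_1_nat[OF p] by simp
  have "padic_abs (of_int b :: 'p padic) \<le> inverse (real ?p) ^ n \<longleftrightarrow>
      real ?p powi (- int (multiplicity (int ?p) b)) \<le> real ?p powi (- int n)"
    using False p by (simp add: rat_pabs_of_int power_int_minus power_inverse)
  also have "\<dots> \<longleftrightarrow> n \<le> multiplicity (int ?p) b"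
    using p1 power_int_strict_increasing[of "- int (multiplicity (int ?p) b)" "- int n" "real ?p"]
      power_int_strict_increasing[of "- int n" "- int (multiplicity (int ?p) b)" "real ?p"]
    by (metis less_le not_le of_nat_le_iff neg_le_iff_le order.order_iff_strict neg_less_iff_less of_nat_less_iff)
  also have "\<dots> \<longleftrightarrow> int ?p ^ n dvd b"
    using False p by (intro power_dvd_iff_le_multiplicity[symmetric]) (auto simp: not_prime_unit)
  finally show ?thesis .
qed auto

lemma padic_abs_of_int_eq_1:
  assumes "\<not> int CARD('p) dvd b"
  shows "padic_abs (of_int b :: 'p::prime_card padic) = 1"
  using assms prime_card[where 'a='p]
  by (cases "b = 0") (auto simp: rat_pabs_of_int not_dvd_imp_multiplicity_0)

lemma padic_p_gt_1: "1 < real CARD('p::prime_card)"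
  using prime_gt_1_nat[OF prime_card[where 'a='p]] by simp

lemma padic_abs_p_power:
  "padic_abs (of_nat CARD('p) ^ n :: 'p::prime_card padic) = inverse (real CARD('p)) ^ n"
  by (simp add: padic_abs_power padic_abs_p)

lemma padic_abs_div_p_power:
  "padic_abs (x / of_nat CARD('p) ^ n) = padic_abs (x :: 'p::prime_card padic) * real CARD('p) ^ n"
  by (simp add: divide_inverse padic_abs_mult padic_abs_inverse padic_abs_p_power power_inverse)

text \<open>The digit expansion truncated at \<open>j < 0\<close> is the same expression in \<open>\<rat>\<^sub>p\<close> and in \<open>\<real>\<close>.\<close>
lemma padic_frac_approx:
  fixes y :: "'p::prime_card padic"
  obtains b :: int and n :: nat where "padic_frac y = of_int b / real CARD('p) ^ n"
    "padic_abs (y - of_int b / of_nat CARD('p) ^ n) \<le> 1"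
proof -
  let ?P = "of_nat CARD('p) :: 'p padic"
  have p1: "1 < real CARD('p)" by (rule padic_p_gt_1)
  obtain M where c: "\<And>j. padic_digit y j < CARD('p)" and M: "\<forall>j<M. padic_digit y j = 0"
    "(\<lambda>n. \<Sum>j\<in>{M..<M + int n}. of_nat (padic_digit y j) * ?P powi j) \<longlonglongrightarrow> y"
    using padic_expansion_digit[of y] unfolding padic_expansion_def by blast
  define n where "n = nat (- M)"
  have n: "- int n \<le> M" by (simp add: n_def)
  define b where "b = (\<Sum>j\<in>{- int n..<0}. int (padic_digit y j) * int CARD('p) ^ nat (j + int n))"
  have pw: "x powi j = x ^ nat (j + int n) / x ^ n" if "x \<noteq> 0" "j \<ge> - int n" for x :: "'b::field" and j
  proof -
    have "x ^ nat (j + int n) = x powi (j + int n)"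
      using that by (simp add: power_int_def)
    also have "\<dots> = x powi j * x ^ n"
      using that by (simp add: power_int_add)
    finally show ?thesis using that by simp
  qed
  have A: "(\<Sum>j\<in>{- int n..<0}. of_nat (padic_digit y j) * ?P powi j) = of_int b / ?P ^ n"
    unfolding b_def of_int_sum sum_divide_distrib
    by (intro sum.cong) (auto simp: pw)
  have "padic_frac y = (\<Sum>j\<in>{- int n..<0}. real (padic_digit y j) * real CARD('p) powi j)"
    unfolding padic_frac_def
  proof (rule sum.mono_neutral_left)
    show "{j. j < 0 \<and> padic_digit y j \<noteq> 0} \<subseteq> {- int n..<0}"
      using M(1) n by (auto, metis (no_types) leI neq0_conv order_trans)
  qed auto
  also have "\<dots> = of_int b / real CARD('p) ^ n"
    unfolding b_def of_int_sum sum_divide_distrib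
    using p1 by (intro sum.cong) (auto simp: pw)
  finally have "padic_frac y = of_int b / real CARD('p) ^ n" .
  moreover have "padic_abs (y - of_int b / ?P ^ n) \<le> real CARD('p) powi (- 0)"
    unfolding A[symmetric]
    by (rule padic_expansion_tail[OF M]) (use n in auto)
  ultimately show thesis
    using that by simp
qed

text \<open>The standard additive character of the \<open>p\<close>-adic numbers, trivial on the
  integral ones.\<close>

definition padic_char :: "'p::prime_card padic \<Rightarrow> complex" where
  "padic_char y = exp (2 * pi * \<i> * of_real (padic_frac y))"

lemma cis_2pi_of_int: "cis (2 * pi * of_int k) = 1"
  by (simp add: cis_conv_exp exp_eq_1)

lemma cis_2pi_cong:
  assumes "int m dvd a - b" "m > 0"
  shows "cis (2 * pi * of_int a / of_nat m) = cis (2 * pi * of_int b / of_nat m)"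
proof -
  obtain k where k: "a - b = int m * k" using assms by auto
  hence "a = b + int m * k" by simp
  hence "2 * pi * of_int a / of_nat m = 2 * pi * of_int b / of_nat m + 2 * pi * of_int k"
    using assms(2) by (simp add: field_simps)
  thus ?thesis
    using cis_2pi_of_int[of k] by (simp only: cis_mult[symmetric]) simp
qed

text \<open>Two fractions with powers of \<open>p\<close> as denominators that both differ from
  \<open>y\<close> by \<open>p\<close>-adic integers differ by an ordinary integer, which
  \<open>cis\<close> does not see. Hence any such approximation, not only
  \<open>padic_frac y\<close>, computes the character.\<close>

lemma padic_char_eq_cis:
  fixes y :: "'p::prime_card padic"
  assumes y: "padic_abs (y - of_int b / of_nat CARD('p) ^ n) \<le> 1"
  shows "padic_char y = cis (2 * pi * of_int b / of_nat (CARD('p) ^ n))"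
proof -
  let ?P = "of_nat CARD('p) :: 'p padic" and ?p = "CARD('p)"
  have p1: "1 < real ?p" by (rule padic_p_gt_1)
  obtain b' m where b': "padic_frac y = of_int b' / real ?p ^ m"
    "padic_abs (y - of_int b' / ?P ^ m) \<le> 1"
    by (rule padic_frac_approx)
  let ?d = "b * int ?p ^ m - b' * int ?p ^ n"
  have "padic_abs ((y - of_int b' / ?P ^ m) - (y - of_int b / ?P ^ n)) \<le> 1"
    using padic_abs_ultra[of "y - of_int b' / ?P ^ m" "- (y - of_int b / ?P ^ n)"] b'(2) y
    by (simp only: padic_abs_minus flip: diff_conv_add_uminus)
  also have "(y - of_int b' / ?P ^ m) - (y - of_int b / ?P ^ n) = of_int ?d / ?P ^ (m + n)"
  proof -
    have "?P ^ m \<noteq> 0" "?P ^ n \<noteq> 0" using p1 by auto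
    moreover have "u \<noteq> 0 \<Longrightarrow> v \<noteq> 0 \<Longrightarrow> (y - a' / u) - (y - a / v) = (a * u - a' * v) / (u * v)"
      for u v a a' :: "'p padic"
      by (simp add: field_simps)
    ultimately show ?thesis by (simp add: power_add)
  qed
  finally have "padic_abs (of_int ?d :: 'p padic) * real ?p ^ (m + n) \<le> 1"
    by (simp only: padic_abs_div_p_power)
  hence "padic_abs (of_int ?d :: 'p padic) \<le> inverse (real ?p) ^ (m + n)"
    using p1 by (simp only: power_inverse) (simp add: field_simps del: padic_abs_of_int)
  hence dvd: "int (?p ^ (m + n)) dvd b * int ?p ^ m - b' * int ?p ^ n"
    by (simp only: padic_abs_le_iff_dvd of_nat_power)
  have "padic_char y = cis (2 * pi * of_int b' / real ?p ^ m)"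
    by (simp add: padic_char_def b'(1) cis_conv_exp mult_ac)
  also have "\<dots> = cis (2 * pi * of_int (b' * int ?p ^ n) / of_nat (?p ^ (m + n)))"
    using p1 by (simp add: power_add field_simps)
  also have "\<dots> = cis (2 * pi * of_int (b * int ?p ^ m) / of_nat (?p ^ (m + n)))"
    by (rule cis_2pi_cong[symmetric]) (use dvd p1 in auto)
  also have "\<dots> = cis (2 * pi * of_int b / of_nat (?p ^ n))"
    using p1 by (simp add: power_add field_simps)
  finally show ?thesis .
qed

lemma padic_integer_residue:
  fixes x :: "'p::prime_card padic"
  assumes "padic_abs x \<le> 1"
  obtains b :: nat where "b < CARD('p) ^ n" "padic_abs (x - of_nat b) \<le> inverse (real CARD('p)) ^ n"
proof -
  have "\<exists>b<CARD('p) ^ n. padic_abs (x - of_nat b) \<le> inverse (real CARD('p)) ^ n"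
    using assms
  proof (induction n)
    case 0
    thus ?case by simp
  next
    case (Suc n)
    let ?p = "CARD('p)" and ?P = "of_nat CARD('p) :: 'p padic"
    have p1: "1 < real ?p" by (rule padic_p_gt_1)
    obtain b where b: "b < ?p ^ n" "padic_abs (x - of_nat b) \<le> inverse (real ?p) ^ n"
      using Suc by blast
    have "padic_abs ((x - of_nat b) / ?P ^ n) \<le> inverse (real ?p) ^ n * real ?p ^ n"
      unfolding padic_abs_div_p_power using b(2) by (intro mult_right_mono) auto
    also have "\<dots> = 1" using p1 by (simp add: power_inverse)
    finally obtain d where d: "d < ?p" "padic_abs ((x - of_nat b) / ?P ^ n - of_nat d) \<le> inverse (real ?p)"
      using padic_digit_ex by blast
    have "x - of_nat (b + d * ?p ^ n) = ((x - of_nat b) / ?P ^ n - of_nat d) * ?P ^ n"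
      by (simp add: field_simps)
    hence "padic_abs (x - of_nat (b + d * ?p ^ n)) = padic_abs ((x - of_nat b) / ?P ^ n - of_nat d) * inverse (real ?p) ^ n"
      by (simp only: padic_abs_mult padic_abs_p_power)
    also have "\<dots> \<le> inverse (real ?p) * inverse (real ?p) ^ n"
      using d by (intro mult_right_mono) auto
    finally have "padic_abs (x - of_nat (b + d * ?p ^ n)) \<le> inverse (real ?p) ^ Suc n" by simp
    moreover have "b + d * ?p ^ n < ?p ^ Suc n"
    proof -
      have "b + d * ?p ^ n < (1 + d) * ?p ^ n" using b by simp
      also have "\<dots> \<le> ?p * ?p ^ n" using d by (intro mult_right_mono) auto
      finally show ?thesis by simp
    qed
    ultimately show ?case by blast
  qed
  thus thesis using that by blast
qed

lemma padic_abs_diff_le: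
  fixes x y z :: "'p::prime_card padic"
  assumes "padic_abs (x - y) \<le> r" "padic_abs (y - z) \<le> r"
  shows "padic_abs (x - z) \<le> r"
  using padic_abs_ultra[of "x - y" "y - z"] assms by simp

text \<open>The residues modulo \<open>p ^ n\<close> form a finite net. The compactness demanded by
  \<open>compact_probs_on\<close> is met through this.\<close>

lemma compact_padic_integers: "compact {x :: 'p::prime_card padic. padic_abs x \<le> 1}"
  unfolding compact_eq_totally_bounded
proof (intro conjI allI impI)
  have "{x :: 'p padic. padic_abs x \<le> 1} = cball 0 1"
    by (auto simp: dist_padic_def)
  thus "uniform_space_class.complete {x :: 'p padic. padic_abs x \<le> 1}"
    by (simp add: complete_eq_closed)
  fix e :: real assume e: "e > 0"
  obtain n where n: "inverse (real CARD('p)) ^ n < e"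
    using real_arch_pow_inv[OF e, of "inverse (real CARD('p))"] padic_p_gt_1[where 'p='p]
    by (auto simp: field_simps)
  show "\<exists>k. finite k \<and> {x :: 'p padic. padic_abs x \<le> 1} \<subseteq> (\<Union>x\<in>k. ball x e)"
  proof (intro exI[of _ "of_nat ` {..<CARD('p) ^ n}"] conjI subsetI)
    fix x :: "'p padic" assume "x \<in> {x. padic_abs x \<le> 1}"
    then obtain b where b: "b < CARD('p) ^ n" "padic_abs (x - of_nat b) \<le> inverse (real CARD('p)) ^ n"
      using padic_integer_residue by blast
    thus "x \<in> (\<Union>x\<in>of_nat ` {..<CARD('p) ^ n}. ball x e)"
      using n by (auto simp: dist_padic_def padic_abs_diff_commute intro!: bexI[of _ b])
  qed auto
qed

text \<open>Both variables may be replaced by integers: the error splits into \<open>x\<close> times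
  an integral element and a multiple of \<open>p ^ n\<close> divided by \<open>p ^ n\<close>, each
  of absolute value at most 1.\<close>

lemma padic_char_mult_eq_cis:
  fixes x \<xi> :: "'p::prime_card padic"
  assumes x: "padic_abs (x - of_int b) \<le> inverse (real CARD('p)) ^ n" "padic_abs x \<le> 1"
    and \<xi>: "padic_abs (\<xi> - of_int a / of_nat CARD('p) ^ n) \<le> 1"
  shows "padic_char (x * \<xi>) = cis (2 * pi * of_int (a * b) / of_nat (CARD('p) ^ n))"
proof (rule padic_char_eq_cis)
  let ?P = "of_nat CARD('p) :: 'p padic" and ?p = "CARD('p)"
  have p1: "1 < real ?p" by (rule padic_p_gt_1)
  have "x * \<xi> - of_int (a * b) / ?P ^ n
      = x * (\<xi> - of_int a / ?P ^ n) + (x - of_int b) * of_int a / ?P ^ n"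
    by (simp add: algebra_simps diff_divide_distrib)
  also have "padic_abs \<dots> \<le> max (padic_abs (x * (\<xi> - of_int a / ?P ^ n)))
      (padic_abs ((x - of_int b) * of_int a / ?P ^ n))"
    by (rule padic_abs_ultra)
  also have "padic_abs (x * (\<xi> - of_int a / ?P ^ n)) \<le> 1"
    unfolding padic_abs_mult using x \<xi> by (intro mult_le_one) auto
  also have "padic_abs ((x - of_int b) * of_int a / ?P ^ n)
      \<le> (inverse (real ?p) ^ n * 1) * real ?p ^ n"
    unfolding padic_abs_div_p_power unfolding padic_abs_mult
    using x rat_pabs_of_int_le_1[OF prime_card[where 'a='p], of a]
    by (intro mult_right_mono mult_mono) auto
  also have "\<dots> = 1"
    using p1 by (simp add: power_inverse)
  finally show "padic_abs (x * \<xi> - of_int (a * b) / ?P ^ n) \<le> 1" by simp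
qed

text \<open>By the ultrametric inequality a rational closer to \<open>x\<close> than
  \<open>padic_abs x\<close> has the same absolute value, and nonzero rationals have powers of
  \<open>p\<close> as values.\<close>

lemma padic_abs_eq_powi:
  fixes x :: "'p::prime_card padic"
  assumes "x \<noteq> 0"
  obtains j :: int where "padic_abs x = real CARD('p) powi j"
proof -
  let ?p = "CARD('p)"
  have pos: "padic_abs x > 0" using assms padic_abs_nonneg[of x] padic_abs_eq_0_iff[of x] by linarith
  obtain r where r: "dist x (of_rat r) < padic_abs x" using padic_rat_dense[OF pos] by blast
  have "padic_abs x = padic_abs (of_rat r :: 'p padic)"
  proof (rule antisym)
    show "padic_abs x \<le> padic_abs (of_rat r :: 'p padic)"
      using padic_abs_ultra[of "x - of_rat r" "of_rat r"] r by (auto simp: dist_padic_def)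
    show "padic_abs (of_rat r :: 'p padic) \<le> padic_abs x"
      using padic_abs_ultra[of "of_rat r - x" "x"] r by (auto simp: dist_padic_def padic_abs_diff_commute)
  qed
  hence "padic_abs x = rat_pabs ?p r" by simp
  thus thesis using that pos by (auto simp: rat_pabs_def split: if_splits)
qed

lemma padic_frequency_representation:
  fixes \<xi> :: "'p::prime_card padic"
  assumes "padic_abs \<xi> > 1"
  obtains n :: nat and a :: int where "n \<ge> 1" "padic_abs \<xi> = real CARD('p) ^ n" "\<not> int CARD('p) dvd a"
    "padic_abs (\<xi> - of_int a / of_nat CARD('p) ^ n) \<le> 1"
proof -
  let ?P = "of_nat CARD('p) :: 'p padic" and ?p = "CARD('p)"
  have p1: "1 < real ?p" by (rule padic_p_gt_1)
  have "\<xi> \<noteq> 0" using assms by auto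
  then obtain j where j: "padic_abs \<xi> = real ?p powi j" by (rule padic_abs_eq_powi)
  have "j > 0"
  proof (rule ccontr)
    assume "\<not> j > 0"
    hence "real ?p powi j \<le> real ?p powi 0" using p1 by (intro power_int_increasing) auto
    thus False using assms j by simp
  qed
  define n where "n = nat j"
  have n: "n \<ge> 1" "padic_abs \<xi> = real ?p ^ n" using \<open>j > 0\<close> j by (auto simp: n_def power_int_def)
  \<comment> \<open>Scaled to a unit, the frequency has a residue \<open>a\<close> modulo
    \<open>p ^ n\<close>, and a unit has a residue prime to \<open>p\<close>.\<close>
  have "padic_abs (\<xi> * ?P ^ n) = 1"
    using p1 by (simp add: padic_abs_mult padic_abs_p_power n power_inverse)
  then obtain a where a: "padic_abs (\<xi> * ?P ^ n - of_nat a) \<le> inverse (real ?p) ^ n"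
    using padic_integer_residue[of "\<xi> * ?P ^ n" n] by force
  have "\<not> int ?p ^ 1 dvd int a"
  proof
    assume "int ?p ^ 1 dvd int a"
    hence "padic_abs (of_int (int a) :: 'p padic) \<le> inverse (real ?p) ^ 1"
      by (subst padic_abs_le_iff_dvd)
    hence "padic_abs (of_nat a :: 'p padic) \<le> inverse (real ?p)" by (simp del: padic_abs_of_int)
    moreover have "inverse (real ?p) ^ n \<le> inverse (real ?p) ^ 1"
      using p1 n by (intro power_decreasing) (auto simp: field_simps)
    hence "padic_abs (\<xi> * ?P ^ n - of_nat a) \<le> inverse (real ?p)"
      using a by simp
    ultimately have "padic_abs (\<xi> * ?P ^ n) \<le> inverse (real ?p)"
      using padic_abs_ultra[of "\<xi> * ?P ^ n - of_nat a" "of_nat a"] by simp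
    thus False using \<open>padic_abs (\<xi> * ?P ^ n) = 1\<close> p1 by (simp add: field_simps)
  qed
  moreover have "padic_abs (\<xi> - of_int (int a) / ?P ^ n) \<le> 1"
  proof -
    have "\<xi> - of_int (int a) / ?P ^ n = (\<xi> * ?P ^ n - of_nat a) / ?P ^ n"
      by (simp add: field_simps)
    hence "padic_abs (\<xi> - of_int (int a) / ?P ^ n) \<le> inverse (real ?p) ^ n * real ?p ^ n"
      using a by (simp only: padic_abs_div_p_power) (intro mult_right_mono, auto)
    thus ?thesis using p1 by (simp add: power_inverse)
  qed
  ultimately show thesis using that[of n "int a"] n by simp
qed


section \<open>The upper bound for the Hausdorff dimension\<close>

lemma hausdorff_measure_eq_0I:
  assumes "\<And>\<delta> \<epsilon> :: real. \<delta> > 0 \<Longrightarrow> \<epsilon> > 0 \<Longrightarrow> \<exists>U :: nat \<Rightarrow> 'a::metric_space set. A \<subseteq> (\<Union>i. U i) \<and>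
      (\<forall>i. bounded (U i) \<and> diameter (U i) \<le> \<delta>) \<and> (\<Sum>i. hausdorff_weight s (U i)) \<le> ennreal \<epsilon>"
  shows "hausdorff_measure s A = 0"
proof -
  have "hausdorff_premeasure s \<delta> A \<le> 0" if "\<delta> > 0" for \<delta>
  proof (rule ennreal_le_epsilon)
    fix e :: real assume "e > 0"
    then obtain U where "A \<subseteq> (\<Union>i. U i) \<and> (\<forall>i. bounded (U i) \<and> diameter (U i) \<le> \<delta>)"
      "(\<Sum>i. hausdorff_weight s (U i)) \<le> ennreal e"
      using assms[OF \<open>\<delta> > 0\<close>] by blast
    thus "hausdorff_premeasure s \<delta> A \<le> 0 + ennreal e"
      unfolding hausdorff_premeasure_def by (auto intro: INF_lower2)
  qed
  thus ?thesis
    unfolding hausdorff_measure_def by (simp add: SUP_eq_const le_zero_eq)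
qed

lemma metric_diameter_le:
  fixes S :: "'a::metric_space set"
  assumes "\<And>x y. x \<in> S \<Longrightarrow> y \<in> S \<Longrightarrow> dist x y \<le> d" "0 \<le> d"
  shows "bounded S" "diameter S \<le> d"
proof -
  show "bounded S"
    unfolding bounded_def using assms by (cases "S = {}") blast+
  show "diameter S \<le> d"
  proof (cases "S = {}")
    case False
    hence "(SUP (x, y)\<in>S \<times> S. dist x y) \<le> d"
      using assms by (intro cSUP_least) auto
    thus ?thesis using False by (simp add: diameter_def)
  qed (use assms in \<open>simp add: diameter_def\<close>)
qed

text \<open>Common powers of \<open>p\<close> can be cancelled from a good approximation since \<open>\<tau> \<ge> 1\<close>.\<close>
lemma well_approximable_coprime:
  fixes x :: "'p::prime_card padic"
  assumes x: "x \<in> well_approximable \<tau>" and \<tau>: "\<tau> > 1"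
  shows "\<exists>q r. \<not> int CARD('p) dvd q \<and> real N \<le> real_of_int (max \<bar>q\<bar> \<bar>r\<bar>) \<and>
    padic_abs (x * of_int q - of_int r) \<le> real_of_int (max \<bar>q\<bar> \<bar>r\<bar>) powr (- \<tau>)"
proof (rule ccontr)
  assume neg: "\<not> ?thesis"
  let ?p = "CARD('p)" and ?P = "of_nat CARD('p) :: 'p padic"
  let ?H = "\<lambda>q r :: int. real_of_int (max \<bar>q\<bar> \<bar>r\<bar>)"
  let ?good = "\<lambda>q r. padic_abs (x * of_int q - of_int r) \<le> ?H q r powr (- \<tau>)"
  have p: "prime ?p" by (rule prime_card)
  have p1: "1 < real ?p" by (rule padic_p_gt_1)
  have p1': "1 < ?p" using p1 by simp
  have x1: "padic_abs x \<le> 1" and inf: "infinite {(q, r). ?good q r}"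
    using x by (auto simp: well_approximable_def)
  \<comment> \<open>Under the negated claim \<open>B\<close> contains every good pair whose
    \<open>q\<close> is prime to \<open>p\<close>.\<close>
  define B where "B = {(q, r) | q r. \<not> int ?p dvd q \<and> ?H q r < N}"
  have finB: "finite B"
  proof (rule finite_subset)
    show "B \<subseteq> {- int N..int N} \<times> {- int N..int N}"
      by (auto simp: B_def)
  qed auto
  \<comment> \<open>Cancelling \<open>p ^ k\<close> multiplies the error by \<open>p ^ k\<close> but
    shrinks the height by the same factor, which enters with exponent \<open>\<tau> > 1\<close>: the
    reduced pair is better than good by \<open>p ^ (k (1 - \<tau>))\<close>.\<close>
  have reduce: "\<exists>k q' r'. q = int ?p ^ k * q' \<and> r = int ?p ^ k * r' \<and> (q', r') \<in> B \<and>
      padic_abs (x * of_int q' - of_int r') \<le> (real ?p powr (1 - \<tau>)) ^ k"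
    if good: "?good q r" and q0: "q \<noteq> 0" for q r
  proof -
    define k where "k = multiplicity (int ?p) q"
    obtain q' where q': "q = int ?p ^ k * q'" "\<not> int ?p dvd q'"
      using multiplicity_decompose'[of q "int ?p" thesis] q0 p p1' unfolding k_def by auto
    have pk: "1 \<le> real ?p ^ k" using p1 by (simp add: one_le_power)
    have p0: "(real ?p) > 0" using p1 by simp
    have pkH: "real ?p ^ k \<le> ?H q r"
    proof -
      have "int ?p ^ k \<le> \<bar>q\<bar>"
        using q0 by (intro zdvd_imp_le) (auto simp: k_def multiplicity_dvd)
      hence "int (?p ^ k) \<le> max \<bar>q\<bar> \<bar>r\<bar>" by simp
      hence "real_of_int (int (?p ^ k)) \<le> ?H q r" by (simp only: of_int_le_iff)
      thus ?thesis by simp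
    qed
    \<comment> \<open>The error is at most the inverse height, hence at most
      \<open>p ^ (- k)\<close>; so the power of \<open>p\<close> in \<open>q\<close> must divide
      \<open>r\<close> as well.\<close>
    have "?H q r powr (- \<tau>) \<le> ?H q r powr (- 1)"
      using \<tau> order_trans[OF pk pkH] by (intro powr_mono) linarith+
    also have "\<dots> \<le> inverse (real ?p) ^ k"
      using pk pkH by (simp add: powr_minus power_inverse le_imp_inverse_le)
    finally have small: "padic_abs (x * of_int q - of_int r) \<le> inverse (real ?p) ^ k"
      using good by linarith
    have "padic_abs (x * of_int q) \<le> 1 * inverse (real ?p) ^ k"
      unfolding padic_abs_mult
      using x1 padic_abs_le_iff_dvd[of q k, where 'p='p] q'(1) by (intro mult_mono) auto
    hence "padic_abs (of_int r :: 'p padic) \<le> inverse (real ?p) ^ k"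
      using padic_abs_diff_le[of "of_int r" "x * of_int q" "inverse (real ?p) ^ k" 0] small
      by (simp add: padic_abs_diff_commute del: padic_abs_of_int)
    hence "int ?p ^ k dvd r" by (simp only: padic_abs_le_iff_dvd)
    then obtain r' where r': "r = int ?p ^ k * r'" by auto
    have q'0: "q' \<noteq> 0" using q0 q' by auto
    have H: "?H q r = real ?p ^ k * ?H q' r'"
      unfolding q'(1) r' of_int_max abs_mult of_int_abs of_int_mult
      using p1 by (simp add: max_mult_distrib_left)
    have H1: "1 \<le> ?H q' r'" using q'0 by (simp add: le_max_iff_disj) linarith
    have "x * of_int q - of_int r = (x * of_int q' - of_int r') * ?P ^ k"
      by (simp add: q'(1) r' algebra_simps)
    hence "padic_abs (x * of_int q - of_int r) = padic_abs (x * of_int q' - of_int r') * inverse (real ?p) ^ k"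
      by (simp only: padic_abs_mult padic_abs_p_power)
    hence "padic_abs (x * of_int q' - of_int r') = real ?p ^ k * padic_abs (x * of_int q - of_int r)"
      using p1 by (simp add: power_inverse)
    also have "\<dots> \<le> real ?p ^ k * (real ?p ^ k * ?H q' r') powr (- \<tau>)"
      using good unfolding H by (intro mult_left_mono) auto
    also have "\<dots> = (real ?p powr (1 - \<tau>)) ^ k * ?H q' r' powr (- \<tau>)"
    proof -
      have "(real ?p powr (1 - \<tau>)) ^ k = real ?p powr (real k + real k * (- \<tau>))"
        using p1 by (simp add: powr_power algebra_simps)
      also have "\<dots> = real ?p ^ k * (real ?p ^ k) powr (- \<tau>)"
        unfolding powr_add using p1 by (simp only: powr_powr[symmetric] powr_realpow[OF p0])
      finally have "(real ?p powr (1 - \<tau>)) ^ k = real ?p ^ k * (real ?p ^ k) powr (- \<tau>)" .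
      thus ?thesis using p1 H1 by (subst powr_mult) auto
    qed
    finally have le: "padic_abs (x * of_int q' - of_int r') \<le> (real ?p powr (1 - \<tau>)) ^ k * ?H q' r' powr (- \<tau>)" .
    have c1: "(real ?p powr (1 - \<tau>)) ^ k \<le> 1"
      using p1 \<tau> powr_mono[of "1 - \<tau>" 0 "real ?p"] by (intro power_le_one) auto
    have c2: "?H q' r' powr (- \<tau>) \<le> 1"
      using H1 \<tau> powr_mono[of "- \<tau>" 0 "?H q' r'"] by auto
    have "?good q' r'"
      using le mult_right_mono[OF c1, of "?H q' r' powr (- \<tau>)"] by simp
    hence "(q', r') \<in> B"
      using neg q'(2) by (force simp: B_def not_le)
    moreover have "padic_abs (x * of_int q' - of_int r') \<le> (real ?p powr (1 - \<tau>)) ^ k"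
      using mult_left_mono[OF c2, of "(real ?p powr (1 - \<tau>)) ^ k"] by (intro order_trans[OF le]) simp
    ultimately show ?thesis using q' r' by blast
  qed
  define G where "G = {(q, r). ?good q r \<and> q \<noteq> 0}"
  \<comment> \<open>For \<open>q = 0\<close> the error is the absolute value of \<open>r\<close>,
    which is at least \<open>1 / |r|\<close> and so exceeds \<open>|r| powr (- \<tau>)\<close> once
    \<open>|r| > 1\<close>.\<close>
  have fin0: "finite {(q, r). ?good q r \<and> q = 0}"
  proof (rule finite_subset)
    show "{(q, r). ?good q r \<and> q = 0} \<subseteq> {0} \<times> {- 1..1}"
    proof safe
      fix r assume good: "?good 0 r"
      show "r \<in> {- 1..1}"
      proof (rule ccontr)
        assume "r \<notin> {- 1..1}"
        hence r: "\<bar>r\<bar> > 1" by auto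
        define m where "m = multiplicity (int ?p) r"
        have "int ?p ^ m \<le> \<bar>r\<bar>"
          using r by (intro zdvd_imp_le) (auto simp: m_def multiplicity_dvd)
        hence "real_of_int (int (?p ^ m)) \<le> real_of_int \<bar>r\<bar>" by (simp only: of_int_le_iff of_nat_power)
        hence pm: "real ?p ^ m \<le> \<bar>real_of_int r\<bar>" by simp
        have "\<bar>real_of_int r\<bar> powr (- \<tau>) < \<bar>real_of_int r\<bar> powr (- 1)"
          using \<tau> r by (intro powr_less_mono) auto
        also have "\<dots> \<le> inverse (real ?p ^ m)"
          using r pm p1 by (simp add: powr_minus le_imp_inverse_le)
        also have "\<dots> = padic_abs (of_int r :: 'p padic)"
          using r p by (simp add: rat_pabs_of_int m_def power_int_minus)
        finally show False using good by simp
      qed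
    qed
  qed auto
  have "infinite G"
  proof
    assume "finite G"
    hence "finite (G \<union> {(q, r). ?good q r \<and> q = 0})" using fin0 by simp
    moreover have "{(q, r). ?good q r} = G \<union> {(q, r). ?good q r \<and> q = 0}" by (auto simp: G_def)
    ultimately show False using inf by simp
  qed
  have "\<forall>z\<in>G. \<exists>k b. z = (int ?p ^ k * fst b, int ?p ^ k * snd b) \<and> b \<in> B \<and>
      padic_abs (x * of_int (fst b) - of_int (snd b)) \<le> (real ?p powr (1 - \<tau>)) ^ k"
    using reduce by (fastforce simp: G_def)
  then obtain K b where Kb: "\<And>z. z \<in> G \<Longrightarrow> z = (int ?p ^ K z * fst (b z), int ?p ^ K z * snd (b z)) \<and> b z \<in> B \<and>
      padic_abs (x * of_int (fst (b z)) - of_int (snd (b z))) \<le> (real ?p powr (1 - \<tau>)) ^ K z"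
    by metis
  have "finite (b ` G)" by (rule finite_subset[OF _ finB]) (use Kb in blast)
  \<comment> \<open>One reduced pair arises from infinitely many powers of \<open>p\<close>; the
    gain in \<open>reduce\<close> is then unbounded and forces \<open>x = r' / q'\<close>.\<close>
  from pigeonhole_infinite[OF \<open>infinite G\<close> this]
  obtain z0 where z0: "z0 \<in> G" "infinite {z \<in> G. b z = b z0}" by auto
  define q' r' where "q' = fst (b z0)" and "r' = snd (b z0)"
  have infK: "infinite (K ` {z \<in> G. b z = b z0})"
  proof
    assume "finite (K ` {z \<in> G. b z = b z0})"
    hence "finite ((\<lambda>k. (int ?p ^ k * q', int ?p ^ k * r')) ` K ` {z \<in> G. b z = b z0})" by simp
    moreover have "{z \<in> G. b z = b z0} \<subseteq> (\<lambda>k. (int ?p ^ k * q', int ?p ^ k * r')) ` K ` {z \<in> G. b z = b z0}"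
      using Kb by (force simp: q'_def r'_def)
    ultimately show False using z0(2) finite_subset by blast
  qed
  have lt1: "real ?p powr (1 - \<tau>) < 1" "0 \<le> real ?p powr (1 - \<tau>)"
    using p1 \<tau> powr_less_mono[of "1 - \<tau>" 0 "real ?p"] by auto
  have "padic_abs (x * of_int q' - of_int r') \<le> (real ?p powr (1 - \<tau>)) ^ n" for n
  proof -
    obtain z where z: "z \<in> G" "b z = b z0" "n < K z"
      using infK unfolding infinite_nat_iff_unbounded by blast
    have "padic_abs (x * of_int q' - of_int r') \<le> (real ?p powr (1 - \<tau>)) ^ K z"
      using Kb[OF z(1)] z(2) by (simp add: q'_def r'_def)
    also have "\<dots> \<le> (real ?p powr (1 - \<tau>)) ^ n"
      using lt1 z by (intro power_decreasing) auto
    finally show ?thesis .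
  qed
  hence "padic_abs (x * of_int q' - of_int r') \<le> 0"
    using LIMSEQ_le_const[OF LIMSEQ_power_zero[of "real ?p powr (1 - \<tau>)"]] lt1 by auto
  hence exact: "x * of_int q' = of_int r'"
    using padic_abs_nonneg[of "x * of_int q' - of_int r'"] padic_abs_eq_0_iff[of "x * of_int q' - of_int r'"] by force
  have "\<not> int ?p dvd q'" using Kb[OF z0(1)] by (auto simp: B_def q'_def)
  \<comment> \<open>For rational \<open>x\<close> the multiples of an exact pair are exact. This
    factor is prime to \<open>p\<close> and at least \<open>N\<close>, so it contradicts the negated
    claim.\<close>
  define m where "m = int ?p * int N + 1"
  have mq: "\<not> int ?p dvd m * q'"
  proof
    assume "int ?p dvd m * q'"
    hence "int ?p dvd m" using \<open>\<not> int ?p dvd q'\<close> p prime_dvd_mult_iff[of "int ?p" m q'] by auto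
    hence "int ?p dvd m - int ?p * int N" by (intro dvd_diff) auto
    thus False using p1' by (simp add: m_def)
  qed
  have "int N \<le> m" using p1' mult_right_mono[of 1 "int ?p" "int N"] by (simp add: m_def)
  moreover have "m \<le> \<bar>m * q'\<bar>"
  proof -
    have "q' \<noteq> 0" using \<open>\<not> int ?p dvd q'\<close> by auto
    hence "\<bar>m\<bar> * 1 \<le> \<bar>m\<bar> * \<bar>q'\<bar>" by (intro mult_left_mono) auto
    thus ?thesis by (simp add: abs_mult)
  qed
  ultimately have "int N \<le> max \<bar>m * q'\<bar> \<bar>m * r'\<bar>" by linarith
  hence "real_of_int (int N) \<le> ?H (m * q') (m * r')" by (simp only: of_int_le_iff)
  moreover have "x * of_int (m * q') - of_int (m * r') = 0"
    using exact by (simp add: mult.left_commute)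
  hence "?good (m * q') (m * r')" by (simp only: padic_abs_0 powr_ge_zero)
  ultimately show False using neg mq by (metis of_int_of_nat_eq)
qed

section \<open>The cover by neighbourhoods of fractions\<close>

text \<open>Pairs of integers are coded by naturals because covers are sequences of sets. The
  conditions on the pair sit inside the set, so an inadmissible pair contributes the empty
  set.\<close>

definition approx_neighbourhood :: "real \<Rightarrow> real \<Rightarrow> nat \<times> nat \<Rightarrow> 'p::prime_card padic set" where
  "approx_neighbourhood \<tau> N = (\<lambda>(i, j). let q = int_decode i; r = int_decode j; H = real_of_int (max \<bar>q\<bar> \<bar>r\<bar>) in
     {x. \<not> int CARD('p) dvd q \<and> N \<le> H \<and> padic_abs (x * of_int q - of_int r) \<le> H powr (- \<tau>)})"

lemma abs_int_decode_ge: "real (Suc i) \<le> 2 * (1 + \<bar>real_of_int (int_decode i)\<bar>)"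
  by (auto simp: int_decode_def sum_decode_def elim!: evenE oddE)

text \<open>Since \<open>q\<close> is a unit, two points differ by at most
  \<open>H powr (- \<tau>)\<close>. Bounding the height from below by the geometric mean of the two
  codes makes the later sum over pairs a product of two single sums; the 4 comes from
  \<open>2 * (1 + H) \<le> 4 * H\<close>.\<close>

lemma approx_neighbourhood_diameter:
  fixes n :: "nat \<times> nat"
  assumes "N \<ge> 1" "\<tau> > 0" "x \<in> approx_neighbourhood \<tau> N n" "y \<in> approx_neighbourhood \<tau> N n"
  shows "dist x (y :: 'p::prime_card padic) \<le>
     (max N (sqrt (real (Suc (fst n)) * real (Suc (snd n))) / 4)) powr (- \<tau>)"
proof -
  obtain i j where n: "n = (i, j)" by force
  define q r H where "q = int_decode i" "r = int_decode j" "H = real_of_int (max \<bar>q\<bar> \<bar>r\<bar>)"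
  have *: "\<not> int CARD('p) dvd q" "N \<le> H" "padic_abs (x * of_int q - of_int r) \<le> H powr (- \<tau>)"
     "padic_abs (y * of_int q - of_int r) \<le> H powr (- \<tau>)"
    using assms(3,4) by (auto simp: approx_neighbourhood_def n q_r_H_def Let_def)
  have q1: "padic_abs (of_int q :: 'p padic) = 1"
    using *(1) by (rule padic_abs_of_int_eq_1)
  have "padic_abs (x * of_int q - y * of_int q) \<le> H powr (- \<tau>)"
    by (rule padic_abs_diff_le[OF *(3)]) (use *(4) in \<open>simp add: padic_abs_diff_commute\<close>)
  hence "dist x y \<le> H powr (- \<tau>)"
    by (simp add: dist_padic_def padic_abs_mult q1 flip: left_diff_distrib del: padic_abs_of_int)
  also have "\<dots> \<le> (max N (sqrt (real (Suc (fst n)) * real (Suc (snd n))) / 4)) powr (- \<tau>)"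
  proof (rule powr_mono2')
    have Hge: "real (Suc i) \<le> 2 * (1 + H)" "real (Suc j) \<le> 2 * (1 + H)"
      using abs_int_decode_ge[of i] abs_int_decode_ge[of j] by (auto simp: q_r_H_def)
    have "real (Suc i) * real (Suc j) \<le> (2 * (1 + H)) * (2 * (1 + H))"
      using Hge by (intro mult_mono) auto
    also have "\<dots> \<le> (4 * H) * (4 * H)"
      by (rule mult_mono) (use *(2) assms(1) in \<open>simp_all del: of_nat_Suc\<close>)
    finally have "sqrt (real (Suc i) * real (Suc j)) \<le> 4 * H"
      using *(2) assms(1) by (intro real_le_lsqrt) (auto simp: power2_eq_square)
    thus "max N (sqrt (real (Suc (fst n)) * real (Suc (snd n))) / 4) \<le> H"
      using *(2) by (simp add: n)
  qed (use assms in auto)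
  finally show ?thesis .
qed

lemma hausdorff_measure_well_approximable:
  assumes \<tau>: "\<tau> > 1" and s: "s > 2 / \<tau>"
  shows "hausdorff_measure s (well_approximable \<tau> :: 'p::prime_card padic set) = 0"
proof (rule hausdorff_measure_eq_0I)
  fix \<delta> \<epsilon> :: real assume \<delta>: "\<delta> > 0" and \<epsilon>: "\<epsilon> > 0"
  \<comment> \<open>The exponent \<open>s'\<close> still gives a convergent series, and the surplus
    \<open>s - s'\<close> gives a factor that is small for large \<open>N\<close>.\<close>
  define s' where "s' = (s + 2 / \<tau>) / 2"
  have s': "2 / \<tau> < s'" "s' < s" "0 < s'" using s \<tau> by (auto simp: s'_def field_simps intro: add_pos_pos)
  \<comment> \<open>The square root in the diameter bound halves the exponent of each code, and
    \<open>\<sigma> > 1\<close> says exactly that \<open>s'\<close> exceeds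
    \<open>2 / \<tau>\<close>.\<close>
  define \<sigma> where "\<sigma> = \<tau> * s' / 2"
  have \<sigma>: "\<sigma> > 1" using s' \<tau> by (simp add: \<sigma>_def field_simps)
  define z where "z = (\<Sum>i. real (Suc i) powr (- \<sigma>))"
  have sm: "summable (\<lambda>i. real (Suc i) powr (- \<sigma>))"
    using \<sigma> by (subst summable_Suc_iff) (simp add: summable_real_powr_iff)
  have z: "z \<ge> 0" unfolding z_def by (intro suminf_nonneg sm) auto
  define M where "M = (16 powr \<sigma> * z * z) + 1"
  have M: "M > 0" using z by (simp add: M_def add_nonneg_pos)
  have "(\<lambda>n::nat. real n powr (- (\<tau> * (s - s')))) \<longlonglongrightarrow> 0"
    using \<tau> s' by (intro tendsto_neg_powr filterlim_real_sequentially) auto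
  hence "\<forall>\<^sub>F n in sequentially. real n powr (- (\<tau> * (s - s'))) < \<epsilon> / M"
    by (rule order_tendstoD) (use \<epsilon> M in auto)
  moreover have "(\<lambda>n::nat. real n powr (- \<tau>)) \<longlonglongrightarrow> 0"
    using \<tau> by (intro tendsto_neg_powr filterlim_real_sequentially) auto
  hence "\<forall>\<^sub>F n in sequentially. real n powr (- \<tau>) < \<delta>"
    by (rule order_tendstoD) (use \<delta> in auto)
  ultimately have "\<forall>\<^sub>F n in sequentially. n \<ge> 1 \<and> real n powr (- (\<tau> * (s - s'))) < \<epsilon> / M \<and> real n powr (- \<tau>) < \<delta>"
    using eventually_ge_at_top[of 1] by eventually_elim auto
  then obtain N :: nat where N: "N \<ge> 1" "real N powr (- (\<tau> * (s - s'))) < \<epsilon> / M" "real N powr (- \<tau>) < \<delta>"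
    by (auto simp: eventually_sequentially)
  define U :: "nat \<Rightarrow> 'p padic set" where "U n = approx_neighbourhood \<tau> N (prod_decode n)" for n
  define D where "D n = max (real N) (sqrt (real (Suc (fst n)) * real (Suc (snd n))) / 4)" for n :: "nat \<times> nat"
  have D: "D n \<ge> N" "D n \<ge> sqrt (real (Suc (fst n)) * real (Suc (snd n))) / 4" for n by (auto simp: D_def)
  have U: "bounded (U n)" "diameter (U n) \<le> D (prod_decode n) powr (- \<tau>)" for n
    using metric_diameter_le[of "U n" "D (prod_decode n) powr (- \<tau>)"]
      approx_neighbourhood_diameter[of N \<tau> _ "prod_decode n"] N \<tau>
    by (auto simp: U_def D_def)
  have D\<delta>: "D n powr (- \<tau>) \<le> \<delta>" for n
  proof -
    have "D n powr (- \<tau>) \<le> real N powr (- \<tau>)"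
      using D[of n] N \<tau> by (intro powr_mono2') auto
    thus ?thesis using N by simp
  qed
  have weight: "hausdorff_weight s (U n) \<le> ennreal (\<epsilon> / M * 16 powr \<sigma>) *
      (ennreal (real (Suc (fst (prod_decode n))) powr (- \<sigma>)) * ennreal (real (Suc (snd (prod_decode n))) powr (- \<sigma>)))" for n
  proof -
    obtain i j where ij: "prod_decode n = (i, j)" by force
    have "s > 0" using s' by simp
    hence "hausdorff_weight s (U n) \<le> ennreal (diameter (U n) powr s)"
      by (simp add: hausdorff_weight_def)
    also have "diameter (U n) powr s \<le> (D (i, j) powr (- \<tau>)) powr s"
      using U[of n] \<open>s > 0\<close> by (intro powr_mono2) (auto simp: ij diameter_ge_0)
    also have "\<dots> = D (i, j) powr (- (\<tau> * (s - s'))) * D (i, j) powr (- (\<tau> * s'))"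
      by (simp add: powr_powr algebra_simps flip: powr_add)
    also have "\<dots> \<le> (\<epsilon> / M) * (16 powr \<sigma> * (real (Suc i) powr (- \<sigma>) * real (Suc j) powr (- \<sigma>)))"
    proof (rule mult_mono)
      have "D (i, j) powr (- (\<tau> * (s - s'))) \<le> real N powr (- (\<tau> * (s - s')))"
        using D[of "(i, j)"] N \<tau> s' by (intro powr_mono2') auto
      thus "D (i, j) powr (- (\<tau> * (s - s'))) \<le> \<epsilon> / M" using N by simp
      have "D (i, j) powr (- (\<tau> * s')) \<le> (sqrt (real (Suc i) * real (Suc j)) / 4) powr (- (\<tau> * s'))"
        using D(2)[of "(i, j)"] \<tau> s' by (intro powr_mono2') auto
      also have "sqrt (real (Suc i) * real (Suc j)) / 4 = ((real (Suc i) * real (Suc j)) / 16) powr (1 / 2)"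
        by (simp add: powr_half_sqrt real_sqrt_divide del: of_nat_Suc)
      also have "\<dots> powr (- (\<tau> * s')) = ((real (Suc i) * real (Suc j)) / 16) powr (- \<sigma>)"
        by (simp add: powr_powr \<sigma>_def)
      also have "\<dots> = 16 powr \<sigma> * (real (Suc i) powr (- \<sigma>) * real (Suc j) powr (- \<sigma>))"
        by (simp add: powr_divide powr_mult powr_minus field_simps del: of_nat_Suc)
      finally show "D (i, j) powr (- (\<tau> * s')) \<le> 16 powr \<sigma> * (real (Suc i) powr (- \<sigma>) * real (Suc j) powr (- \<sigma>))" .
    qed (use \<epsilon> M in auto)
    finally have "hausdorff_weight s (U n) \<le> ennreal (\<epsilon> / M * (16 powr \<sigma> * (real (Suc i) powr (- \<sigma>) * real (Suc j) powr (- \<sigma>))))"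
      by (simp add: ennreal_leI)
    also have "\<dots> = ennreal (\<epsilon> / M * 16 powr \<sigma>) * (ennreal (real (Suc i) powr (- \<sigma>)) * ennreal (real (Suc j) powr (- \<sigma>)))"
      using \<epsilon> M by (simp add: mult.assoc flip: ennreal_mult del: of_nat_Suc)
    finally show ?thesis by (simp add: ij)
  qed
  let ?w = "\<lambda>i. ennreal (real (Suc i) powr (- \<sigma>))"
  have zsum: "(\<integral>\<^sup>+ i. ?w i \<partial>count_space UNIV) = ennreal z"
    unfolding nn_integral_count_space_nat z_def by (rule suminf_ennreal2[OF _ sm]) auto
  have "(\<Sum>n. hausdorff_weight s (U n)) \<le>
      (\<Sum>n. ennreal (\<epsilon> / M * 16 powr \<sigma>) * (?w (fst (prod_decode n)) * ?w (snd (prod_decode n))))"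
    by (intro suminf_le weight) auto
  also have "\<dots> = ennreal (\<epsilon> / M * 16 powr \<sigma>) * (\<Sum>n. ?w (fst (prod_decode n)) * ?w (snd (prod_decode n)))"
    by (simp add: ennreal_suminf_cmult)
  \<comment> \<open>Read as an integral for counting measure, the series over coded pairs splits by
    Tonelli.\<close>
  also have "(\<Sum>n. ?w (fst (prod_decode n)) * ?w (snd (prod_decode n)))
      = (\<integral>\<^sup>+ n. ?w (fst (prod_decode n)) * ?w (snd (prod_decode n)) \<partial>count_space UNIV)"
    by (rule nn_integral_count_space_nat[symmetric])
  also have "\<dots> = (\<integral>\<^sup>+ n. ?w (fst n) * ?w (snd n) \<partial>count_space UNIV)"
    by (rule nn_integral_bij_count_space[OF bij_prod_decode])
  also have "\<dots> = (\<integral>\<^sup>+ i. \<integral>\<^sup>+ j. ?w i * ?w j \<partial>count_space UNIV \<partial>count_space UNIV)"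
    by (subst nn_integral_fst_count_space[symmetric]) (simp only: fst_conv snd_conv)
  also have "\<dots> = ennreal z * ennreal z"
    by (simp add: nn_integral_cmult nn_integral_multc zsum del: of_nat_Suc)
  also have "ennreal (\<epsilon> / M * 16 powr \<sigma>) * (ennreal z * ennreal z) = ennreal (\<epsilon> * ((16 powr \<sigma> * z * z) / M))"
    using \<epsilon> M z by (simp flip: ennreal_mult)
  also have "\<dots> \<le> ennreal (\<epsilon> * 1)"
    using \<epsilon> M by (intro ennreal_leI mult_left_mono) (auto simp: M_def)
  finally have sum: "(\<Sum>n. hausdorff_weight s (U n)) \<le> ennreal \<epsilon>" by simp
  show "\<exists>U :: nat \<Rightarrow> 'p padic set. well_approximable \<tau> \<subseteq> (\<Union>i. U i) \<and>
      (\<forall>i. bounded (U i) \<and> diameter (U i) \<le> \<delta>) \<and> (\<Sum>i. hausdorff_weight s (U i)) \<le> ennreal \<epsilon>"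
  proof (intro exI[of _ U] conjI allI subsetI sum)
    fix x :: "'p padic" assume "x \<in> well_approximable \<tau>"
    then obtain q r where qr: "\<not> int CARD('p) dvd q" "real N \<le> real_of_int (max \<bar>q\<bar> \<bar>r\<bar>)"
      "padic_abs (x * of_int q - of_int r) \<le> real_of_int (max \<bar>q\<bar> \<bar>r\<bar>) powr (- \<tau>)"
      using well_approximable_coprime[OF _ \<tau>] by blast
    hence "x \<in> U (prod_encode (int_encode q, int_encode r))"
      by (auto simp: U_def approx_neighbourhood_def Let_def)
    thus "x \<in> (\<Union>i. U i)" by blast
  next
    fix i show "bounded (U i)" "diameter (U i) \<le> \<delta>"
      using U[of i] D\<delta>[of "prod_decode i"] by auto
  qed
qed

lemma hausdorff_dim_well_approximable_le:
  assumes \<tau>: "\<tau> > 1"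
  shows "hausdorff_dim (well_approximable \<tau> :: 'p::prime_card padic set) \<le> ennreal (2 / \<tau>)"
proof (rule ennreal_le_epsilon)
  fix e :: real assume e: "e > 0"
  have "hausdorff_dim (well_approximable \<tau> :: 'p padic set) \<le> ennreal (2 / \<tau> + e)"
    unfolding hausdorff_dim_def using \<tau> e
    by (intro INF_lower) (auto intro!: hausdorff_measure_well_approximable add_nonneg_nonneg)
  also have "\<dots> = ennreal (2 / \<tau>) + ennreal e"
    using \<tau> e by (intro ennreal_plus) auto
  finally show "hausdorff_dim (well_approximable \<tau> :: 'p padic set) \<le> ennreal (2 / \<tau>) + ennreal e" .
qed


section \<open>Energy and the inequality between the dimensions\<close>

lemma cis_2pi_eq_1_imp_dvd:
  assumes "cis (2 * pi * of_int k / of_nat M) = 1" "M > 0"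
  shows "int M dvd k"
proof -
  have "exp (\<i> * complex_of_real (2 * pi * of_int k / of_nat M)) = 1"
    using assms by (simp add: cis_conv_exp)
  then obtain n :: int where "2 * pi * of_int k / of_nat M = of_int (2 * n) * pi"
    unfolding exp_eq_1 by auto
  hence "real_of_int k = real_of_int (n * int M)"
    using assms(2) by (simp add: field_simps)
  hence "k = n * int M" by (simp only: of_int_eq_iff)
  thus ?thesis by simp
qed

lemma sum_cis_roots:
  assumes "M > 0"
  shows "(\<Sum>a<M. cis (2 * pi * of_int (int a * k) / of_nat M)) = (if int M dvd k then of_nat M else 0)"
proof -
  let ?w = "cis (2 * pi * of_int k / of_nat M)"
  have pw: "cis (2 * pi * of_int (int a * k) / of_nat M) = ?w ^ a" for a
    unfolding Complex.DeMoivre by (simp add: mult_ac)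
  have "?w ^ M = cis (2 * pi * of_int k)"
    using assms unfolding Complex.DeMoivre by simp
  hence wM: "?w ^ M = 1"
    by (simp only: cis_2pi_of_int)
  show ?thesis
  proof (cases "int M dvd k")
    case True
    hence "?w = 1" using cis_2pi_cong[of M k 0] assms by simp
    thus ?thesis using True unfolding pw by simp
  next
    case False
    hence "?w \<noteq> 1" using cis_2pi_eq_1_imp_dvd assms by blast
    thus ?thesis using False wM unfolding pw by (simp add: sum_gp_strict)
  qed
qed

lemma eq_if_int_dvd_diff:
  assumes "b < M" "c < M" "int M dvd int b - int c"
  shows "b = c"
proof -
  have "int b mod int M = int c mod int M"
    using assms(3) by (simp only: mod_eq_dvd_iff)
  thus ?thesis using assms(1,2) by (simp add: mod_pos_pos_trivial)
qed

lemma padic_residue_unique: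
  fixes x :: "'p::prime_card padic"
  assumes "b < CARD('p) ^ n" "c < CARD('p) ^ n"
    "padic_abs (x - of_nat b) \<le> inverse (real CARD('p)) ^ n" "padic_abs (x - of_nat c) \<le> inverse (real CARD('p)) ^ n"
  shows "b = c"
proof -
  have "padic_abs (of_nat b - x) \<le> inverse (real CARD('p)) ^ n"
    using assms(3) by (simp only: padic_abs_diff_commute[of x])
  hence "padic_abs (of_nat b - of_nat c :: 'p padic) \<le> inverse (real CARD('p)) ^ n"
    using assms(4) by (rule padic_abs_diff_le)
  hence "padic_abs (of_int (int b - int c) :: 'p padic) \<le> inverse (real CARD('p)) ^ n"
    by (simp only: of_int_diff of_int_of_nat_eq)
  hence "int (CARD('p) ^ n) dvd int b - int c"
    by (simp only: padic_abs_le_iff_dvd of_nat_power)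
  thus ?thesis
    using assms(1,2) by (rule eq_if_int_dvd_diff[rotated 2])
qed

text \<open>The balls around \<open>0, ..., p ^ n - 1\<close> partition the \<open>p\<close>-adic
  integers, so an integrand constant on each of them reduces to a finite sum.\<close>

lemma integral_padic_residues:
  fixes \<mu> :: "'p::prime_card padic measure" and f :: "'p padic \<Rightarrow> 'b::{banach, second_countable_topology}"
  assumes \<mu>: "borel_prob \<mu>" "AE x in \<mu>. padic_abs x \<le> 1" and f: "f \<in> borel_measurable \<mu>"
    and F: "\<And>x b. padic_abs x \<le> 1 \<Longrightarrow> b < CARD('p) ^ n \<Longrightarrow>
      padic_abs (x - of_nat b) \<le> inverse (real CARD('p)) ^ n \<Longrightarrow> f x = F b"
  shows "integral\<^sup>L \<mu> f = (\<Sum>b<CARD('p) ^ n. measure \<mu> (cball (of_nat b) (inverse (real CARD('p)) ^ n)) *\<^sub>R F b)"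
proof -
  interpret prob_space \<mu> using \<mu> by (simp add: borel_prob_def)
  have sets: "sets \<mu> = sets borel" using \<mu> by (simp add: borel_prob_def)
  let ?B = "\<lambda>b. cball (of_nat b) (inverse (real CARD('p)) ^ n) :: 'p padic set"
  have B: "?B b \<in> sets \<mu>" for b by (simp add: sets)
  have hb: "has_bochner_integral \<mu> (\<lambda>x. indicator (?B b) x *\<^sub>R F b) (measure \<mu> (?B b) *\<^sub>R F b)" for b
    by (intro has_bochner_integral_indicator B) (simp add: emeasure_eq_measure)
  have "integral\<^sup>L \<mu> f = (LINT x|\<mu>. (\<Sum>b<CARD('p) ^ n. indicator (?B b) x *\<^sub>R F b))"
  proof (rule integral_cong_AE[OF f])
    show "(\<lambda>x. \<Sum>b<CARD('p) ^ n. indicator (?B b) x *\<^sub>R F b) \<in> borel_measurable \<mu>"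
      using B by measurable
    show "AE x in \<mu>. f x = (\<Sum>b<CARD('p) ^ n. indicator (?B b) x *\<^sub>R F b)"
      using \<mu>(2)
    proof eventually_elim
      case (elim x)
      then obtain b where b: "b < CARD('p) ^ n" "padic_abs (x - of_nat b) \<le> inverse (real CARD('p)) ^ n"
        using padic_integer_residue by blast
      have mem: "x \<in> ?B c \<longleftrightarrow> padic_abs (x - of_nat c) \<le> inverse (real CARD('p)) ^ n" for c
        by (simp only: mem_cball dist_padic_def padic_abs_diff_commute[of x])
      have "indicator (?B c) x *\<^sub>R F c = 0" if "c \<in> {..<CARD('p) ^ n} - {b}" for c
      proof -
        have "x \<notin> ?B c" unfolding mem using padic_residue_unique[OF b(1) _ b(2), of c] that by blast
        thus ?thesis by simp
      qed
      hence "(\<Sum>c<CARD('p) ^ n. indicator (?B c) x *\<^sub>R F c) = (\<Sum>c\<in>{b}. indicator (?B c) x *\<^sub>R F c)"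
        using b(1) by (intro sum.mono_neutral_right) auto
      also have "\<dots> = F b" using b(2) unfolding mem[symmetric] by simp
      finally show ?case using F[OF elim b] by simp
    qed
  qed
  also have "\<dots> = (\<Sum>b<CARD('p) ^ n. measure \<mu> (?B b) *\<^sub>R F b)"
    by (intro has_bochner_integral_integral_eq has_bochner_integral_sum hb)
  finally show ?thesis .
qed

lemma borel_measurable_padic_char:
  "(\<lambda>x :: 'p::prime_card padic. padic_char (x * \<xi>)) \<in> borel_measurable borel"
proof -
  have "continuous_on UNIV (\<lambda>x. padic_frac (x * \<xi>))"
    using continuous_on_padic_frac continuous_on_padic_mult_right
    by (rule continuous_on_compose2) auto
  thus ?thesis
    unfolding padic_char_def by (intro borel_measurable_continuous_onI continuous_intros)
qed

lemma padic_fourier_eq_integral_char: "padic_fourier \<mu> \<xi> = (LINT x|\<mu>. padic_char (x * \<xi>))"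
  by (simp add: padic_fourier_def padic_char_def)

lemma padic_fourier_eq_sum:
  fixes \<mu> :: "'p::prime_card padic measure"
  assumes \<mu>: "borel_prob \<mu>" "AE x in \<mu>. padic_abs x \<le> 1"
  shows "padic_fourier \<mu> (of_nat a / of_nat CARD('p) ^ n) =
    (\<Sum>b<CARD('p) ^ n. of_real (measure \<mu> (cball (of_nat b) (inverse (real CARD('p)) ^ n))) *
        cis (2 * pi * of_int (int a * int b) / of_nat (CARD('p) ^ n)))"
  unfolding padic_fourier_eq_integral_char scaleR_conv_of_real[symmetric]
proof (rule integral_padic_residues[OF \<mu>])
  show "(\<lambda>x. padic_char (x * (of_nat a / of_nat CARD('p) ^ n))) \<in> borel_measurable \<mu>"
    using \<mu>(1) borel_measurable_padic_char[of "of_nat a / of_nat CARD('p) ^ n :: 'p padic"]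
    by (simp add: borel_prob_def cong: measurable_cong_sets del: times_divide_eq_right)
next
  fix x :: "'p padic" and b
  assume "padic_abs x \<le> 1" "padic_abs (x - of_nat b) \<le> inverse (real CARD('p)) ^ n"
  thus "padic_char (x * (of_nat a / of_nat CARD('p) ^ n)) = cis (2 * pi * of_int (int a * int b) / of_nat (CARD('p) ^ n))"
    by (intro padic_char_mult_eq_cis) auto
qed

text \<open>The masses of the residue balls form a function on the integers modulo
  \<open>p ^ n\<close>, and the coefficients at \<open>a / p ^ n\<close> are its discrete Fourier
  transform.\<close>

lemma padic_parseval:
  fixes \<mu> :: "'p::prime_card padic measure"
  assumes \<mu>: "borel_prob \<mu>" "AE x in \<mu>. padic_abs x \<le> 1"
  shows "(\<Sum>a<CARD('p) ^ n. (cmod (padic_fourier \<mu> (of_nat a / of_nat CARD('p) ^ n)))\<^sup>2) =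
     real CARD('p) ^ n * (\<Sum>b<CARD('p) ^ n. (measure \<mu> (cball (of_nat b) (inverse (real CARD('p)) ^ n)))\<^sup>2)"
proof -
  let ?M = "CARD('p) ^ n"
  define m where "m b = measure \<mu> (cball (of_nat b) (inverse (real CARD('p)) ^ n))" for b
  have M: "?M > 0" using prime_gt_0_nat[OF prime_card[where 'a='p]] by simp
  have e: "cnj (cis (2 * pi * of_int (int a * int c) / of_nat ?M)) * cis (2 * pi * of_int (int a * int b) / of_nat ?M)
      = cis (2 * pi * of_int (int a * (int b - int c)) / of_nat ?M)" for a b c
    unfolding cis_cnj cis_mult by (simp add: algebra_simps diff_divide_distrib)
  have orth: "(\<Sum>a<?M. cis (2 * pi * of_int (int a * (int b - int c)) / of_nat ?M)) = (if b = c then of_nat ?M else 0)"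
    if "b < ?M" "c < ?M" for b c
  proof -
    have "int ?M dvd int b - int c \<longleftrightarrow> b = c"
    proof
      assume "int ?M dvd int b - int c"
      thus "b = c" by (rule eq_if_int_dvd_diff[OF that])
    qed auto
    thus ?thesis by (subst sum_cis_roots[OF M]) simp
  qed
  have "complex_of_real (\<Sum>a<?M. (cmod (padic_fourier \<mu> (of_nat a / of_nat CARD('p) ^ n)))\<^sup>2)
    = (\<Sum>a<?M. \<Sum>c<?M. \<Sum>b<?M. of_real (m c * m b) * cis (2 * pi * of_int (int a * (int b - int c)) / of_nat ?M))"
    unfolding of_real_sum
  proof (intro sum.cong refl)
    fix a
    let ?z = "padic_fourier \<mu> (of_nat a / of_nat CARD('p) ^ n)"
    have "complex_of_real ((cmod ?z)\<^sup>2) = cnj ?z * ?z"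
      by (simp only: complex_norm_square mult.commute)
    also have "\<dots> = (\<Sum>c<?M. \<Sum>b<?M. (of_real (m c) * cnj (cis (2 * pi * of_int (int a * int c) / of_nat ?M))) *
        (of_real (m b) * cis (2 * pi * of_int (int a * int b) / of_nat ?M)))"
      unfolding padic_fourier_eq_sum[OF \<mu>] m_def[symmetric] cnj_sum complex_cnj_mult complex_cnj_complex_of_real
      by (rule sum_product)
    also have "\<dots> = (\<Sum>c<?M. \<Sum>b<?M. of_real (m c * m b) * cis (2 * pi * of_int (int a * (int b - int c)) / of_nat ?M))"
      unfolding e[symmetric] by (intro sum.cong) auto
    finally show "complex_of_real ((cmod ?z)\<^sup>2) = (\<Sum>c<?M. \<Sum>b<?M. of_real (m c * m b) * cis (2 * pi * of_int (int a * (int b - int c)) / of_nat ?M))" .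
  qed
  also have "\<dots> = (\<Sum>c<?M. \<Sum>a<?M. \<Sum>b<?M. of_real (m c * m b) * cis (2 * pi * of_int (int a * (int b - int c)) / of_nat ?M))"
    by (rule sum.swap)
  also have "\<dots> = (\<Sum>c<?M. \<Sum>b<?M. \<Sum>a<?M. of_real (m c * m b) * cis (2 * pi * of_int (int a * (int b - int c)) / of_nat ?M))"
    by (intro sum.cong refl sum.swap)
  also have "\<dots> = (\<Sum>c<?M. \<Sum>b<?M. of_real (m c * m b) * (if b = c then of_nat ?M else 0))"
    unfolding sum_distrib_left[symmetric] by (intro sum.cong refl) (simp only: orth lessThan_iff)
  also have "\<dots> = (\<Sum>c<?M. of_real (m c * m c) * of_nat ?M)"
    by (intro sum.cong refl) (simp add: if_distrib sum.delta cong: if_cong)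
  also have "\<dots> = complex_of_real (real CARD('p) ^ n * (\<Sum>b<?M. (m b)\<^sup>2))"
    by (simp add: power2_eq_square sum_distrib_left mult_ac)
  finally show ?thesis unfolding m_def by (simp only: of_real_eq_iff)
qed

lemma padic_fourier_0: "borel_prob \<mu> \<Longrightarrow> padic_fourier \<mu> (0 :: 'p::prime_card padic) = 1"
  by (simp add: padic_fourier_def borel_prob_def padic_frac_integral prob_space.prob_space)

text \<open>Induction over the levels of frequencies. Numerators divisible by \<open>p\<close>
  belong to the previous level; the others have absolute value exactly \<open>p ^ n\<close> and
  number at most \<open>p ^ n\<close>, so each level adds at most
  \<open>C * p ^ (n (1 - \<beta>))\<close>. As \<open>\<beta> \<le> 1\<close> these bounds increase
  with \<open>n\<close>, and the last one times the number of levels bounds the total.\<close>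

lemma padic_energy_le:
  fixes \<mu> :: "'p::prime_card padic measure"
  assumes \<mu>: "borel_prob \<mu>" "AE x in \<mu>. padic_abs x \<le> 1"
    and C: "\<And>\<xi>. \<xi> \<noteq> 0 \<Longrightarrow> (cmod (padic_fourier \<mu> \<xi>))\<^sup>2 * padic_abs \<xi> powr \<beta> \<le> C"
    and \<beta>: "\<beta> \<le> 1"
  shows "(\<Sum>b<CARD('p) ^ n. (measure \<mu> (cball (of_nat b) (inverse (real CARD('p)) ^ n)))\<^sup>2)
    \<le> (1 + real n * C) * real CARD('p) powr (- (\<beta> * real n))"
proof -
  let ?p = "CARD('p)" and ?P = "of_nat CARD('p) :: 'p padic"
  have p: "prime ?p" by (rule prime_card)
  have p1: "1 < real ?p" by (rule padic_p_gt_1)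
  have C0: "0 \<le> C"
    using order_trans[OF _ C[of 1]] by simp
  define E where "E n = (\<Sum>a<?p ^ n. (cmod (padic_fourier \<mu> (of_nat a / ?P ^ n)))\<^sup>2)" for n
  have E: "E n \<le> (1 + real n * C) * real ?p powr ((1 - \<beta>) * real n)" for n
  proof (induction n)
    case 0
    show ?case using \<mu> p1 by (simp add: E_def padic_fourier_0)
  next
    case (Suc n)
    let ?f = "\<lambda>a. (cmod (padic_fourier \<mu> (of_nat a / ?P ^ Suc n)))\<^sup>2"
    let ?A = "{a. a < ?p ^ Suc n \<and> ?p dvd a}" and ?A' = "{a. a < ?p ^ Suc n \<and> \<not> ?p dvd a}"
    have "{..<?p ^ Suc n} = ?A \<union> ?A'" by auto
    hence split: "E (Suc n) = sum ?f ?A + sum ?f ?A'"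
      unfolding E_def by (simp only:) (intro sum.union_disjoint; auto)
    have multiples: "sum ?f ?A = E n"
      unfolding E_def
    proof (rule sum.reindex_bij_witness[of _ "\<lambda>a. ?p * a" "\<lambda>a. a div ?p"])
      fix a assume "a \<in> {..<?p ^ n}"
      thus "?p * a \<in> ?A" "?p * a div ?p = a" using p1 by auto
    next
      fix a assume a: "a \<in> ?A"
      then obtain c where c: "a = ?p * c" by auto
      thus "?p * (a div ?p) = a" "a div ?p \<in> {..<?p ^ n}" using a p1 by auto
      show "(cmod (padic_fourier \<mu> (of_nat (a div ?p) / ?P ^ n)))\<^sup>2 = ?f a"
        using p1 by (simp add: c)
    qed
    have "sum ?f ?A' \<le> (\<Sum>a\<in>?A'. C * real ?p powr (- (\<beta> * real (Suc n))))"
    proof (rule sum_mono)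
      fix a assume "a \<in> ?A'"
      hence a: "\<not> ?p dvd a" by simp
      hence "\<not> int ?p dvd int a" by (simp only: int_dvd_int_iff not_False_eq_True)
      from padic_abs_of_int_eq_1[OF this] have "padic_abs (of_nat a :: 'p padic) = 1"
        by (simp only: of_int_of_nat_eq)
      moreover have "a \<noteq> 0" using a by (rule contrapos_nn) simp
      ultimately have abs: "padic_abs (of_nat a / ?P ^ Suc n) = real ?p ^ Suc n"
"a \<noteq> 0"
        unfolding padic_abs_div_p_power by simp_all
      have "of_nat a / ?P ^ Suc n \<noteq> 0" using \<open>a \<noteq> 0\<close> p1 by simp
      from C[OF this] have "?f a * (real ?p ^ Suc n) powr \<beta> \<le> C" by (simp only: abs)
      moreover have "(real ?p ^ Suc n) powr \<beta> = real ?p powr (\<beta> * real (Suc n))"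
      proof -
        have "real ?p ^ Suc n = real ?p powr real (Suc n)" using p1 by (subst powr_realpow) auto
        thus ?thesis by (simp only: powr_powr mult.commute)
      qed
      ultimately show "?f a \<le> C * real ?p powr (- (\<beta> * real (Suc n)))"
        using powr_gt_zero[of "real ?p" "\<beta> * real (Suc n)"] p1
        by (simp only: powr_minus divide_inverse[symmetric] pos_le_divide_eq)
    qed
    also have "\<dots> = real (card ?A') * (C * real ?p powr (- (\<beta> * real (Suc n))))" by simp
    also have "\<dots> \<le> real ?p ^ Suc n * (C * real ?p powr (- (\<beta> * real (Suc n))))"
    proof (rule mult_right_mono)
      have "card ?A' \<le> card {..<?p ^ Suc n}" by (intro card_mono) auto
      hence "card ?A' \<le> ?p ^ Suc n" by simp
      hence "real (card ?A') \<le> real (?p ^ Suc n)" by (simp only: of_nat_le_iff)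
      thus "real (card ?A') \<le> real ?p ^ Suc n" by simp
    qed (use C0 in auto)
    also have "\<dots> = C * real ?p powr ((1 - \<beta>) * real (Suc n))"
    proof -
      have "real ?p ^ Suc n = real ?p powr real (Suc n)" using p1 by (subst powr_realpow) auto
      thus ?thesis by (simp add: algebra_simps flip: powr_add)
    qed
    finally have units: "sum ?f ?A' \<le> C * real ?p powr ((1 - \<beta>) * real (Suc n))" .
    have "E n \<le> (1 + real n * C) * real ?p powr ((1 - \<beta>) * real (Suc n))"
    proof (rule order_trans[OF Suc.IH mult_left_mono])
      show "real ?p powr ((1 - \<beta>) * real n) \<le> real ?p powr ((1 - \<beta>) * real (Suc n))"
        using p1 \<beta> by (intro powr_mono mult_left_mono) auto
    qed (use C0 in auto)
    thus ?case using split multiples units by (simp add: distrib_right)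
  qed
  have "real ?p ^ n * (\<Sum>b<?p ^ n. (measure \<mu> (cball (of_nat b) (inverse (real ?p) ^ n)))\<^sup>2)
      \<le> (1 + real n * C) * real ?p powr ((1 - \<beta>) * real n)"
    using E[of n] unfolding E_def padic_parseval[OF \<mu>] .
  also have "\<dots> = real ?p ^ n * ((1 + real n * C) * real ?p powr (- (\<beta> * real n)))"
  proof -
    have "real ?p ^ n = real ?p powr real n" using p1 by (subst powr_realpow) auto
    moreover have "real ?p powr ((1 - \<beta>) * real n) = real ?p powr real n * real ?p powr (- (\<beta> * real n))"
      by (simp add: algebra_simps flip: powr_add)
    ultimately show ?thesis by simp
  qed
  finally show ?thesis using p1 by simp
qed

section \<open>Ball masses and the mass distribution principle\<close>

lemma padic_cball_eq:
  fixes x y :: "'p::prime_card padic"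
  assumes "dist x y \<le> r"
  shows "cball x r = cball y r"
proof -
  have sub: "cball x r \<subseteq> cball y r" if "dist x y \<le> r" for x y :: "'p padic"
  proof
    fix z assume "z \<in> cball x r"
    thus "z \<in> cball y r"
      using that padic_abs_diff_le[of y x r z] by (simp add: dist_padic_def padic_abs_diff_commute)
  qed
  show ?thesis by (intro subset_antisym sub) (use assms in \<open>simp_all add: dist_commute\<close>)
qed

text \<open>The function is locally constant, because in an ultrametric space any point of a ball is
  a centre of it.\<close>

lemma borel_measurable_measure_cball:
  assumes "r > 0"
  shows "(\<lambda>x :: 'p::prime_card padic. measure \<mu> (cball x r)) \<in> borel_measurable borel"
proof (rule borel_measurable_continuous_onI)
  show "continuous_on UNIV (\<lambda>x :: 'p padic. measure \<mu> (cball x r))"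
    unfolding continuous_on_iff
  proof (intro ballI allI impI exI[of _ r] conjI assms)
    fix x y :: "'p padic" and e :: real assume "dist y x < r" "e > 0"
    hence "cball y r = cball x r" by (intro padic_cball_eq) auto
    thus "dist (measure \<mu> (cball y r)) (measure \<mu> (cball x r)) < e" using \<open>e > 0\<close> by simp
  qed
qed

text \<open>The left side is the product mass of the pairs at distance at most
  \<open>p ^ (- n)\<close>; this turns the sum bounded by \<open>padic_energy_le\<close> into an
  integral.\<close>

lemma integral_measure_cball:
  fixes \<mu> :: "'p::prime_card padic measure"
  assumes \<mu>: "borel_prob \<mu>" "AE x in \<mu>. padic_abs x \<le> 1"
  shows "(LINT x|\<mu>. measure \<mu> (cball x (inverse (real CARD('p)) ^ n))) =
     (\<Sum>b<CARD('p) ^ n. (measure \<mu> (cball (of_nat b) (inverse (real CARD('p)) ^ n)))\<^sup>2)"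
proof -
  have pos: "inverse (real CARD('p)) ^ n > 0" using padic_p_gt_1[where 'p='p] by simp
  have "(LINT x|\<mu>. measure \<mu> (cball x (inverse (real CARD('p)) ^ n))) =
     (\<Sum>b<CARD('p) ^ n. measure \<mu> (cball (of_nat b) (inverse (real CARD('p)) ^ n)) *\<^sub>R
        measure \<mu> (cball (of_nat b) (inverse (real CARD('p)) ^ n)))"
  proof (rule integral_padic_residues[OF \<mu>])
    show "(\<lambda>x. measure \<mu> (cball x (inverse (real CARD('p)) ^ n))) \<in> borel_measurable \<mu>"
      using \<mu> borel_measurable_measure_cball[OF pos] by (simp add: borel_prob_def cong: measurable_cong_sets)
    fix x :: "'p padic" and b assume "padic_abs (x - of_nat b) \<le> inverse (real CARD('p)) ^ n"
    thus "measure \<mu> (cball x (inverse (real CARD('p)) ^ n)) = measure \<mu> (cball (of_nat b) (inverse (real CARD('p)) ^ n))"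
      by (subst padic_cball_eq[of x "of_nat b"]) (auto simp: dist_padic_def)
  qed
  thus ?thesis by (simp add: power2_eq_square)
qed

text \<open>The part of \<open>F\<close> in a covering set lies in a ball centred in
  \<open>F\<close> of comparable size, whose mass is at most a constant times the weight of that
  set. Covers of small total weight therefore leave no mass for \<open>F\<close>.\<close>

lemma mass_distribution:
  fixes \<mu> :: "'p::prime_card padic measure" and A F :: "'p padic set"
  assumes \<mu>: "borel_prob \<mu>" "AE x in \<mu>. x \<in> A" and s: "s > 0" and K: "K \<ge> 0"
    and F: "F \<in> sets \<mu>" "\<And>x n. x \<in> F \<Longrightarrow>
      measure \<mu> (cball x (inverse (real CARD('p)) ^ n)) \<le> K * real CARD('p) powr (- (s * real n))"
    and null: "hausdorff_measure s A = 0"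
  shows "emeasure \<mu> F = 0"
proof -
  let ?p = "real CARD('p)"
  interpret prob_space \<mu> using \<mu> by (simp add: borel_prob_def)
  have sets: "sets \<mu> = sets borel" using \<mu> by (simp add: borel_prob_def)
  have p1: "1 < ?p" by (rule padic_p_gt_1)
  have cover: "emeasure \<mu> F \<le> ennreal (K * ?p powr s) * (\<Sum>i. hausdorff_weight s (U i))"
    if U: "A \<subseteq> (\<Union>i. U i)" "\<And>i. bounded (U i) \<and> diameter (U i) \<le> 1" for U :: "nat \<Rightarrow> 'p padic set"
  proof -
    have "\<exists>V. V \<in> sets \<mu> \<and> U i \<inter> F \<subseteq> V \<and> emeasure \<mu> V \<le> ennreal (K * ?p powr s) * hausdorff_weight s (U i)" for i
    proof (cases "U i \<inter> F = {}")
      case True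
      thus ?thesis by (intro exI[of _ "{}"]) auto
    next
      case False
      then obtain x where x: "x \<in> U i" "x \<in> F" by auto
      define d where "d = diameter (U i)"
      have d: "0 \<le> d" "d \<le> 1" "\<And>y. y \<in> U i \<Longrightarrow> dist x y \<le> d"
        using U(2)[of i] x(1) diameter_ge_0 diameter_bounded_bound by (auto simp: d_def)
      have w: "hausdorff_weight s (U i) = ennreal (d powr s)"
        using s x by (auto simp: hausdorff_weight_def d_def)
      show ?thesis
      proof (cases "d = 0")
        \<comment> \<open>A set of diameter 0 has weight \<open>0 powr s = 0\<close>, so its point
          must carry no mass; the bound for ever smaller balls shows this.\<close>
        case True
        have "measure \<mu> {x} \<le> K * (?p powr (- s)) ^ n" for n
        proof -
          have "measure \<mu> {x} \<le> measure \<mu> (cball x (inverse ?p ^ n))"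
            using p1 by (intro finite_measure_mono) (auto simp: sets)
          also have "\<dots> \<le> K * ?p powr (- (s * real n))" by (rule F(2)[OF x(2)])
          also have "?p powr (- (s * real n)) = (?p powr (- s)) ^ n"
            using p1 by (simp add: powr_power mult.commute)
          finally show ?thesis .
        qed
        moreover have "(\<lambda>n. K * (?p powr (- s)) ^ n) \<longlonglongrightarrow> 0"
          using p1 s powr_less_mono[of "- s" 0 ?p] by (intro tendsto_mult_right_zero LIMSEQ_power_zero) auto
        ultimately have "measure \<mu> {x} \<le> 0"
          by (intro LIMSEQ_le_const) auto
        hence "emeasure \<mu> {x} = 0" by (simp add: emeasure_eq_measure measure_le_0_iff)
        moreover have "U i \<inter> F \<subseteq> {x}" using d(3) True by auto
        ultimately show ?thesis by (intro exI[of _ "{x}"]) (simp add: sets)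
      next
        case False
        hence d0: "d > 0" using d by simp
        \<comment> \<open>The largest \<open>n\<close> with \<open>d \<le> p ^ (- n)\<close>.
          Rounding the diameter up to a power of \<open>p\<close> costs the factor
          \<open>p powr s\<close>.\<close>
        define n where "n = nat \<lfloor>- log ?p d\<rfloor>"
        have "0 \<le> - log ?p d" using d0 d p1 by simp
        hence n: "real n \<le> - log ?p d" "- log ?p d < real n + 1" by (auto simp: n_def)
        have "d = ?p powr (log ?p d)" using d0 p1 by simp
        also have "\<dots> \<le> ?p powr (- real n)" using n p1 by (intro powr_mono) auto
        also have "\<dots> = inverse ?p ^ n" using p1 by (simp add: powr_minus powr_realpow power_inverse)
        finally have dn: "d \<le> inverse ?p ^ n" .
        have "?p powr (- real n) \<le> ?p powr (1 + log ?p d)" using n p1 by (intro powr_mono) auto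
        hence "?p powr (- real n) \<le> ?p * d" using p1 d0 by (simp add: powr_add)
        hence "(?p powr (- real n)) powr s \<le> (?p * d) powr s" using s by (intro powr_mono2) auto
        hence pn: "?p powr (- (s * real n)) \<le> ?p powr s * d powr s"
          using p1 d0 by (simp add: powr_powr powr_mult mult.commute)
        have "measure \<mu> (cball x (inverse ?p ^ n)) \<le> K * (?p powr s * d powr s)"
          using F(2)[OF x(2), of n] mult_left_mono[OF pn K] by linarith
        hence "emeasure \<mu> (cball x (inverse ?p ^ n)) \<le> ennreal (K * ?p powr s) * ennreal (d powr s)"
          using K by (simp add: emeasure_eq_measure ennreal_leI mult.assoc flip: ennreal_mult)
        moreover have "U i \<inter> F \<subseteq> cball x (inverse ?p ^ n)" using d(3) dn by force
        ultimately show ?thesis by (intro exI[of _ "cball x (inverse ?p ^ n)"]) (simp add: sets w)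
      qed
    qed
    then obtain V where V: "\<And>i. V i \<in> sets \<mu>" "\<And>i. U i \<inter> F \<subseteq> V i"
      "\<And>i. emeasure \<mu> (V i) \<le> ennreal (K * ?p powr s) * hausdorff_weight s (U i)" by metis
    have "AE x in \<mu>. x \<in> F \<longrightarrow> x \<in> (\<Union>i. V i)"
      using \<mu>(2)
    proof eventually_elim
      case (elim x)
      thus ?case using U(1) V(2) by blast
    qed
    hence "emeasure \<mu> F \<le> emeasure \<mu> (\<Union>i. V i)"
      using V(1) by (intro emeasure_mono_AE) auto
    also have "\<dots> \<le> (\<Sum>i. emeasure \<mu> (V i))"
      using V(1) by (intro emeasure_subadditive_countably) auto
    also have "\<dots> \<le> (\<Sum>i. ennreal (K * ?p powr s) * hausdorff_weight s (U i))"
      by (intro suminf_le V) auto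
    finally show ?thesis by simp
  qed
  show ?thesis
  proof (rule ccontr)
    assume "emeasure \<mu> F \<noteq> 0"
    hence m: "measure \<mu> F > 0" by (simp add: emeasure_eq_measure measure_nonneg less_le)
    define c where "c = K * ?p powr s"
    have c: "c \<ge> 0" using K by (simp add: c_def)
    \<comment> \<open>At scale 1 all diameters are at most 1, so that the radii
      \<open>p ^ (- n)\<close> with natural \<open>n\<close> suffice.\<close>
    have "hausdorff_premeasure s 1 A \<le> hausdorff_measure s A"
      unfolding hausdorff_measure_def by (intro SUP_upper) auto
    hence "hausdorff_premeasure s 1 A < ennreal (measure \<mu> F / (c + 1))"
      using m c null by simp
    then obtain U :: "nat \<Rightarrow> 'p padic set" where U: "A \<subseteq> (\<Union>i. U i)" "\<And>i. bounded (U i) \<and> diameter (U i) \<le> 1"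
      "(\<Sum>i. hausdorff_weight s (U i)) < ennreal (measure \<mu> F / (c + 1))"
      unfolding hausdorff_premeasure_def INF_less_iff by blast
    have "ennreal (measure \<mu> F) \<le> ennreal c * (\<Sum>i. hausdorff_weight s (U i))"
      using cover[OF U(1,2)] by (simp add: emeasure_eq_measure c_def)
    also have "\<dots> \<le> ennreal c * ennreal (measure \<mu> F / (c + 1))"
      using U(3) by (intro mult_left_mono) auto
    also have "\<dots> = ennreal (c * (measure \<mu> F / (c + 1)))"
      by (rule ennreal_mult[symmetric]) (use c m in auto)
    finally have "measure \<mu> F \<le> c * (measure \<mu> F / (c + 1))"
      using c m by (subst (asm) ennreal_le_iff) auto
    thus False using m c by (simp add: field_simps)
  qed
qed

text \<open>With the convention of \<open>hausdorff_weight\<close> at \<open>s = 0\<close> each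
  nonempty covering set counts 1. This disposes of the exponent 0, which
  \<open>mass_distribution\<close> excludes.\<close>

lemma hausdorff_measure_0_nonempty:
  assumes "A \<noteq> {}"
  shows "hausdorff_measure 0 A \<noteq> 0"
proof
  assume null: "hausdorff_measure 0 A = 0"
  have "hausdorff_premeasure 0 1 A \<le> hausdorff_measure 0 A"
    unfolding hausdorff_measure_def by (intro SUP_upper) auto
  hence "hausdorff_premeasure 0 1 A < 1" using null by simp
  then obtain U where U: "A \<subseteq> (\<Union>i. U i)" "(\<Sum>i. hausdorff_weight 0 (U i :: 'a set)) < 1"
    unfolding hausdorff_premeasure_def INF_less_iff by blast
  then obtain i where "U i \<noteq> {}" using assms by blast
  hence "1 = (\<Sum>j\<in>{i}. hausdorff_weight 0 (U j))" by (simp add: hausdorff_weight_def)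
  also have "\<dots> \<le> (\<Sum>j. hausdorff_weight 0 (U j))" by (intro sum_le_suminf) auto
  finally show False using U(2) by simp
qed

text \<open>Finite energy makes the potential \<open>\<Sum>n. p ^ (n * s) * \<mu> (cball x (p ^ (- n)))\<close> finite almost everywhere, hence
  bounded on a set of positive measure, to which the mass distribution principle applies.\<close>
lemma fourier_decay_imp_hausdorff_measure_pos:
  fixes \<mu> :: "'p::prime_card padic measure"
  assumes \<mu>: "borel_prob \<mu>" "AE x in \<mu>. x \<in> A" and A: "A \<subseteq> {x. padic_abs x \<le> 1}"
    and C: "\<And>\<xi>. \<xi> \<noteq> 0 \<Longrightarrow> (cmod (padic_fourier \<mu> \<xi>))\<^sup>2 * padic_abs \<xi> powr \<beta> \<le> C"
    and \<beta>: "\<beta> \<le> 1" and s: "0 < s" "s < \<beta>"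
  shows "hausdorff_measure s A \<noteq> 0"
proof
  assume null: "hausdorff_measure s A = 0"
  let ?p = "real CARD('p)"
  interpret prob_space \<mu> using \<mu> by (simp add: borel_prob_def)
  have sets: "sets \<mu> = sets borel" using \<mu> by (simp add: borel_prob_def)
  have p1: "1 < ?p" by (rule padic_p_gt_1)
  have \<mu>1: "AE x in \<mu>. padic_abs x \<le> 1" using \<mu>(2) by eventually_elim (use A in auto)
  have C0: "0 \<le> C" using order_trans[OF _ C[of 1]] by simp
  define h where "h n x = ?p powr (s * real n) * measure \<mu> (cball x (inverse ?p ^ n))" for n x
  have h_nonneg: "0 \<le> h n x" for n x by (simp add: h_def)
  have h_meas: "h n \<in> borel_measurable \<mu>" for n
  proof -
    have "(\<lambda>x :: 'p padic. measure \<mu> (cball x (inverse ?p ^ n))) \<in> borel_measurable \<mu>"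
      using borel_measurable_measure_cball[of "inverse ?p ^ n" \<mu>] p1 \<mu>(1)
      by (simp add: borel_prob_def cong: measurable_cong_sets)
    thus ?thesis unfolding h_def by (intro borel_measurable_times borel_measurable_const)
  qed
  \<comment> \<open>The energy bound decays like \<open>p ^ (- \<beta> n)\<close> against the growth
    \<open>p ^ (s n)\<close> of the potential; \<open>s < \<beta>\<close> makes the ratio less than
    1.\<close>
  define \<rho> where "\<rho> = ?p powr (s - \<beta>)"
  have \<rho>: "0 < \<rho>" "\<rho> < 1" using p1 s powr_less_mono[of "s - \<beta>" 0 ?p] by (auto simp: \<rho>_def)
  have int_h: "(\<integral>\<^sup>+ x. ennreal (h n x) \<partial>\<mu>) \<le> ennreal ((1 + real n * C) * \<rho> ^ n)" for n
  proof -
    have bdd: "\<bar>h n x\<bar> \<le> ?p powr (s * real n) * 1" for x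
      unfolding h_def abs_mult using p1 by (intro mult_mono) auto
    hence "integrable \<mu> (h n)"
      using h_meas by (intro integrable_const_bound[where B = "?p powr (s * real n)"]) auto
    hence "(\<integral>\<^sup>+ x. ennreal (h n x) \<partial>\<mu>) = ennreal (LINT x|\<mu>. h n x)"
      using h_nonneg by (intro nn_integral_eq_integral) auto
    also have "(LINT x|\<mu>. h n x) = ?p powr (s * real n) *
        (\<Sum>b<CARD('p) ^ n. (measure \<mu> (cball (of_nat b) (inverse ?p ^ n)))\<^sup>2)"
      unfolding h_def by (simp add: integral_measure_cball[OF \<mu>(1) \<mu>1])
    also have "\<dots> \<le> ?p powr (s * real n) * ((1 + real n * C) * ?p powr (- (\<beta> * real n)))"
      by (intro mult_left_mono padic_energy_le[OF \<mu>(1) \<mu>1 C \<beta>]) auto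
    also have "\<dots> = (1 + real n * C) * \<rho> ^ n"
    proof -
      have "\<rho> ^ n = ?p powr (s * real n + - (\<beta> * real n))"
        using p1 by (simp add: \<rho>_def powr_power algebra_simps)
      thus ?thesis by (simp only: powr_add mult_ac)
    qed
    finally show ?thesis by (simp add: ennreal_leI)
  qed
  have summ: "summable (\<lambda>n. (1 + real n * C) * \<rho> ^ n)"
  proof -
    have "summable (\<lambda>n. \<rho> ^ n)" using \<rho> by (intro summable_geometric) auto
    moreover have "summable (\<lambda>n. real (Suc n) * \<rho> ^ n)"
      using \<rho> geometric_deriv_sums[of \<rho>] by (auto intro: sums_summable)
    ultimately have "summable (\<lambda>n. (1 - C) * \<rho> ^ n + C * (real (Suc n) * \<rho> ^ n))"
      by (intro summable_add summable_mult)
    thus ?thesis by (simp add: algebra_simps)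
  qed
  define G where "G x = (\<Sum>n. ennreal (h n x))" for x
  define S where "S = (\<Sum>n. (1 + real n * C) * \<rho> ^ n)"
  have G_meas: "G \<in> borel_measurable \<mu>"
    unfolding G_def using h_meas by measurable
  have "(\<integral>\<^sup>+ x. G x \<partial>\<mu>) = (\<Sum>n. \<integral>\<^sup>+ x. ennreal (h n x) \<partial>\<mu>)"
    unfolding G_def using h_meas by (intro nn_integral_suminf) auto
  also have "\<dots> \<le> (\<Sum>n. ennreal ((1 + real n * C) * \<rho> ^ n))"
    by (intro suminf_le int_h) auto
  also have "\<dots> = ennreal S"
    unfolding S_def using \<rho> C0 by (intro suminf_ennreal2 summ) auto
  finally have G_le: "(\<integral>\<^sup>+ x. G x \<partial>\<mu>) \<le> ennreal S" .
  have S0: "S \<ge> 0" unfolding S_def using \<rho> C0 by (intro suminf_nonneg summ) auto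
  define F where "F = {x \<in> space \<mu>. G x \<le> ennreal (S + 1)}"
  have F_sets: "F \<in> sets \<mu>" unfolding F_def using G_meas by measurable
  have "emeasure \<mu> F = 0"
  proof (rule mass_distribution[OF \<mu> s(1) _ F_sets _ null])
    fix x n assume "x \<in> F"
    hence "ennreal (h n x) \<le> ennreal (S + 1)"
      unfolding F_def G_def using sum_le_suminf[of "\<lambda>n. ennreal (h n x)" "{n}"] by (auto intro: order_trans)
    hence "h n x \<le> S + 1" using S0 by (subst (asm) ennreal_le_iff) auto
    thus "measure \<mu> (cball x (inverse ?p ^ n)) \<le> (S + 1) * ?p powr (- (s * real n))"
      using p1 by (simp add: h_def powr_minus field_simps)
  qed (use S0 in auto)
  \<comment> \<open>With \<open>F\<close> null, \<open>G\<close> is at least \<open>S + 1\<close>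
    almost everywhere, against its integral of at most \<open>S\<close>.\<close>
  hence "AE x in \<mu>. x \<notin> F" by (intro AE_not_in) (auto simp: null_sets_def F_sets)
  hence "AE x in \<mu>. ennreal (S + 1) \<le> G x"
    using AE_space by eventually_elim (auto simp: F_def not_le)
  hence "(\<integral>\<^sup>+ x. ennreal (S + 1) \<partial>\<mu>) \<le> (\<integral>\<^sup>+ x. G x \<partial>\<mu>)"
    by (rule nn_integral_mono_AE)
  hence "ennreal (S + 1) \<le> ennreal S" using G_le by (simp add: emeasure_space_1)
  thus False using S0 by (subst (asm) ennreal_le_iff) auto
qed

lemma fourier_dim_le_hausdorff_dim:
  assumes A: "A \<subseteq> {x :: 'p::prime_card padic. padic_abs x \<le> 1}"
  shows "fourier_dim A \<le> hausdorff_dim A"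
  unfolding fourier_dim_def hausdorff_dim_def
proof (intro SUP_least INF_greatest)
  fix \<beta> s :: real
  assume "\<beta> \<in> {\<beta>. 0 \<le> \<beta> \<and> \<beta> \<le> 1 \<and> (\<exists>\<mu>\<in>compact_probs_on A.
        bdd_above ((\<lambda>\<xi>. (cmod (padic_fourier \<mu> \<xi>))\<^sup>2 * padic_abs \<xi> powr \<beta>) ` (- {0})))}"
    and "s \<in> {s. 0 \<le> s \<and> hausdorff_measure s A = 0}"
  then obtain \<mu> where \<beta>: "0 \<le> \<beta>" "\<beta> \<le> 1" and \<mu>: "\<mu> \<in> compact_probs_on A"
    and bdd: "bdd_above ((\<lambda>\<xi>. (cmod (padic_fourier \<mu> \<xi>))\<^sup>2 * padic_abs \<xi> powr \<beta>) ` (- {0}))"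
    and s: "0 \<le> s" "hausdorff_measure s A = 0"
    by blast
  have bp: "borel_prob \<mu>" and supp: "measure_support \<mu> \<subseteq> A"
    using \<mu> by (auto simp: compact_probs_on_def)
  interpret prob_space \<mu> using bp by (simp add: borel_prob_def)
  have AE: "AE x in \<mu>. x \<in> A" using AE_measure_support[OF bp] by eventually_elim (use supp in auto)
  obtain C where C: "\<And>\<xi>. \<xi> \<noteq> 0 \<Longrightarrow> (cmod (padic_fourier \<mu> \<xi>))\<^sup>2 * padic_abs \<xi> powr \<beta> \<le> C"
    using bdd by (auto simp: bdd_above_def)
  have "A \<noteq> {}"
  proof
    assume "A = {}"
    hence "AE x in \<mu>. False" using AE by simp
    thus False by simp
  qed
  hence "s \<noteq> 0" using s hausdorff_measure_0_nonempty by metis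
  thus "ennreal \<beta> \<le> ennreal s"
    using fourier_decay_imp_hausdorff_measure_pos[OF bp AE A C \<beta>(2), of s] s by (intro ennreal_leI) force
qed


section \<open>A lower bound for the number of primes\<close>

text \<open>The entries of Leibniz's harmonic triangle. Row \<open>m\<close> starts with
  \<open>1 / m\<close> and the rest is generated by differences, so a common multiple of
  \<open>1, ..., m\<close> clears all its denominators and is at least each of them (Nair's route to
  Chebyshev's bound).\<close>

definition leibniz_harmonic :: "nat \<Rightarrow> nat \<Rightarrow> real" where
  "leibniz_harmonic m k = inverse (real k * real (m choose k))"

lemma leibniz_harmonic_Suc:
  assumes "1 \<le> k" "k < m"
  shows "leibniz_harmonic m (Suc k) = leibniz_harmonic (m - 1) k - leibniz_harmonic m k"
proof -
  obtain l where m: "m = Suc l" using assms by (cases m) auto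
  have pos: "real (l choose k) > 0" "real (m choose k) > 0" "real (m choose Suc k) > 0"
    using assms m by (auto simp del: binomial_Suc_Suc)
  have "Suc k * (Suc l choose Suc k) = Suc l * (l choose k)"
    using Suc_times_binomial_eq[of l k] by (simp only: mult.commute)
  hence 1: "real (Suc k) * real (m choose Suc k) = real m * real (l choose k)"
    unfolding m by (simp only: of_nat_mult[symmetric])
  have "(m - k) * (m choose k) = m * (l choose k)"
    using binomial_absorb_comp[of m k] m by simp
  hence "real (m - k) * real (m choose k) = real m * real (l choose k)"
    by (simp only: of_nat_mult[symmetric])
  hence 2: "(real m - real k) * real (m choose k) = real m * real (l choose k)"
    using assms by (simp add: of_nat_diff)
  have mk: "real m - real k > 0" "real m > 0" "real k > 0" using assms by auto
  have "real (m choose k) = real m * real (l choose k) / (real m - real k)"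
    using 2 mk by (simp add: field_simps)
  hence h1: "leibniz_harmonic m k = (real m - real k) / (real k * (real m * real (l choose k)))"
    using mk pos by (simp add: leibniz_harmonic_def field_simps)
  have h2: "leibniz_harmonic m (Suc k) = 1 / (real m * real (l choose k))"
    unfolding leibniz_harmonic_def 1 by (simp add: inverse_eq_divide)
  have h3: "leibniz_harmonic (m - 1) k = 1 / (real k * real (l choose k))"
    by (simp add: leibniz_harmonic_def m inverse_eq_divide)
  show ?thesis
    unfolding h1 h2 h3 using mk pos by (simp add: divide_simps)
qed

lemma common_multiple_times_leibniz_harmonic:
  assumes "\<And>j. 1 \<le> j \<Longrightarrow> j \<le> m \<Longrightarrow> j dvd N" "1 \<le> k" "k \<le> m"
  shows "real N * leibniz_harmonic m k \<in> \<int>"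
  using assms(2,3,1)
proof (induction k arbitrary: m rule: dec_induct)
  case base
  obtain c where "N = m * c" using base by (auto elim: dvdE)
  hence "real N * leibniz_harmonic m 1 = of_nat c" using base by (simp add: leibniz_harmonic_def)
  thus ?case by (simp only: Ints_of_nat)
next
  case (step k)
  have "real N * leibniz_harmonic (m - 1) k \<in> \<int>" "real N * leibniz_harmonic m k \<in> \<int>"
    using step by auto
  thus ?case
    using step(1,4) by (simp add: leibniz_harmonic_Suc right_diff_distrib)
qed

lemma common_multiple_ge_binomial:
  assumes "\<And>j. 1 \<le> j \<Longrightarrow> j \<le> m \<Longrightarrow> j dvd N" "1 \<le> k" "k \<le> m" "N > 0"
  shows "k * (m choose k) \<le> N"
proof -
  have pos: "real k * real (m choose k) > 0" using assms by simp
  have "real N * leibniz_harmonic m k \<in> \<int>"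
    by (rule common_multiple_times_leibniz_harmonic) (use assms in auto)
  then obtain z where z: "real N * leibniz_harmonic m k = of_int z" by (auto elim: Ints_cases)
  have "real N * leibniz_harmonic m k > 0"
    using assms(4) pos unfolding leibniz_harmonic_def
    by (intro mult_pos_pos[OF _ positive_imp_inverse_positive]) auto
  hence "z \<ge> 1" unfolding z by simp
  hence "real N * leibniz_harmonic m k \<ge> 1" unfolding z by simp
  hence "real k * real (m choose k) \<le> real N"
    using pos by (simp add: leibniz_harmonic_def field_simps)
  thus ?thesis by (metis of_nat_le_iff of_nat_mult)
qed

text \<open>The least common multiple: each prime enters with its largest power not exceeding
  \<open>m\<close>, hence contributes a factor of at most \<open>m\<close>.\<close>

lemma exists_common_multiple_le:
  assumes "m \<ge> 1"
  obtains N :: nat where "\<And>j. 1 \<le> j \<Longrightarrow> j \<le> m \<Longrightarrow> j dvd N" "N > 0" "N \<le> m ^ card {q. prime q \<and> q \<le> m}"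
proof -
  let ?P = "{q. prime q \<and> q \<le> m}"
  have fin: "finite ?P" by (rule finite_subset[of _ "{..m}"]) auto
  define E where "E q = Max {e. q ^ e \<le> m}" for q
  have finE: "finite {e. q ^ e \<le> m}" if "q \<in> ?P" for q
  proof (rule finite_subset[of _ "{..m}"])
    show "{e. q ^ e \<le> m} \<subseteq> {..m}"
    proof (rule subsetI)
      fix e assume "e \<in> {e. q ^ e \<le> m}"
      hence e: "q ^ e \<le> m" by simp
      have "e < q ^ e" using that prime_gt_1_nat by (intro less_exp power_gt_expt) auto
      thus "e \<in> {..m}" using e by simp
    qed
  qed auto
  have E: "q ^ E q \<le> m" if "q \<in> ?P" for q
  proof -
    have "E q \<in> {e. q ^ e \<le> m}" unfolding E_def
      using finE[OF that] assms by (intro Max_in) (auto intro!: exI[of _ 0])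
    thus ?thesis by simp
  qed
  define N where "N = (\<Prod>q\<in>?P. q ^ E q)"
  have "j dvd N" if j: "1 \<le> j" "j \<le> m" for j
  proof -
    have "j = (\<Prod>q\<in>prime_factors j. q ^ multiplicity q j)"
      using j by (intro prime_factorization_nat) auto
    also have "\<dots> dvd N"
      unfolding N_def
    proof (rule prod_dvd_prod_subset2[OF fin])
      show "prime_factors j \<subseteq> ?P"
        using j by (auto simp: in_prime_factors_iff dest!: dvd_imp_le)
      fix q assume q: "q \<in> prime_factors j"
      hence qP: "q \<in> ?P" using j by (auto simp: in_prime_factors_iff dest!: dvd_imp_le)
      have "q ^ multiplicity q j dvd j" by (rule multiplicity_dvd)
      hence "q ^ multiplicity q j \<le> m" using j dvd_imp_le[of "q ^ multiplicity q j" j] by linarith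
      hence "multiplicity q j \<le> E q" unfolding E_def using finE[OF qP] by (intro Max_ge) auto
      thus "q ^ multiplicity q j dvd q ^ E q" by (rule le_imp_power_dvd)
    qed
    finally show ?thesis .
  qed
  moreover have "N > 0" unfolding N_def by (intro prod_pos) (auto simp: prime_gt_0_nat)
  moreover have "N \<le> m ^ card ?P"
    unfolding N_def using E by (simp add: prod_mono2 flip: prod_constant) (intro prod_mono, auto)
  ultimately show thesis using that by blast
qed

text \<open>With \<open>n = m div 2\<close>, the central binomial coefficient forces every positive
  common multiple of \<open>1, ..., m\<close> to be at least \<open>4 ^ n / 2\<close>, and
  \<open>2 * n - 1 \<ge> m - 2\<close>. The upper bound by \<open>m\<close> to the number of primes
  gives the claim after taking logarithms.\<close>

lemma chebyshev_lower_bound: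
  assumes "m \<ge> 2"
  shows "(real m - 2) * ln 2 \<le> real (card {q. prime q \<and> q \<le> m}) * ln (real m)"
proof -
  define n where "n = m div 2"
  have n: "n \<ge> 1" "2 * n \<le> m" "m \<le> 2 * n + 1" using assms by (auto simp: n_def)
  obtain N where N: "\<And>j. 1 \<le> j \<Longrightarrow> j \<le> m \<Longrightarrow> j dvd N" "N > 0" "N \<le> m ^ card {q. prime q \<and> q \<le> m}"
    using exists_common_multiple_le[of m] assms by auto
  have "n * (2 * n choose n) \<le> N"
    using N n by (intro common_multiple_ge_binomial) auto
  hence "n * (2 * n choose n) \<le> m ^ card {q. prime q \<and> q \<le> m}" using N by linarith
  hence "real (n * (2 * n choose n)) \<le> real (m ^ card {q. prime q \<and> q \<le> m})" by (simp only: of_nat_le_iff)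
  moreover have "4 ^ n / 2 \<le> real n * real (2 * n choose n)"
    using central_binomial_lower_bound[of n] n by (simp add: field_simps)
  ultimately have "4 ^ n / 2 \<le> real m ^ card {q. prime q \<and> q \<le> m}" by simp
  moreover have "(2::real) powr (real m - 2) \<le> 4 ^ n / 2"
  proof -
    have "(2::real) powr (real m - 2) \<le> 2 powr (2 * real n - 1)" using n by (intro powr_mono) auto
    also have "\<dots> = 2 powr (2 * real n) / 2" by (simp add: powr_diff)
    also have "(2::real) powr (2 * real n) = (2 powr 2) powr real n" by (simp only: powr_powr)
    also have "\<dots> = 4 ^ n" by (simp add: powr_realpow)
    finally show ?thesis .
  qed
  ultimately have "(2::real) powr (real m - 2) \<le> real m ^ card {q. prime q \<and> q \<le> m}" by linarith
  hence "ln ((2::real) powr (real m - 2)) \<le> ln (real m ^ card {q. prime q \<and> q \<le> m})"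
    using assms by (subst ln_le_cancel_iff) auto
  thus ?thesis using assms by (simp add: ln_powr ln_realpow)
qed

text \<open>The lower cutoff keeps the number of such primes dividing an integer of size
  \<open>p ^ (n + k)\<close> at \<open>O(n / k)\<close>. It also excludes \<open>p\<close> itself
  for \<open>k \<ge> 2\<close> and makes the denominators tend to infinity.\<close>

definition large_primes :: "nat \<Rightarrow> nat \<Rightarrow> nat set" where
  "large_primes p k = {q. prime q \<and> p ^ (k div 2) < q \<and> q \<le> p ^ k}"

lemma finite_large_primes: "finite (large_primes p k)"
  by (rule finite_subset[of _ "{..p ^ k}"]) (auto simp: large_primes_def)

lemma card_large_primes_ge:
  assumes p: "p \<ge> 2"
  obtains c :: real and K :: nat where "c > 0" "K \<ge> 2"
    "\<And>k. k \<ge> K \<Longrightarrow> c * real p ^ k / real k \<le> real (card (large_primes p k))"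
proof -
  \<comment> \<open>One half of \<open>ln 2 / ln p\<close> is lost in
    \<open>p ^ k - 2 \<ge> p ^ k / 2\<close>; half of the rest pays for the primes below the cutoff,
    at most \<open>p ^ (k div 2)\<close> in number.\<close>
  define c where "c = ln 2 / (4 * ln (real p))"
  have lnp: "ln (real p) > 0" using p by simp
  have c: "c > 0" using lnp by (simp add: c_def)
  have "(\<lambda>k. real k * inverse (sqrt (real p)) ^ k) \<longlonglongrightarrow> 0"
    using p by (intro powser_times_n_limit_0) (auto simp: norm_inverse field_simps)
  hence ev: "\<forall>\<^sub>F k in sequentially. real k * inverse (sqrt (real p)) ^ k < c"
    by (rule order_tendstoD) (rule c)
  then obtain K0 where K0: "\<And>k. k \<ge> K0 \<Longrightarrow> real k * inverse (sqrt (real p)) ^ k < c"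
    by (auto simp: eventually_sequentially)
  show thesis
  proof (rule that[OF c, of "max K0 2"])
    fix k assume k: "k \<ge> max K0 2"
    have pk: "real p ^ k \<ge> 4"
    proof -
      have "(2::real) ^ 2 \<le> real p ^ 2" using p by (intro power_mono) auto
      also have "\<dots> \<le> real p ^ k" using p k by (intro power_increasing) auto
      finally show ?thesis by simp
    qed
    let ?P = "{q. prime q \<and> q \<le> p ^ k}"
    have finP: "finite ?P" by (rule finite_subset[of _ "{..p ^ k}"]) auto
    have "?P \<subseteq> large_primes p k \<union> {1..p ^ (k div 2)}"
      by (auto simp: large_primes_def Suc_le_eq prime_gt_0_nat)
    hence "card ?P \<le> card (large_primes p k \<union> {1..p ^ (k div 2)})"
      by (intro card_mono) (auto simp: finite_large_primes)
    also have "\<dots> \<le> card (large_primes p k) + p ^ (k div 2)"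
      using card_Un_le[of "large_primes p k" "{1..p ^ (k div 2)}"] by simp
    finally have "real (card ?P) \<le> real (card (large_primes p k) + p ^ (k div 2))" by (simp only: of_nat_le_iff)
    hence A: "real (card ?P) \<le> real (card (large_primes p k)) + real p ^ (k div 2)" by simp
    have B: "real p ^ (k div 2) \<le> c * real p ^ k / real k"
    proof -
      have "sqrt (real p) ^ (2 * (k div 2)) = real p ^ (k div 2)"
        by (simp add: power_mult)
      moreover have "sqrt (real p) ^ (2 * (k div 2)) \<le> sqrt (real p) ^ k"
        using p by (intro power_increasing) auto
      ultimately have 1: "real p ^ (k div 2) \<le> sqrt (real p) ^ k" by simp
      have "real k * inverse (sqrt (real p)) ^ k < c" using K0 k by simp
      hence "real k < c * sqrt (real p) ^ k" using p by (simp add: power_inverse field_simps)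
      hence "real k * sqrt (real p) ^ k \<le> (c * sqrt (real p) ^ k) * sqrt (real p) ^ k"
        by (intro mult_right_mono) auto
      also have "\<dots> = c * real p ^ k"
        by (simp add: mult.assoc flip: power_mult_distrib)
      finally have "sqrt (real p) ^ k \<le> c * real p ^ k / real k" using k by (simp add: field_simps)
      thus ?thesis using 1 by linarith
    qed
    have C: "2 * c * real p ^ k / real k \<le> real (card ?P)"
    proof -
      have "p ^ k \<ge> 2" using pk by (simp flip: of_nat_power)
      from chebyshev_lower_bound[OF this]
      have "(real p ^ k - 2) * ln 2 \<le> real (card ?P) * (real k * ln (real p))"
        using p by (simp add: ln_realpow)
      moreover have "real p ^ k / 2 * ln 2 \<le> (real p ^ k - 2) * ln 2"
        using pk by (intro mult_right_mono) auto
      ultimately have "real p ^ k / 2 * ln 2 \<le> real (card ?P) * (real k * ln (real p))" by linarith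
      thus ?thesis using lnp k by (simp add: c_def field_simps)
    qed
    show "c * real p ^ k / real k \<le> real (card (large_primes p k))"
      using A B C by (simp add: algebra_simps)
  qed auto
qed


section \<open>Exponential sums over primes\<close>

text \<open>Jordan's inequality: a concave function lies above its chord.\<close>

lemma sin_pi_times_ge:
  assumes "0 \<le> \<theta>" "\<theta> \<le> 1 / 2"
  shows "2 * \<theta> \<le> sin (pi * \<theta>)"
proof -
  have "convex_on {0..pi / 2} (\<lambda>x. - sin x)"
  proof (rule f''_ge0_imp_convex)
    show "((\<lambda>x. - sin x) has_real_derivative - cos x) (at x)" for x
      by (auto intro!: derivative_eq_intros)
    show "((\<lambda>x. - cos x) has_real_derivative sin x) (at x)" for x
      by (auto intro!: derivative_eq_intros)
    show "0 \<le> sin x" if "x \<in> {0..pi / 2}" for x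
      using that by (intro sin_ge_zero) auto
  qed auto
  from convex_onD[OF this, of "2 * \<theta>" 0 "pi / 2"] assms
  show ?thesis by (simp add: mult_ac)
qed

lemma norm_one_minus_cis: "cmod (1 - cis (2 * x)) = 2 * \<bar>sin x\<bar>"
proof -
  have "(cmod (1 - cis (2 * x)))\<^sup>2 = (1 - cos (2 * x))\<^sup>2 + (sin (2 * x))\<^sup>2"
    by (simp add: cmod_power2)
  also have "\<dots> = 2 - 2 * cos (2 * x)"
    using sin_cos_squared_add[of "2 * x"] by (simp add: power2_eq_square algebra_simps)
  also have "\<dots> = (2 * \<bar>sin x\<bar>)\<^sup>2"
    by (simp add: cos_double_sin power_mult_distrib)
  finally show ?thesis by (rule power2_eq_imp_eq) simp_all
qed

lemma norm_sum_cis_le: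
  assumes "\<theta> \<noteq> 0" "\<bar>\<theta>\<bar> \<le> 1 / 2"
  shows "cmod (\<Sum>v<V. cis (2 * pi * \<theta> * real v)) \<le> 1 / (2 * \<bar>\<theta>\<bar>)"
proof -
  define w where "w = cis (2 * (pi * \<theta>))"
  have "2 * \<bar>\<theta>\<bar> \<le> \<bar>sin (pi * \<theta>)\<bar>"
    using sin_pi_times_ge[of "\<bar>\<theta>\<bar>"] assms by (cases "\<theta> \<ge> 0") auto
  hence nw: "4 * \<bar>\<theta>\<bar> \<le> cmod (1 - w)"
    unfolding w_def norm_one_minus_cis by simp
  hence w1: "w \<noteq> 1" using assms by auto
  have "(\<Sum>v<V. cis (2 * pi * \<theta> * real v)) = (\<Sum>v<V. w ^ v)"
    unfolding w_def Complex.DeMoivre by (simp add: mult_ac)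
  also have "\<dots> = (1 - w ^ V) / (1 - w)"
    using w1 by (simp add: sum_gp_strict)
  finally have "cmod (\<Sum>v<V. cis (2 * pi * \<theta> * real v)) = cmod (1 - w ^ V) / cmod (1 - w)"
    by (simp add: norm_divide)
  also have "\<dots> \<le> 2 / (4 * \<bar>\<theta>\<bar>)"
  proof (rule frac_le)
    show "cmod (1 - w ^ V) \<le> 2"
      using norm_triangle_ineq4[of 1 "w ^ V"] by (simp add: w_def norm_power)
  qed (use nw assms in auto)
  finally show ?thesis by simp
qed

text \<open>A bound for the squared normalised geometric sum at index \<open>j\<close>: the trivial
  one up to \<open>P\<close>, and beyond it the square of the decay \<open>P / |j|\<close>, which is
  summable.\<close>

definition decay_weight :: "nat \<Rightarrow> int \<Rightarrow> real" where
  "decay_weight P j = (if \<bar>j\<bar> \<le> int P then 1 else (real P / real_of_int \<bar>j\<bar>)\<^sup>2)"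

lemma decay_weight_minus: "decay_weight P (- j) = decay_weight P j"
  by (simp add: decay_weight_def)

text \<open>The tail telescopes through \<open>1 / j^2 \<le> 1 / (j - 1) - 1 / j\<close>; keeping
  the negative term makes the bound inductive.\<close>

lemma sum_decay_weight_nat:
  assumes "P \<ge> 1"
  shows "(\<Sum>j\<in>{1..N}. decay_weight P (int j)) \<le> (if N \<le> P then real N else 2 * real P - (real P)\<^sup>2 / real N)"
proof (induction N)
  case (Suc N)
  show ?case
  proof (cases "Suc N \<le> P")
    case True
    thus ?thesis using Suc by (simp add: decay_weight_def)
  next
    case False
    have "(\<Sum>j\<in>{1..N}. decay_weight P (int j)) \<le> 2 * real P - (real P)\<^sup>2 / real N"
    proof (cases "N = P")
      case True
      thus ?thesis using Suc assms by (simp add: power2_eq_square)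
    qed (use Suc False in auto)
    moreover have "decay_weight P (int (Suc N)) \<le> (real P)\<^sup>2 / real N - (real P)\<^sup>2 / real (Suc N)"
    proof -
      have N: "real N \<ge> 1" using False assms by simp
      have "decay_weight P (int (Suc N)) = (real P)\<^sup>2 * (1 / (real (Suc N) * real (Suc N)))"
        using False by (simp add: decay_weight_def power_divide power2_eq_square)
      also have "\<dots> \<le> (real P)\<^sup>2 * (1 / (real N * real (Suc N)))"
        using N by (intro mult_left_mono divide_left_mono mult_right_mono) auto
      also have "1 / (real N * real (Suc N)) = 1 / real N - 1 / real (Suc N)"
        using N by (simp add: field_simps)
      finally show ?thesis by (simp add: algebra_simps)
    qed
    ultimately show ?thesis using False by simp
  qed
qed simp

lemma sum_decay_weight_le:
  assumes "P \<ge> 1" "finite J"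
  shows "(\<Sum>j\<in>J. decay_weight P j) \<le> 5 * real P"
proof -
  obtain N where N: "\<And>j. j \<in> J \<Longrightarrow> \<bar>j\<bar> \<le> int N"
  proof -
    have "finite ((\<lambda>j. nat \<bar>j\<bar>) ` J)" using assms by simp
    then obtain N where N: "\<forall>i\<in>(\<lambda>j. nat \<bar>j\<bar>) ` J. i \<le> N"
      using finite_nat_set_iff_bounded_le by blast
    have "\<bar>j\<bar> \<le> int N" if "j \<in> J" for j using N that by (auto simp: nat_le_iff)
    thus thesis by (rule that)
  qed
  have nn: "decay_weight P j \<ge> 0" for j by (simp add: decay_weight_def)
  have one: "(\<Sum>j\<in>{1..N}. decay_weight P (int j)) \<le> 2 * real P"
    using sum_decay_weight_nat[OF assms(1), of N] by (auto split: if_splits intro: order_trans)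
  have "J \<subseteq> {0} \<union> (int ` {1..N} \<union> (\<lambda>i. - int i) ` {1..N})"
  proof
    fix j assume "j \<in> J"
    from N[OF this] have "j = 0 \<or> j = int (nat j) \<and> nat j \<in> {1..N} \<or> j = - int (nat (- j)) \<and> nat (- j) \<in> {1..N}"
      by auto
    thus "j \<in> {0} \<union> (int ` {1..N} \<union> (\<lambda>i. - int i) ` {1..N})" by blast
  qed
  hence "(\<Sum>j\<in>J. decay_weight P j) \<le> (\<Sum>j\<in>{0} \<union> (int ` {1..N} \<union> (\<lambda>i. - int i) ` {1..N}). decay_weight P j)"
    by (intro sum_mono2) (auto simp: nn)
  also have "\<dots> = (\<Sum>j\<in>{0}. decay_weight P j) + (\<Sum>j\<in>int ` {1..N} \<union> (\<lambda>i. - int i) ` {1..N}. decay_weight P j)"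
    by (rule sum.union_disjoint) auto
  also have "(\<Sum>j\<in>int ` {1..N} \<union> (\<lambda>i. - int i) ` {1..N}. decay_weight P j) =
      (\<Sum>j\<in>int ` {1..N}. decay_weight P j) + (\<Sum>j\<in>(\<lambda>i. - int i) ` {1..N}. decay_weight P j)"
    by (rule sum.union_disjoint) auto
  also have "(\<Sum>j\<in>int ` {1..N}. decay_weight P j) = (\<Sum>j\<in>{1..N}. decay_weight P (int j))"
    by (subst sum.reindex) (auto simp: inj_on_def)
  also have "(\<Sum>j\<in>(\<lambda>i. - int i) ` {1..N}. decay_weight P j) = (\<Sum>j\<in>{1..N}. decay_weight P (int j))"
    by (subst sum.reindex) (auto simp: inj_on_def decay_weight_minus)
  also have "(\<Sum>j\<in>{0}. decay_weight P j) = 1" by (simp add: decay_weight_def)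
  finally show ?thesis using one assms by simp
qed

section \<open>Counting the primes that share a value of the index \<open>j\<close>\<close>

lemma prod_distinct_primes_dvd:
  fixes t :: nat
  assumes "finite S" "\<And>q. q \<in> S \<Longrightarrow> prime q \<and> q dvd t"
  shows "\<Prod>S dvd t"
  using assms
proof (induction S rule: finite_induct)
  case (insert q S)
  have "coprime q (\<Prod>S)"
    using insert by (intro prod_coprime_right primes_coprime) auto
  thus ?case using insert by (simp add: divides_mult)
qed simp

lemma card_large_prime_divisors:
  fixes t :: nat
  assumes S: "finite S" "\<And>q. q \<in> S \<Longrightarrow> prime q \<and> y \<le> q \<and> q dvd t" and t: "t > 0"
  shows "y ^ card S \<le> t"
proof -
  have "y ^ card S = (\<Prod>q\<in>S. y)" by simp
  also have "\<dots> \<le> \<Prod>S" using S by (intro prod_mono) auto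
  also have "\<dots> \<le> t" using prod_distinct_primes_dvd[OF S(1), of t] S(2) t by (intro dvd_imp_le) auto
  finally show ?thesis .
qed

lemma least_absolute_residue:
  fixes c :: int and m :: nat
  assumes "m > 0"
  obtains b :: int where "int m dvd c - b" "2 * \<bar>b\<bar> \<le> int m"
proof -
  define r where "r = c mod int m"
  have r: "0 \<le> r" "r < int m" "int m dvd c - r"
    using assms by (auto simp: r_def dvd_minus_mod)
  show thesis
  proof (cases "2 * r \<le> int m")
    case True
    thus ?thesis using r that[of r] by simp
  next
    case False
    have "int m dvd (c - r) + int m" using r(3) by (intro dvd_add) auto
    hence "int m dvd c - (r - int m)" by (simp add: algebra_simps)
    moreover have "2 * \<bar>r - int m\<bar> \<le> int m" using False r by (simp add: abs_if)
    ultimately show ?thesis by (rule that)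
  qed
qed

text \<open>If \<open>b\<close> is the least absolute residue of \<open>a / q\<close> modulo \<open>m\<close>, then \<open>b * q = a' + j * m\<close> for some \<open>j\<close>; the
  inner sum is small unless \<open>j\<close> is, and for given \<open>j\<close> few primes \<open>q\<close> divide \<open>a' + j * m\<close>.\<close>
lemma sum_primes_norm_sum_cis_le:
  fixes p k L n V :: nat and a :: int and c :: "nat \<Rightarrow> int" and Q :: "nat set"
  assumes p: "p \<ge> 2" and k: "k \<ge> 2" "L < k" "k \<le> n"
    and V: "V = p ^ (k - 1 - L)" and a: "\<not> int p dvd a"
    and Q: "finite Q" "\<And>q. q \<in> Q \<Longrightarrow> prime q \<and> p ^ (k div 2) \<le> q \<and> q \<le> p ^ k"
    and c: "\<And>q. q \<in> Q \<Longrightarrow> int (p ^ (n - L)) dvd c q * int q - a"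
  shows "(\<Sum>q\<in>Q. (cmod (\<Sum>v<V. cis (2 * pi * (real_of_int (c q) / real (p ^ (n - L))) * real v)) / real V)\<^sup>2)
    \<le> 40 * real n / real k * real p ^ (L + 1)"
proof -
  define m where "m = p ^ (n - L)"
  \<comment> \<open>The ratio of the bound \<open>p ^ k\<close> for \<open>q\<close> to the length
    \<open>V\<close> of the sums; it is the size of \<open>j\<close> beyond which the geometric sum
    decays.\<close>
  define P where "P = p ^ (L + 1)"
  have m0: "m > 0" "int m > 0" "real m > 0" using p by (auto simp: m_def)
  have P1: "P \<ge> 1" using p by (simp add: P_def)
  have V0: "V > 0" using p V by simp
  have pm: "int p dvd int m" using k by (simp add: m_def dvd_power)
  have "L + 1 + (k - 1 - L) = k" using k by simp
  hence PV: "P * V = p ^ k" by (simp only: P_def V power_add[symmetric])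
  define f where "f q = cmod (\<Sum>v<V. cis (2 * pi * (real_of_int (c q) / real m) * real v)) / real V" for q
  have f1: "f q \<le> 1" "f q \<ge> 0" for q
  proof -
    have "cmod (\<Sum>v<V. cis (2 * pi * (real_of_int (c q) / real m) * real v)) \<le> (\<Sum>v<V. 1)"
      by (intro order_trans[OF norm_sum] sum_mono) auto
    thus "f q \<le> 1" using V0 by (simp add: f_def)
    show "f q \<ge> 0" by (simp add: f_def)
  qed
  \<comment> \<open>A representative between 0 and \<open>m\<close> makes \<open>a' + j m\<close>
    comparable to \<open>j m\<close> once \<open>|j| \<ge> 2\<close>. It is still prime to
    \<open>p\<close>, so \<open>a' + j m\<close> never vanishes and has only finitely many
    divisors.\<close>
  define a' where "a' = a mod int m"
  have a': "0 \<le> a'" "a' < int m" "\<not> int p dvd a'"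
    using m0 a pm by (auto simp: a'_def dvd_mod_iff)
  have "\<forall>q\<in>Q. \<exists>b. int m dvd c q - b \<and> 2 * \<bar>b\<bar> \<le> int m"
    using least_absolute_residue[OF m0(1)] by metis
  then obtain b where b: "\<And>q. q \<in> Q \<Longrightarrow> int m dvd c q - b q" "\<And>q. q \<in> Q \<Longrightarrow> 2 * \<bar>b q\<bar> \<le> int m"
    by metis
  define j where "j q = (b q * int q - a') div int m" for q
  have bj: "b q * int q = a' + j q * int m" if "q \<in> Q" for q
  proof -
    have h1: "int m dvd c q * int q - a" using c[OF that] by (simp only: m_def)
    have h2: "int m dvd (c q - b q) * int q" using b(1)[OF that] by (rule dvd_mult2)
    have h3: "int m dvd a - a'" unfolding a'_def by (rule dvd_minus_mod)
    have "int m dvd (c q * int q - a) - (c q - b q) * int q + (a - a')"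
      by (rule dvd_add[OF dvd_diff[OF h1 h2] h3])
    hence "int m dvd b q * int q - a'" by (simp add: algebra_simps)
    thus ?thesis by (simp add: j_def)
  qed
  have ndvd: "\<not> int p dvd a' + i * int m" for i
    using a'(3) pm by (metis dvd_add_left_iff dvd_mult)
  have nz: "a' + i * int m \<noteq> 0" for i using ndvd[of i] by auto
  have fj: "(f q)\<^sup>2 \<le> decay_weight P (j q)" if q: "q \<in> Q" for q
  proof (cases "\<bar>j q\<bar> \<le> int P")
    case True
    thus ?thesis using f1[of q] by (simp add: decay_weight_def power_le_one)
  next
    case False
    hence j2: "\<bar>j q\<bar> \<ge> 2" using P1 by linarith
    have "int m * \<bar>j q\<bar> \<le> 2 * \<bar>a' + j q * int m\<bar>"
    proof (cases "j q \<ge> 0")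
      case True
      hence "0 \<le> j q * int m" by simp
      thus ?thesis using a' True by (simp add: mult.commute)
    next
      case neg: False
      hence "(j q + 2) * int m \<le> 0" using j2 m0 by (intro mult_nonpos_nonneg) auto
      hence "j q * int m + 2 * int m \<le> 0" by (simp add: algebra_simps)
      thus ?thesis using a' neg by (simp add: abs_if mult.commute)
    qed
    also have "\<dots> = 2 * (\<bar>b q\<bar> * int q)" by (simp add: bj[OF q, symmetric] abs_mult)
    also have "\<dots> \<le> 2 * (\<bar>b q\<bar> * int (p ^ k))"
      using Q(2)[OF q] by (intro mult_left_mono) auto
    finally have "int (m * nat \<bar>j q\<bar>) \<le> int (2 * (nat \<bar>b q\<bar> * (P * V)))" by (simp add: PV)
    hence "real (m * nat \<bar>j q\<bar>) \<le> real (2 * (nat \<bar>b q\<bar> * (P * V)))" by (simp only: of_nat_le_iff)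
    hence jb: "real m * \<bar>real_of_int (j q)\<bar> \<le> 2 * \<bar>real_of_int (b q)\<bar> * real P * real V" by simp
    have jpos: "\<bar>real_of_int (j q)\<bar> > 0" using j2 by auto
    have b0: "b q \<noteq> 0" using bj[OF q] nz[of "j q"] by auto
    have cb: "cis (2 * pi * (real_of_int (c q) / real m) * real v) = cis (2 * pi * (real_of_int (b q) / real m) * real v)" for v
    proof -
      have "int m dvd c q * int v - b q * int v"
        using b(1)[OF q] by (metis dvd_mult2 left_diff_distrib)
      from cis_2pi_cong[OF this m0(1)] show ?thesis by (simp add: mult_ac)
    qed
    have "cmod (\<Sum>v<V. cis (2 * pi * (real_of_int (c q) / real m) * real v)) \<le> 1 / (2 * \<bar>real_of_int (b q) / real m\<bar>)"
      unfolding cb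
    proof (rule norm_sum_cis_le)
      have "real_of_int (2 * \<bar>b q\<bar>) \<le> real_of_int (int m)" using b(2)[OF q] by (simp only: of_int_le_iff)
      thus "\<bar>real_of_int (b q) / real m\<bar> \<le> 1 / 2" using m0 by (simp add: field_simps)
    qed (use b0 m0 in auto)
    hence "f q \<le> 1 / (2 * \<bar>real_of_int (b q) / real m\<bar>) / real V"
      unfolding f_def by (intro divide_right_mono) auto
    also have "\<dots> = real m / (2 * \<bar>real_of_int (b q)\<bar> * real V)"
      using m0 by (simp add: abs_divide)
    also have "\<dots> \<le> real P / \<bar>real_of_int (j q)\<bar>"
      using jb jpos b0 V0 by (simp add: field_simps)
    finally have "(f q)\<^sup>2 \<le> (real P / \<bar>real_of_int (j q)\<bar>)\<^sup>2"
      using f1[of q] by (intro power_mono) auto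
    thus ?thesis using False by (simp add: decay_weight_def)
  qed
  \<comment> \<open>The primes with \<open>j q = i\<close> all divide the same nonzero integer
    \<open>t\<close>, of size at most \<open>p ^ (n + k)\<close>, and each is at least
    \<open>p ^ (k div 2)\<close>. So there are at most \<open>(n + k) / (k div 2)\<close> of them,
    and \<open>n + k \<le> 2 * n\<close> with \<open>k \<le> 4 * (k div 2)\<close> gives the
    8.\<close>
  have cnt: "real (card {q \<in> Q. j q = i}) \<le> 8 * real n / real k" if i: "i \<in> j ` Q" for i
  proof -
    let ?S = "{q \<in> Q. j q = i}" and ?t = "a' + i * int m"
    obtain q0 where q0: "q0 \<in> Q" "j q0 = i" using i by auto
    have "(p ^ (k div 2)) ^ card ?S \<le> nat \<bar>?t\<bar>"
    proof (rule card_large_prime_divisors)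
      show "finite ?S" using Q by simp
      fix q assume q: "q \<in> ?S"
      hence "int q dvd ?t" using bj[of q] by (metis (mono_tags, lifting) dvd_triv_right mem_Collect_eq)
      hence "q dvd nat \<bar>?t\<bar>" by (simp add: nat_dvd_iff int_dvd_int_iff flip: int_dvd_int_iff)
      thus "prime q \<and> p ^ (k div 2) \<le> q \<and> q dvd nat \<bar>?t\<bar>" using q Q(2) by auto
    qed (use nz[of i] in auto)
    also have "nat \<bar>?t\<bar> \<le> p ^ n * p ^ k"
    proof -
      have "\<bar>?t\<bar> = \<bar>b q0 * int q0\<bar>" using bj[OF q0(1)] q0(2) by simp
      also have "\<dots> = \<bar>b q0\<bar> * int q0" by (simp add: abs_mult)
      also have "\<dots> \<le> int (p ^ n) * int (p ^ k)"
      proof (rule mult_mono)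
        have "m \<le> p ^ n" unfolding m_def using p by (intro power_increasing) auto
        hence "int m \<le> int (p ^ n)" by (simp only: of_nat_le_iff)
        thus "\<bar>b q0\<bar> \<le> int (p ^ n)" using b(2)[OF q0(1)] by linarith
        show "int q0 \<le> int (p ^ k)" using Q(2)[OF q0(1)] by (simp only: of_nat_le_iff)
      qed auto
      finally have "\<bar>?t\<bar> \<le> int (p ^ n * p ^ k)" by simp
      thus ?thesis by (simp add: nat_le_iff)
    qed
    finally have "p ^ (k div 2 * card ?S) \<le> p ^ (n + k)" by (simp add: power_mult power_add)
    hence "k div 2 * card ?S \<le> n + k" using p by (subst (asm) power_increasing_iff) auto
    hence "k div 2 * card ?S \<le> 2 * n" using k by linarith
    moreover have "k \<le> 4 * (k div 2)" using k by linarith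
    hence "k * card ?S \<le> 4 * (k div 2) * card ?S" by (rule mult_right_mono) simp
    ultimately have "k * card ?S \<le> 8 * n" by linarith
    hence "real (k * card ?S) \<le> real (8 * n)" by (simp only: of_nat_le_iff)
    thus ?thesis using k by (simp add: field_simps)
  qed
  have "(\<Sum>q\<in>Q. (f q)\<^sup>2) \<le> (\<Sum>q\<in>Q. decay_weight P (j q))"
    by (intro sum_mono fj)
  also have "\<dots> = (\<Sum>i\<in>j ` Q. \<Sum>q\<in>{q \<in> Q. j q = i}. decay_weight P (j q))"
    by (rule sum.image_gen[OF Q(1)])
  also have "\<dots> = (\<Sum>i\<in>j ` Q. real (card {q \<in> Q. j q = i}) * decay_weight P i)"
    by (intro sum.cong) auto
  also have "\<dots> \<le> (\<Sum>i\<in>j ` Q. (8 * real n / real k) * decay_weight P i)"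
    by (intro sum_mono mult_right_mono cnt) (auto simp: decay_weight_def)
  also have "\<dots> = (8 * real n / real k) * (\<Sum>i\<in>j ` Q. decay_weight P i)"
    by (simp add: sum_distrib_left)
  \<comment> \<open>The 5 covers the term \<open>j = 0\<close> and two half-lines of weight
    \<open>2 * P\<close> each.\<close>
  also have "\<dots> \<le> (8 * real n / real k) * (5 * real P)"
    using P1 Q(1) by (intro mult_left_mono sum_decay_weight_le) auto
  finally show ?thesis unfolding f_def m_def by (simp add: P_def)
qed


section \<open>A random walk through residues\<close>

lemma exists_quotient_mod_prime_power:
  fixes p q :: nat
  assumes "coprime q p"
  obtains x :: int where "int (p ^ m) dvd x * int q - b"
proof -
  have "coprime (int q) (int (p ^ m))" using assms by simp
  then obtain u where u: "[int q * u = 1] (mod int (p ^ m))"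
    using cong_solve_coprime_int by blast
  have "int (p ^ m) dvd (int q * u - 1) * b"
    using u by (intro dvd_mult2) (simp add: cong_iff_dvd_diff)
  hence "int (p ^ m) dvd (u * b) * int q - b" by (simp add: algebra_simps)
  thus thesis by (rule that)
qed

locale salem_walk =
  fixes p K :: nat and \<tau> :: real
  assumes prime_p: "prime p" and \<tau>: "\<tau> > 1" and K: "K \<ge> 2"
    and nonempty_primes: "\<And>k. k \<ge> K \<Longrightarrow> large_primes p k \<noteq> {}"
begin

text \<open>At stage \<open>N\<close> the residue of the random point modulo \<open>p ^ level N\<close> has been chosen; the next stage makes the
  point equal to a fraction with denominator in \<open>large_primes p (expo N)\<close> modulo \<open>p ^ level (Suc N)\<close>.
  Taking \<open>expo N \<ge> p ^ level N\<close> absorbs the loss from conditioning on the earlier stages.\<close>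
primrec level :: "nat \<Rightarrow> nat" where
  "level 0 = 0"
| "level (Suc N) = nat \<lceil>real (p ^ level N + K) * \<tau>\<rceil>"

declare level.simps(2) [simp del]

definition expo :: "nat \<Rightarrow> nat" where
  "expo N = p ^ level N + K"

text \<open>The \<open>- 1\<close> leaves room for two summands: \<open>s + p ^ L * (v + w)\<close>
  stays at most \<open>2 * p ^ (k - 1)\<close>, hence at most \<open>p ^ k\<close>.\<close>

definition width :: "nat \<Rightarrow> nat" where
  "width N = p ^ (expo N - 1 - level N)"

definition moves :: "nat \<Rightarrow> (nat \<times> nat \<times> nat) set" where
  "moves N = large_primes p (expo N) \<times> {..<width N} \<times> {..<width N}"

text \<open>The first summand makes the fraction with denominator \<open>q\<close> congruent to
  \<open>c\<close> modulo \<open>p ^ level N\<close>, so the new stage extends the old one; the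
  second runs over the remaining freedom.\<close>

definition numerator :: "nat \<Rightarrow> int \<Rightarrow> nat \<times> nat \<times> nat \<Rightarrow> int" where
  "numerator N c = (\<lambda>(q, v, w). (c * int q) mod int (p ^ level N) + int (p ^ level N) * int (v + w))"

text \<open>The fraction \<open>numerator / q\<close> as a residue modulo
  \<open>p ^ level (Suc N)\<close>. As \<open>q\<close> is invertible there, the choice of the
  solution does not affect the result.\<close>

definition move :: "nat \<Rightarrow> int \<Rightarrow> nat \<times> nat \<times> nat \<Rightarrow> int" where
  "move N c z = (SOME x. int (p ^ level (Suc N)) dvd x * int (fst z) - numerator N c z) mod int (p ^ level (Suc N))"

text \<open>The product space contains sequences with coordinates outside \<open>moves N\<close>,
  which have probability 0. Redirecting them makes the statements about the walk hold for every
  outcome.\<close>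

definition clip :: "nat \<Rightarrow> nat \<times> nat \<times> nat \<Rightarrow> nat \<times> nat \<times> nat" where
  "clip N z = (if z \<in> moves N then z else SOME z. z \<in> moves N)"

primrec walk :: "(nat \<Rightarrow> nat \<times> nat \<times> nat) \<Rightarrow> nat \<Rightarrow> int" where
  "walk \<omega> 0 = 0"
| "walk \<omega> (Suc N) = move N (walk \<omega> N) (clip N (\<omega> N))"

definition walk_space :: "(nat \<Rightarrow> nat \<times> nat \<times> nat) measure" where
  "walk_space = PiM UNIV (\<lambda>N. measure_pmf (pmf_of_set (moves N)))"

lemma p_ge_2: "p \<ge> 2" using prime_p by (rule prime_ge_2_nat)

lemma expo_ge: "expo N \<ge> level N + 3" "expo N \<ge> K" "p ^ level N \<le> expo N"
proof -
  have "level N < p ^ level N" using p_ge_2 by (intro power_gt_expt) auto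
  thus "expo N \<ge> level N + 3" using K by (simp add: expo_def)
qed (auto simp: expo_def)

lemma level_Suc_ge: "real (expo N) * \<tau> \<le> real (level (Suc N))"
  and level_Suc_less: "real (level (Suc N)) < real (expo N) * \<tau> + 1"
proof -
  have nn: "0 \<le> real (expo N) * \<tau>" using \<tau> by simp
  show "real (expo N) * \<tau> \<le> real (level (Suc N))"
    unfolding level.simps expo_def[symmetric] by linarith
  show "real (level (Suc N)) < real (expo N) * \<tau> + 1"
    unfolding level.simps expo_def[symmetric] using nn by linarith
qed

lemma expo_le_level_Suc: "expo N \<le> level (Suc N)"
proof -
  have "real (expo N) * 1 \<le> real (expo N) * \<tau>" using \<tau> by (intro mult_left_mono) auto
  thus ?thesis using level_Suc_ge[of N] by linarith
qed

lemma level_less_Suc: "level N < level (Suc N)"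
  using expo_ge(1)[of N] expo_le_level_Suc[of N] by linarith

lemma level_mono: "N \<le> N' \<Longrightarrow> level N \<le> level N'"
  by (rule lift_Suc_mono_le[of level]) (use level_less_Suc less_imp_le in blast)+

lemma level_ge: "N \<le> level N"
proof (induction N)
  case (Suc N)
  thus ?case using level_less_Suc[of N] by linarith
qed simp

lemma exists_stage:
  assumes "n \<ge> 1"
  obtains N where "level N < n" "n \<le> level (Suc N)"
proof -
  define M where "M = (LEAST M. n \<le> level M)"
  have M: "n \<le> level M" unfolding M_def by (rule LeastI[of _ n]) (rule level_ge)
  hence "M \<noteq> 0" using assms by (intro notI) simp
  then obtain N where N: "M = Suc N" by (cases M) auto
  have "\<not> n \<le> level N" using not_less_Least[of N "\<lambda>M. n \<le> level M"] N by (simp add: M_def)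
  hence "level N < n" by simp
  moreover have "n \<le> level (Suc N)" using M N by simp
  ultimately show thesis by (rule that)
qed

lemma width_times_power: "p ^ level N * width N = p ^ (expo N - 1)"
proof -
  have "level N + (expo N - 1 - level N) = expo N - 1" using expo_ge(1)[of N] by simp
  thus ?thesis by (simp only: width_def power_add[symmetric])
qed

lemma width_pos: "width N > 0" using p_ge_2 by (simp add: width_def)

lemma finite_moves: "finite (moves N)" by (simp add: moves_def finite_large_primes)

lemma moves_nonempty: "moves N \<noteq> {}"
  using nonempty_primes[OF expo_ge(2)] width_pos[of N] by (auto simp: moves_def)

lemma clip_in_moves: "clip N z \<in> moves N"
proof (cases "z \<in> moves N")
  case False
  thus ?thesis using some_in_eq[of "moves N"] moves_nonempty by (simp add: clip_def)
qed (simp add: clip_def)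

lemma moves_coprime:
  assumes "z \<in> moves N"
  shows "coprime (fst z) p"
proof -
  have q: "prime (fst z)" "p ^ (expo N div 2) < fst z"
    using assms by (auto simp: moves_def large_primes_def)
  have "p ^ 1 \<le> p ^ (expo N div 2)" using expo_ge(1)[of N] p_ge_2 by (intro power_increasing) auto
  hence "fst z \<noteq> p" using q by auto
  thus ?thesis using q prime_p primes_coprime by blast
qed

lemma move_times: 
  assumes "z \<in> moves N"
  shows "int (p ^ level (Suc N)) dvd move N c z * int (fst z) - numerator N c z"
proof -
  let ?m = "int (p ^ level (Suc N))"
  define x where "x = (SOME x. ?m dvd x * int (fst z) - numerator N c z)"
  have x: "?m dvd x * int (fst z) - numerator N c z"
    unfolding x_def using exists_quotient_mod_prime_power[OF moves_coprime[OF assms]] by (rule someI_ex) blast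
  have "?m dvd (x - x mod ?m) * int (fst z)" by (intro dvd_mult2 dvd_minus_mod)
  from dvd_diff[OF x this] have "?m dvd (x mod ?m) * int (fst z) - numerator N c z"
    by (simp add: algebra_simps)
  thus ?thesis by (simp only: move_def x_def)
qed

lemma move_bounds: "0 \<le> move N c z" "move N c z < int (p ^ level (Suc N))"
  using p_ge_2 by (auto simp: move_def)

text \<open>Modulo \<open>p ^ level N\<close> the numerator is \<open>c * q\<close>, and
  \<open>q\<close> cancels.\<close>

lemma move_cong:
  assumes "z \<in> moves N"
  shows "int (p ^ level N) dvd move N c z - c"
proof -
  let ?m = "int (p ^ level N)" and ?q = "int (fst z)"
  obtain q v w where z: "z = (q, v, w)" by (cases z) auto
  have "?m dvd int (p ^ level (Suc N))"
    using level_less_Suc[of N] by (simp add: le_imp_power_dvd)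
  hence h1: "?m dvd move N c z * ?q - numerator N c z"
    using move_times[OF assms] by (rule dvd_trans)
  have h2: "?m dvd c * ?q - (c * ?q) mod ?m" by (rule dvd_minus_mod)
  have h3: "?m dvd ?m * int (v + w)" by simp
  have eq: "numerator N c z = (c * ?q) mod ?m + ?m * int (v + w)"
    by (simp add: numerator_def z)
  have "?m dvd (move N c z * ?q - numerator N c z) - (c * ?q - (c * ?q) mod ?m) + ?m * int (v + w)"
    by (rule dvd_add[OF dvd_diff[OF h1 h2] h3])
  hence "?m dvd (move N c z - c) * ?q" unfolding eq by (simp add: algebra_simps)
  moreover have "coprime ?m ?q" using moves_coprime[OF assms] by (simp add: coprime_commute)
  ultimately show ?thesis by (simp add: coprime_dvd_mult_left_iff)
qed

lemma walk_cong:
  assumes "N \<le> N'"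
  shows "int (p ^ level N) dvd walk \<omega> N' - walk \<omega> N"
  using assms
proof (induction N' rule: dec_induct)
  case (step M)
  have "int (p ^ level N) dvd int (p ^ level M)" using level_mono[OF step(1)] by (simp add: le_imp_power_dvd)
  also have "\<dots> dvd walk \<omega> (Suc M) - walk \<omega> M" unfolding walk.simps by (rule move_cong[OF clip_in_moves])
  finally have "int (p ^ level N) dvd (walk \<omega> (Suc M) - walk \<omega> M) + (walk \<omega> M - walk \<omega> N)"
    using step.IH by (rule dvd_add)
  moreover have "(walk \<omega> (Suc M) - walk \<omega> M) + (walk \<omega> M - walk \<omega> N) = walk \<omega> (Suc M) - walk \<omega> N" by simp
  ultimately show ?case by (simp only:)
qed simp

lemma walk_range: "walk \<omega> N \<in> {0..<int (p ^ level N)}"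
proof (cases N)
  case (Suc M)
  thus ?thesis using move_bounds[of M "walk \<omega> M" "clip M (\<omega> M)"] by simp
qed simp

lemma numerator_bounds:
  assumes "z \<in> moves N"
  shows "0 \<le> numerator N c z" "numerator N c z \<le> int (p ^ expo N)"
proof -
  obtain q v w where z: "z = (q, v, w)" by (cases z) auto
  let ?m = "int (p ^ level N)"
  have vw: "v < width N" "w < width N" using assms by (auto simp: moves_def z)
  have m: "?m > 0" using p_ge_2 by simp
  have r: "0 \<le> (c * int q) mod ?m" "(c * int q) mod ?m < ?m" using m by auto
  have eq: "numerator N c z = (c * int q) mod ?m + ?m * int (v + w)" by (simp add: numerator_def z)
  show "0 \<le> numerator N c z" unfolding eq using r(1) by (intro add_nonneg_nonneg) auto
  have "numerator N c z \<le> ?m * 1 + ?m * int (v + w)" unfolding eq using r(2) by simp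
  also have "\<dots> = ?m * int (1 + v + w)" by (simp add: algebra_simps)
  also have "\<dots> \<le> ?m * int (2 * width N)" using vw by (intro mult_left_mono) auto
  also have "\<dots> = 2 * int (p ^ level N * width N)" by simp
  also have "\<dots> = 2 * int (p ^ (expo N - 1))" by (simp only: width_times_power)
  also have "\<dots> \<le> int p * int (p ^ (expo N - 1))" using p_ge_2 by (intro mult_right_mono) auto
  also have "\<dots> = int (p ^ Suc (expo N - 1))" by simp
  also have "Suc (expo N - 1) = expo N" using expo_ge(1)[of N] by simp
  finally show "numerator N c z \<le> int (p ^ expo N)" .
qed

section \<open>The Fourier average over a single stage\<close>

text \<open>With \<open>c'\<close> standing for \<open>a / q\<close>, the congruence
  \<open>x * q \<equiv> numerator\<close> becomes \<open>a * x \<equiv> c' * numerator\<close>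
  modulo \<open>p ^ n\<close>. The numerator is affine in \<open>v + w\<close>, so the phase
  factors; the multiplier \<open>p ^ level N\<close> of \<open>v + w\<close> lowers the denominator
  to \<open>p ^ (n - level N)\<close>.\<close>

lemma cis_move:
  assumes z: "(q, v, w) \<in> moves N" and n: "level N < n" "n \<le> level (Suc N)"
    and c': "int (p ^ n) dvd c' * int q - a"
  shows "cis (2 * pi * of_int (a * move N c (q, v, w)) / of_nat (p ^ n)) =
    cis (2 * pi * of_int (c' * ((c * int q) mod int (p ^ level N))) / of_nat (p ^ n)) *
    (cis (2 * pi * (real_of_int c' / real (p ^ (n - level N))) * real v) *
     cis (2 * pi * (real_of_int c' / real (p ^ (n - level N))) * real w))"
proof -
  let ?s = "(c * int q) mod int (p ^ level N)" and ?x = "move N c (q, v, w)"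
  let ?P = "real (p ^ level N)" and ?R = "real (p ^ (n - level N))"
  have p0: "p > 0" "real p > 0" using p_ge_2 by auto
  have "int (p ^ n) dvd int (p ^ level (Suc N))" using n(2) by (simp add: le_imp_power_dvd)
  hence "int (p ^ n) dvd ?x * int q - numerator N c (q, v, w)"
    using move_times[OF z, of c] by (metis dvd_trans fst_conv)
  hence h1: "int (p ^ n) dvd (?x * int q - numerator N c (q, v, w)) * c'" by (rule dvd_mult2)
  have h2: "int (p ^ n) dvd (c' * int q - a) * ?x" using c' by (rule dvd_mult2)
  have "int (p ^ n) dvd (?x * int q - numerator N c (q, v, w)) * c' - (c' * int q - a) * ?x"
    by (rule dvd_diff[OF h1 h2])
  also have "(?x * int q - numerator N c (q, v, w)) * c' - (c' * int q - a) * ?x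
      = a * ?x - c' * numerator N c (q, v, w)" by (simp add: algebra_simps)
  finally have "cis (2 * pi * of_int (a * ?x) / of_nat (p ^ n)) = cis (2 * pi * of_int (c' * numerator N c (q, v, w)) / of_nat (p ^ n))"
    by (rule cis_2pi_cong) (use p0 in simp)
  also have "2 * pi * of_int (c' * numerator N c (q, v, w)) / of_nat (p ^ n)
     = 2 * pi * of_int (c' * ?s) / of_nat (p ^ n) +
        (2 * pi * (real_of_int c' / real (p ^ (n - level N))) * real v +
         2 * pi * (real_of_int c' / real (p ^ (n - level N))) * real w)"
  proof -
    have pn: "real (p ^ n) = ?P * ?R" using n by (simp flip: power_add)
    have num: "real_of_int (c' * numerator N c (q, v, w)) = real_of_int c' * (real_of_int ?s + ?P * (real v + real w))"
      by (simp add: numerator_def)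
    have "2 * pi * (d * (t + P * (x + y))) / (P * R) = 2 * pi * (d * t) / (P * R) + (2 * pi * (d / R) * x + 2 * pi * (d / R) * y)"
      if "P \<noteq> 0" "R \<noteq> 0" for d t P R x y :: real
      using that by (simp add: field_simps)
    thus ?thesis unfolding num pn unfolding of_int_mult using p0 by simp
  qed
  finally show ?thesis by (simp only: cis_mult)
qed

definition char_sum :: "nat \<Rightarrow> nat \<Rightarrow> int \<Rightarrow> complex" where
  "char_sum N n c' = (\<Sum>v<width N. cis (2 * pi * (real_of_int c' / real (p ^ (n - level N))) * real v))"

text \<open>The forced part of the numerator is a phase of modulus 1, and \<open>v\<close> and
  \<open>w\<close> contribute the same sum twice: hence the square, and a bound without
  \<open>c\<close>.\<close>

lemma norm_sum_moves_le:
  assumes n: "level N < n" "n \<le> level (Suc N)"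
    and c': "\<And>q. q \<in> large_primes p (expo N) \<Longrightarrow> int (p ^ n) dvd c' q * int q - a"
  shows "cmod (\<Sum>z\<in>moves N. cis (2 * pi * of_int (a * move N c z) / of_nat (p ^ n))) / real (card (moves N))
    \<le> (\<Sum>q\<in>large_primes p (expo N). (cmod (char_sum N n (c' q)) / real (width N))\<^sup>2) / real (card (large_primes p (expo N)))"
proof -
  let ?Q = "large_primes p (expo N)" and ?V = "width N"
  let ?e = "\<lambda>q v. cis (2 * pi * (real_of_int (c' q) / real (p ^ (n - level N))) * real v)"
  let ?u = "\<lambda>q. cis (2 * pi * of_int (c' q * ((c * int q) mod int (p ^ level N))) / of_nat (p ^ n))"
  have "(\<Sum>z\<in>moves N. cis (2 * pi * of_int (a * move N c z) / of_nat (p ^ n)))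
     = (\<Sum>q\<in>?Q. \<Sum>x\<in>{..<?V} \<times> {..<?V}. cis (2 * pi * of_int (a * move N c (q, x)) / of_nat (p ^ n)))"
    unfolding moves_def by (simp add: sum.cartesian_product)
  also have "\<dots> = (\<Sum>q\<in>?Q. ?u q * (char_sum N n (c' q) * char_sum N n (c' q)))"
  proof (rule sum.cong)
    fix q assume q: "q \<in> ?Q"
    have "(\<Sum>x\<in>{..<?V} \<times> {..<?V}. cis (2 * pi * of_int (a * move N c (q, x)) / of_nat (p ^ n)))
       = (\<Sum>x\<in>{..<?V} \<times> {..<?V}. ?u q * (?e q (fst x) * ?e q (snd x)))"
    proof (rule sum.cong)
      fix x assume "x \<in> {..<?V} \<times> {..<?V}"
      then obtain v w where x: "x = (v, w)" "v < ?V" "w < ?V" by auto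
      hence "(q, v, w) \<in> moves N" using q by (simp add: moves_def)
      from cis_move[OF this n c'[OF q], of c]
      show "cis (2 * pi * of_int (a * move N c (q, x)) / of_nat (p ^ n)) = ?u q * (?e q (fst x) * ?e q (snd x))"
        by (simp only: x fst_conv snd_conv)
    qed simp
    also have "\<dots> = ?u q * (\<Sum>x\<in>{..<?V} \<times> {..<?V}. ?e q (fst x) * ?e q (snd x))"
      by (rule sum_distrib_left[symmetric])
    also have "(\<Sum>x\<in>{..<?V} \<times> {..<?V}. ?e q (fst x) * ?e q (snd x)) = char_sum N n (c' q) * char_sum N n (c' q)"
      unfolding char_sum_def sum_product by (simp add: sum.cartesian_product case_prod_beta)
    finally show "(\<Sum>x\<in>{..<?V} \<times> {..<?V}. cis (2 * pi * of_int (a * move N c (q, x)) / of_nat (p ^ n)))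
       = ?u q * (char_sum N n (c' q) * char_sum N n (c' q))" .
  qed simp
  finally have "cmod (\<Sum>z\<in>moves N. cis (2 * pi * of_int (a * move N c z) / of_nat (p ^ n)))
     \<le> (\<Sum>q\<in>?Q. cmod (?u q * (char_sum N n (c' q) * char_sum N n (c' q))))"
    by (simp only: norm_sum)
  also have "\<dots> = (\<Sum>q\<in>?Q. (cmod (char_sum N n (c' q)))\<^sup>2)"
    by (simp add: norm_mult power2_eq_square)
  finally have le: "cmod (\<Sum>z\<in>moves N. cis (2 * pi * of_int (a * move N c z) / of_nat (p ^ n)))
     \<le> (\<Sum>q\<in>?Q. (cmod (char_sum N n (c' q)))\<^sup>2)" .
  have "real (card (moves N)) = real (card ?Q) * (real ?V)\<^sup>2"
    by (simp add: moves_def card_cartesian_product power2_eq_square)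
  hence "cmod (\<Sum>z\<in>moves N. cis (2 * pi * of_int (a * move N c z) / of_nat (p ^ n))) / real (card (moves N))
     \<le> (\<Sum>q\<in>?Q. (cmod (char_sum N n (c' q)))\<^sup>2) / (real (card ?Q) * (real ?V)\<^sup>2)"
    using le by (simp add: divide_right_mono)
  also have "\<dots> = (\<Sum>q\<in>?Q. (cmod (char_sum N n (c' q)) / real ?V)\<^sup>2) / real (card ?Q)"
    by (simp add: power_divide sum_divide_distrib mult.commute)
  finally show ?thesis .
qed

text \<open>At frequencies with \<open>n < expo N\<close> the number \<open>width N\<close> of terms is a multiple of the period.\<close>
lemma char_sum_eq_0:
  assumes n: "level N < n" "n < expo N" and c': "\<not> int p dvd c'"
  shows "char_sum N n c' = 0"
proof -
  let ?R = "p ^ (n - level N)"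
  define w where "w = cis (2 * pi * of_int c' / of_nat ?R)"
  have R: "?R > 0" using p_ge_2 by simp
  have "?R dvd width N" unfolding width_def using n by (intro le_imp_power_dvd) auto
  hence dvd: "int ?R dvd c' * int (width N) - 0" by (simp add: int_dvd_int_iff del: of_nat_power)
  have "w ^ width N = cis (2 * pi * of_int (c' * int (width N)) / of_nat ?R)"
    unfolding w_def Complex.DeMoivre by (simp add: mult_ac)
  also have "\<dots> = 1" by (subst cis_2pi_cong[OF dvd R]) simp
  finally have "w ^ width N = 1" .
  moreover have "w \<noteq> 1"
  proof
    assume "w = 1"
    hence "int ?R dvd c'" unfolding w_def using cis_2pi_eq_1_imp_dvd R by blast
    moreover have "int p dvd int ?R" using n by (simp add: dvd_power)
    ultimately show False using c' dvd_trans by blast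
  qed
  moreover have "char_sum N n c' = (\<Sum>v<width N. w ^ v)"
    unfolding char_sum_def w_def Complex.DeMoivre by (simp add: mult_ac)
  ultimately show ?thesis by (simp add: sum_gp_strict)
qed

text \<open>Uniformity in the residue \<open>c\<close> reached so far is what lets the bound survive
  the average over the past.\<close>

lemma average_moves_le:
  assumes n: "level N < n" "n \<le> level (Suc N)" and a: "\<not> int p dvd a"
  shows "cmod (\<Sum>z\<in>moves N. cis (2 * pi * of_int (a * move N c z) / of_nat (p ^ n))) / real (card (moves N))
    \<le> (if n < expo N then 0 else 40 * real n / real (expo N) * real p ^ (level N + 1) / real (card (large_primes p (expo N))))"
proof -
  let ?Q = "large_primes p (expo N)"
  have cop: "coprime q p" if "q \<in> ?Q" for q
    using moves_coprime[of "(q, 0, 0)" N] that width_pos by (simp add: moves_def)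
  have "\<forall>q\<in>?Q. \<exists>c'. int (p ^ n) dvd c' * int q - a"
    using exists_quotient_mod_prime_power[OF cop] by metis
  then obtain c' where c': "\<And>q. q \<in> ?Q \<Longrightarrow> int (p ^ n) dvd c' q * int q - a" by metis
  note le = norm_sum_moves_le[OF n c', of c]
  show ?thesis
  proof (cases "n < expo N")
    case True
    have "char_sum N n (c' q) = 0" if q: "q \<in> ?Q" for q
    proof (rule char_sum_eq_0[OF n(1) True])
      have "int p dvd int (p ^ n)" using n by (simp add: dvd_power)
      hence "int p dvd c' q * int q - a" using c'[OF q] by (rule dvd_trans)
      hence "int p dvd a" if "int p dvd c' q"
        using dvd_diff[OF dvd_mult2[OF that, of "int q"], of "c' q * int q - a"] by simp
      thus "\<not> int p dvd c' q" using a by blast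
    qed
    thus ?thesis using le True by simp
  next
    case False
    have "(\<Sum>q\<in>?Q. (cmod (char_sum N n (c' q)) / real (width N))\<^sup>2) \<le> 40 * real n / real (expo N) * real p ^ (level N + 1)"
      unfolding char_sum_def
    proof (rule sum_primes_norm_sum_cis_le[OF p_ge_2 _ _ _ width_def a finite_large_primes])
      show "2 \<le> expo N" "level N < expo N" using expo_ge(1)[of N] by auto
      show "expo N \<le> n" using False by simp
      fix q assume q: "q \<in> ?Q"
      show "prime q \<and> p ^ (expo N div 2) \<le> q \<and> q \<le> p ^ expo N" using q by (simp add: large_primes_def)
      have "int (p ^ (n - level N)) dvd int (p ^ n)" by (simp add: le_imp_power_dvd)
      thus "int (p ^ (n - level N)) dvd c' q * int q - a" using c'[OF q] by (rule dvd_trans)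
    qed
    hence "(\<Sum>q\<in>?Q. (cmod (char_sum N n (c' q)) / real (width N))\<^sup>2) / real (card ?Q)
      \<le> 40 * real n / real (expo N) * real p ^ (level N + 1) / real (card ?Q)"
      by (intro divide_right_mono) auto
    thus ?thesis using le False by simp
  qed
qed

section \<open>Conditioning on the earlier stages\<close>

text \<open>Proved for any index set containing the first \<open>N\<close> coordinates, as it is
  applied both to the whole product and to the block of those coordinates.\<close>

lemma measurable_walk:
  assumes "{..<N} \<subseteq> I"
  shows "(\<lambda>\<omega>. walk \<omega> N) \<in> measurable (PiM I (\<lambda>N. measure_pmf (pmf_of_set (moves N)))) (count_space UNIV)"
  using assms
proof (induction N)
  case (Suc N)
  let ?M = "PiM I (\<lambda>N. measure_pmf (pmf_of_set (moves N)))"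
  have "(\<lambda>\<omega>. \<omega> N) \<in> measurable ?M (measure_pmf (pmf_of_set (moves N)))"
    using Suc.prems by (intro measurable_component_singleton) auto
  hence "(\<lambda>\<omega>. \<omega> N) \<in> measurable ?M (count_space UNIV)"
    by (simp cong: measurable_cong_sets)
  hence "(\<lambda>\<omega>. move N c (clip N (\<omega> N))) \<in> measurable ?M (count_space UNIV)" for c
    by (rule measurable_compose) simp
  moreover have "(\<lambda>\<omega>. walk \<omega> N) \<in> measurable ?M (count_space UNIV)"
    by (rule Suc.IH) (use Suc.prems in auto)
  ultimately show ?case unfolding walk.simps
    by (rule measurable_compose_countable[of "\<lambda>c \<omega>. move N c (clip N (\<omega> N))"])
qed simp

lemma walk_cong_prefix: "(\<And>i. i < N \<Longrightarrow> \<omega> i = \<omega>' i) \<Longrightarrow> walk \<omega> N = walk \<omega>' N"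
  by (induction N) auto

lemma prob_space_walk_space: "prob_space walk_space"
  unfolding walk_space_def by (intro prob_space_PiM measure_pmf.prob_space_axioms)

text \<open>The walk at time \<open>N\<close> depends only on the coordinates below
  \<open>N\<close>, and disjoint blocks of coordinates of a product measure are independent.\<close>

lemma indep_walk_coordinate:
  fixes u :: "int \<Rightarrow> complex" and g :: "nat \<times> nat \<times> nat \<Rightarrow> complex"
  shows "prob_space.indep_var walk_space borel (\<lambda>\<omega>. u (walk \<omega> N)) borel (\<lambda>\<omega>. g (\<omega> N))"
proof -
  let ?M = "\<lambda>N. measure_pmf (pmf_of_set (moves N))"
  interpret prob_space walk_space by (rule prob_space_walk_space)
  have comp: "(\<lambda>\<omega>. \<omega> i) \<in> measurable walk_space (?M i)" for i
    unfolding walk_space_def by (intro measurable_component_singleton) auto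
  have "indep_vars ?M (\<lambda>i \<omega>. \<omega> i) UNIV"
  proof (subst indep_vars_iff_distr_eq_PiM)
    have "distr walk_space (PiM UNIV ?M) (\<lambda>\<omega>. \<lambda>i\<in>UNIV. \<omega> i) = distr walk_space walk_space (\<lambda>\<omega>. \<omega>)"
      by (simp add: walk_space_def restrict_def)
    also have "\<dots> = walk_space" by (rule distr_id)
    also have "walk_space = PiM UNIV (\<lambda>i. distr walk_space (?M i) (\<lambda>\<omega>. \<omega> i))"
      unfolding walk_space_def by (subst distr_PiM_component) (auto intro: measure_pmf.prob_space_axioms)
    finally show "distr walk_space (PiM UNIV ?M) (\<lambda>\<omega>. \<lambda>i\<in>UNIV. \<omega> i) = PiM UNIV (\<lambda>i. distr walk_space (?M i) (\<lambda>\<omega>. \<omega> i))" .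
  qed (use comp in auto)
  hence "indep_var (PiM {..<N} ?M) (\<lambda>\<omega>. restrict (\<lambda>i. \<omega> i) {..<N}) (PiM {N} ?M) (\<lambda>\<omega>. restrict (\<lambda>i. \<omega> i) {N})"
    by (rule indep_var_restrict) auto
  moreover have "(\<lambda>\<omega>. u (walk \<omega> N)) \<in> borel_measurable (PiM {..<N} ?M)"
    by (rule measurable_compose[OF measurable_walk]) simp_all
  moreover have "(\<lambda>\<omega>. g (\<omega> N)) \<in> borel_measurable (PiM {N} ?M)"
    by (rule measurable_compose[OF measurable_component_singleton]) simp_all
  ultimately have "indep_var borel ((\<lambda>\<omega>. u (walk \<omega> N)) \<circ> (\<lambda>\<omega>. restrict (\<lambda>i. \<omega> i) {..<N}))
     borel ((\<lambda>\<omega>. g (\<omega> N)) \<circ> (\<lambda>\<omega>. restrict (\<lambda>i. \<omega> i) {N}))"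
    by (rule indep_var_compose)
  moreover have "((\<lambda>\<omega>. u (walk \<omega> N)) \<circ> (\<lambda>\<omega>. restrict (\<lambda>i. \<omega> i) {..<N})) = (\<lambda>\<omega>. u (walk \<omega> N))"
    by (auto simp: fun_eq_iff intro!: arg_cong[of _ _ u] walk_cong_prefix)
  moreover have "((\<lambda>\<omega>. g (\<omega> N)) \<circ> (\<lambda>\<omega>. restrict (\<lambda>i. \<omega> i) {N})) = (\<lambda>\<omega>. g (\<omega> N))"
    by (auto simp: fun_eq_iff)
  ultimately show ?thesis by simp
qed

text \<open>Conditioning on the walk at time \<open>N\<close> in elementary form: it has finitely
  many values, so the integrand is a finite sum of products of an indicator of the past and a
  function of the next coordinate.\<close>

lemma expectation_walk_le:
  fixes f :: "int \<Rightarrow> complex"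
  assumes B: "\<And>c. cmod (\<Sum>z\<in>moves N. f (move N c z)) / real (card (moves N)) \<le> B"
    and f: "\<And>c. cmod (f c) \<le> 1"
  shows "cmod (LINT \<omega>|walk_space. f (walk \<omega> (Suc N))) \<le> B"
proof -
  interpret prob_space walk_space by (rule prob_space_walk_space)
  let ?R = "{0..<int (p ^ level N)}"
  have mw: "(\<lambda>\<omega>. walk \<omega> N) \<in> measurable walk_space (count_space UNIV)"
    unfolding walk_space_def by (rule measurable_walk) simp
  have mc0: "(\<lambda>\<omega>. \<omega> N) \<in> measurable walk_space (measure_pmf (pmf_of_set (moves N)))"
    unfolding walk_space_def by (intro measurable_component_singleton) auto
  have mc: "(\<lambda>\<omega>. \<omega> N) \<in> measurable walk_space (count_space UNIV)"
    using mc0 by (simp cong: measurable_cong_sets)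
  define g where "g c z = f (move N c (clip N z))" for c z
  define ind where "ind c y = (if y = c then 1 else 0 :: complex)" for c y :: int
  have g1: "cmod (g c z) \<le> 1" for c z using f by (simp add: g_def)
  have mg: "(\<lambda>\<omega>. g c (\<omega> N)) \<in> borel_measurable walk_space" for c
    by (rule measurable_compose[OF mc]) simp
  have mi: "(\<lambda>\<omega>. ind c (walk \<omega> N)) \<in> borel_measurable walk_space" for c
    by (rule measurable_compose[OF mw]) simp
  have ig: "integrable walk_space (\<lambda>\<omega>. g c (\<omega> N))" for c
    using mg g1 by (intro integrable_const_bound[where B = 1]) auto
  have ii: "integrable walk_space (\<lambda>\<omega>. ind c (walk \<omega> N))" for c
    using mi by (intro integrable_const_bound[where B = 1]) (auto simp: ind_def)
  have indep: "indep_var borel (\<lambda>\<omega>. ind c (walk \<omega> N)) borel (\<lambda>\<omega>. g c (\<omega> N))" for c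
    by (rule indep_walk_coordinate)
  have iprod: "integrable walk_space (\<lambda>\<omega>. ind c (walk \<omega> N) * g c (\<omega> N))" for c
    by (rule indep_var_integrable[OF indep ii ig])
  have E_g: "cmod (LINT \<omega>|walk_space. g c (\<omega> N)) \<le> B" for c
  proof -
    have "(LINT \<omega>|walk_space. g c (\<omega> N)) = (LINT z|distr walk_space (measure_pmf (pmf_of_set (moves N))) (\<lambda>\<omega>. \<omega> N). g c z)"
      by (rule integral_distr[symmetric, OF mc0]) simp
    also have "distr walk_space (measure_pmf (pmf_of_set (moves N))) (\<lambda>\<omega>. \<omega> N) = measure_pmf (pmf_of_set (moves N))"
      unfolding walk_space_def by (rule distr_PiM_component) (auto intro: measure_pmf.prob_space_axioms)
    also have "(LINT z|measure_pmf (pmf_of_set (moves N)). g c z) = (\<Sum>z\<in>moves N. g c z) / real (card (moves N))"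
    proof -
      have "(LINT z|measure_pmf (pmf_of_set (moves N)). g c z) = (\<Sum>z\<in>moves N. pmf (pmf_of_set (moves N)) z *\<^sub>R g c z)"
        using finite_moves moves_nonempty by (intro integral_measure_pmf) (auto simp: set_pmf_of_set)
      also have "\<dots> = (\<Sum>z\<in>moves N. g c z / of_nat (card (moves N)))"
        using finite_moves moves_nonempty by (intro sum.cong) (auto simp: scaleR_conv_of_real)
      finally show ?thesis by (simp add: sum_divide_distrib)
    qed
    also have "(\<Sum>z\<in>moves N. g c z) = (\<Sum>z\<in>moves N. f (move N c z))"
      by (intro sum.cong) (auto simp: g_def clip_def)
    finally show ?thesis using B[of c] by (simp add: norm_divide)
  qed
  have "f (walk \<omega> (Suc N)) = (\<Sum>c\<in>?R. ind c (walk \<omega> N) * g c (\<omega> N))" for \<omega>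
  proof -
    have "(\<Sum>c\<in>?R. ind c (walk \<omega> N) * g c (\<omega> N)) = (\<Sum>c\<in>{walk \<omega> N}. ind c (walk \<omega> N) * g c (\<omega> N))"
      using walk_range[of \<omega> N] by (intro sum.mono_neutral_right) (auto simp: ind_def)
    thus ?thesis by (simp add: ind_def g_def)
  qed
  hence "(LINT \<omega>|walk_space. f (walk \<omega> (Suc N))) = (\<Sum>c\<in>?R. LINT \<omega>|walk_space. ind c (walk \<omega> N) * g c (\<omega> N))"
    by (simp add: iprod)
  also have "\<dots> = (\<Sum>c\<in>?R. (LINT \<omega>|walk_space. ind c (walk \<omega> N)) * (LINT \<omega>|walk_space. g c (\<omega> N)))"
    by (intro sum.cong refl indep_var_lebesgue_integral indep ii ig)
  finally have "cmod (LINT \<omega>|walk_space. f (walk \<omega> (Suc N)))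
     \<le> (\<Sum>c\<in>?R. cmod (LINT \<omega>|walk_space. ind c (walk \<omega> N)) * cmod (LINT \<omega>|walk_space. g c (\<omega> N)))"
    by (simp only: norm_mult[symmetric] norm_sum)
  \<comment> \<open>The law of the past enters only through the probabilities of its values, which
    add up to 1.\<close>
  also have "\<dots> \<le> (\<Sum>c\<in>?R. (LINT \<omega>|walk_space. cmod (ind c (walk \<omega> N))) * B)"
    by (intro sum_mono mult_mono integral_norm_bound E_g) auto
  also have "\<dots> = (LINT \<omega>|walk_space. (\<Sum>c\<in>?R. cmod (ind c (walk \<omega> N)))) * B"
    unfolding sum_distrib_right[symmetric] by (subst Bochner_Integration.integral_sum) (auto intro: ii)
  also have "(\<lambda>\<omega>. \<Sum>c\<in>?R. cmod (ind c (walk \<omega> N))) = (\<lambda>\<omega>. 1)"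
  proof
    fix \<omega>
    have "(\<Sum>c\<in>?R. cmod (ind c (walk \<omega> N))) = (\<Sum>c\<in>{walk \<omega> N}. cmod (ind c (walk \<omega> N)))"
      using walk_range[of \<omega> N] by (intro sum.mono_neutral_right) (auto simp: ind_def)
    thus "(\<Sum>c\<in>?R. cmod (ind c (walk \<omega> N))) = 1" by (simp add: ind_def)
  qed
  finally show ?thesis by (simp add: prob_space)
qed

end

section \<open>The limit point, its law and the decay of its Fourier transform\<close>

lemma padic_limit_of_compatible_residues:
  fixes w :: "nat \<Rightarrow> int"
  assumes w: "\<And>N N'. N \<le> N' \<Longrightarrow> int (CARD('p) ^ l N) dvd w N' - w N" and l: "\<And>N. N \<le> l N"
  obtains x :: "'p::prime_card padic" where "(\<lambda>N. of_int (w N)) \<longlonglongrightarrow> x"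
    "\<And>N. padic_abs (x - of_int (w N)) \<le> inverse (real CARD('p)) ^ l N"
proof -
  let ?q = "inverse (real CARD('p))"
  have p1: "1 < real CARD('p)" by (rule padic_p_gt_1)
  have q: "0 < ?q" "?q < 1" using p1 by (auto simp: field_simps)
  have d: "dist (of_int (w N') :: 'p padic) (of_int (w N)) \<le> ?q ^ l N" if "N \<le> N'" for N N'
  proof -
    have "padic_abs (of_int (w N' - w N) :: 'p padic) \<le> ?q ^ l N"
      using w[OF that] by (simp only: padic_abs_le_iff_dvd of_nat_power)
    thus ?thesis by (simp only: dist_padic_def of_int_diff)
  qed
  have "Cauchy (\<lambda>N. of_int (w N) :: 'p padic)"
  proof (rule metric_CauchyI)
    fix e :: real assume "e > 0"
    then obtain n where n: "?q ^ n < e" using real_arch_pow_inv[of e ?q] q by auto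
    show "\<exists>M. \<forall>m\<ge>M. \<forall>k\<ge>M. dist (of_int (w m) :: 'p padic) (of_int (w k)) < e"
    proof (intro exI[of _ n] allI impI)
      fix m k assume mk: "m \<ge> n" "k \<ge> n"
      have "padic_abs (of_int (w m) - of_int (w k) :: 'p padic) \<le> ?q ^ l n"
      proof (rule padic_abs_diff_le[of _ "of_int (w n)"])
        show "padic_abs (of_int (w m) - of_int (w n) :: 'p padic) \<le> ?q ^ l n"
          using d[OF mk(1)] by (simp only: dist_padic_def)
        show "padic_abs (of_int (w n) - of_int (w k) :: 'p padic) \<le> ?q ^ l n"
          using d[OF mk(2)] by (simp only: dist_padic_def padic_abs_diff_commute)
      qed
      also have "\<dots> \<le> ?q ^ n" using q l[of n] by (intro power_decreasing) auto
      finally show "dist (of_int (w m) :: 'p padic) (of_int (w k)) < e"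
        using n by (simp only: dist_padic_def)
    qed
  qed
  then obtain x :: "'p padic" where x: "(\<lambda>N. of_int (w N)) \<longlonglongrightarrow> x"
    by (auto simp: Cauchy_convergent_iff convergent_def)
  have "dist x (of_int (w N)) \<le> ?q ^ l N" for N
  proof (rule LIMSEQ_le_const2)
    show "(\<lambda>N'. dist (of_int (w N')) (of_int (w N) :: 'p padic)) \<longlonglongrightarrow> dist x (of_int (w N))"
      by (intro tendsto_dist x tendsto_const)
    show "\<exists>M. \<forall>N'\<ge>M. dist (of_int (w N')) (of_int (w N) :: 'p padic) \<le> ?q ^ l N"
      using d by blast
  qed
  thus thesis using that[OF x] by (simp only: dist_padic_def)
qed

lemma closed_measure_support: "closed (measure_support \<mu>)"
proof -
  have "open (- measure_support \<mu>)"
  proof (subst open_subopen, rule ballI)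
    fix x assume "x \<in> - measure_support \<mu>"
    then obtain U where "open U" "x \<in> U" "\<not> emeasure \<mu> U > 0"
      by (auto simp: measure_support_def)
    thus "\<exists>T. open T \<and> x \<in> T \<and> T \<subseteq> - measure_support \<mu>"
      by (intro exI[of _ U]) (auto simp: measure_support_def)
  qed
  thus ?thesis by (simp add: closed_def)
qed

lemma measure_support_distr_approx:
  fixes X :: "'a \<Rightarrow> 'b::metric_space"
  assumes "X \<in> borel_measurable M" "x \<in> measure_support (distr M borel X)" "e > 0"
  obtains \<omega> where "\<omega> \<in> space M" "dist x (X \<omega>) < e"
proof -
  have "emeasure (distr M borel X) (ball x e) > 0"
    using assms(2,3) by (auto simp: measure_support_def)
  also have "emeasure (distr M borel X) (ball x e) = emeasure M (X -` ball x e \<inter> space M)"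
    by (rule emeasure_distr[OF assms(1)]) simp
  finally have "X -` ball x e \<inter> space M \<noteq> {}" by auto
  thus thesis using that by auto
qed

lemma cmod_padic_char: "cmod (padic_char y) = 1"
  by (simp add: padic_char_def)

lemma cmod_padic_fourier_le_1:
  assumes "borel_prob \<mu>"
  shows "cmod (padic_fourier \<mu> (\<xi> :: 'p::prime_card padic)) \<le> 1"
proof -
  interpret prob_space \<mu> using assms by (simp add: borel_prob_def)
  have "cmod (padic_fourier \<mu> \<xi>) \<le> (LINT x|\<mu>. cmod (padic_char (x * \<xi>)))"
    unfolding padic_fourier_eq_integral_char by (rule integral_norm_bound)
  thus ?thesis by (simp add: cmod_padic_char prob_space)
qed

text \<open>The largest frequencies \<open>n\<close> of the stage with exponent \<open>k\<close> satisfy \<open>n \<le> k * \<tau> + 1\<close>, hence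
  \<open>p ^ (- k)\<close> is at most \<open>p * \<bar>\<xi>\<bar> powr (- 1 / \<tau>)\<close>.\<close>
lemma stage_decay_le:
  fixes p k n :: nat and \<tau> :: real
  assumes p: "p \<ge> 2" and \<tau>: "\<tau> > 1" and n: "n \<ge> 1" "real n \<le> real k * \<tau> + 1"
  shows "(real n)\<^sup>2 / real p ^ k \<le> real p / (ln 2)\<^sup>2 * ((real p ^ n) powr (- 1 / \<tau>) * (ln (1 + real p ^ n))\<^sup>2)"
proof -
  have p0: "real p > 0" "real p \<ge> 1" using p by auto
  have "1 / real p ^ k = real p powr (- real k)"
    using p0 by (simp add: powr_minus powr_realpow inverse_eq_divide)
  also have "\<dots> \<le> real p powr (1 + - real n / \<tau>)"
  proof (rule powr_mono)
    have "real n / \<tau> \<le> (real k * \<tau> + 1) / \<tau>" using n \<tau> by (intro divide_right_mono) auto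
    also have "\<dots> = real k + 1 / \<tau>" using \<tau> by (simp add: field_simps)
    also have "\<dots> \<le> real k + 1" using \<tau> by simp
    finally show "- real k \<le> 1 + - real n / \<tau>" by simp
  qed (use p0 in auto)
  also have "\<dots> = real p * (real p ^ n) powr (- 1 / \<tau>)"
  proof -
    have "(real p ^ n) powr (- 1 / \<tau>) = real p powr (- real n / \<tau>)"
      using p0 by (subst powr_realpow[symmetric]) (simp_all add: powr_powr)
    thus ?thesis using p0 powr_add[of "real p" 1 "- real n / \<tau>"] by simp
  qed
  finally have 1: "1 / real p ^ k \<le> real p * (real p ^ n) powr (- 1 / \<tau>)" .
  have "real n * ln 2 \<le> real n * ln (real p)" using p by (intro mult_left_mono) auto
  also have "\<dots> = ln (real p ^ n)" using p0 by (simp add: ln_realpow)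
  also have "\<dots> \<le> ln (1 + real p ^ n)" using p0 by (subst ln_le_cancel_iff) (auto intro: add_pos_pos)
  finally have "(real n * ln 2)\<^sup>2 \<le> (ln (1 + real p ^ n))\<^sup>2" by (intro power_mono) auto
  hence 2: "(real n)\<^sup>2 \<le> (ln (1 + real p ^ n))\<^sup>2 / (ln 2)\<^sup>2"
    by (simp add: power_mult_distrib field_simps)
  have "(real n)\<^sup>2 * (1 / real p ^ k) \<le> ((ln (1 + real p ^ n))\<^sup>2 / (ln 2)\<^sup>2) * (real p * (real p ^ n) powr (- 1 / \<tau>))"
    by (intro mult_mono 1 2) (use p0 in auto)
  thus ?thesis by (simp add: field_simps)
qed

context salem_walk
begin

text \<open>Both entries of the pair are at most \<open>p ^ expo N\<close>, and the stage ends at a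
  level of at least \<open>expo N * \<tau>\<close>: this is the reason for rounding up in
  \<open>level\<close>.\<close>

lemma approximation_quality:
  assumes z: "z \<in> moves N"
  shows "inverse (real p) ^ level (Suc N) \<le> real_of_int (max \<bar>int (fst z)\<bar> \<bar>numerator N c z\<bar>) powr (- \<tau>)"
proof -
  have p1: "real p > 1" using p_ge_2 by simp
  have q: "0 < fst z" "fst z \<le> p ^ expo N"
    using z by (auto simp: moves_def large_primes_def prime_gt_0_nat)
  have "int (fst z) \<le> int (p ^ expo N)" using q(2) by (simp only: of_nat_le_iff)
  hence "max \<bar>int (fst z)\<bar> \<bar>numerator N c z\<bar> \<le> int (p ^ expo N)"
    using numerator_bounds[OF z, of c] by simp
  hence "real_of_int (max \<bar>int (fst z)\<bar> \<bar>numerator N c z\<bar>) \<le> real_of_int (int (p ^ expo N))"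
    by (simp only: of_int_le_iff)
  hence H: "real_of_int (max \<bar>int (fst z)\<bar> \<bar>numerator N c z\<bar>) \<le> real p ^ expo N" by simp
  have H0: "real_of_int (max \<bar>int (fst z)\<bar> \<bar>numerator N c z\<bar>) > 0" using q(1) by simp
  have "inverse (real p) ^ level (Suc N) = real p powr (- real (level (Suc N)))"
    using p1 by (simp add: powr_minus powr_realpow power_inverse)
  also have "\<dots> \<le> real p powr (- (real (expo N) * \<tau>))"
    using p1 level_Suc_ge[of N] by (intro powr_mono) auto
  also have "\<dots> = (real p ^ expo N) powr (- \<tau>)"
    using p1 by (subst powr_realpow[symmetric]) (simp_all add: powr_powr)
  also have "\<dots> \<le> real_of_int (max \<bar>int (fst z)\<bar> \<bar>numerator N c z\<bar>) powr (- \<tau>)"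
    using H H0 \<tau> by (intro powr_mono2') auto
  finally show ?thesis .
qed

text \<open>Unbounded denominators make the approximating pairs infinitely many.\<close>

lemma moves_denominator_ge:
  assumes "z \<in> moves N"
  shows "N div 2 < fst z"
proof -
  have "N div 2 \<le> expo N div 2" using expo_ge(1)[of N] level_ge[of N] by (intro div_le_mono) linarith
  also have "\<dots> < p ^ (expo N div 2)" using p_ge_2 by (intro power_gt_expt) auto
  also have "\<dots> < fst z" using assms by (auto simp: moves_def large_primes_def)
  finally show ?thesis .
qed

text \<open>Stated for any \<open>x\<close> close to the walk rather than for its limit, so that it
  covers the whole support of the law.\<close>

lemma padic_approximation:
  fixes x :: "'p::prime_card padic"
  assumes pC: "p = CARD('p)" and x: "padic_abs (x - of_int (walk \<omega> (Suc N))) \<le> inverse (real p) ^ level (Suc N)"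
  defines "z \<equiv> clip N (\<omega> N)"
  shows "padic_abs (x * of_int (int (fst z)) - of_int (numerator N (walk \<omega> N) z))
    \<le> real_of_int (max \<bar>int (fst z)\<bar> \<bar>numerator N (walk \<omega> N) z\<bar>) powr (- \<tau>)"
proof -
  let ?q = "int (fst z)" and ?r = "numerator N (walk \<omega> N) z" and ?e = "inverse (real p) ^ level (Suc N)"
  have z: "z \<in> moves N" unfolding z_def by (rule clip_in_moves)
  have "padic_abs ((x - of_int (walk \<omega> (Suc N))) * of_int ?q) \<le> ?e * 1"
    unfolding padic_abs_mult using x rat_pabs_of_int_le_1[OF prime_card[where 'a='p], of ?q]
    by (intro mult_mono) (auto simp del: of_int_of_nat_eq)
  hence 1: "padic_abs (x * of_int ?q - of_int (walk \<omega> (Suc N) * ?q)) \<le> ?e"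
    by (simp only: left_diff_distrib of_int_mult mult_1_right)
  have "int (p ^ level (Suc N)) dvd walk \<omega> (Suc N) * ?q - ?r"
    unfolding walk.simps(2) z_def[symmetric] by (rule move_times[OF z])
  hence "padic_abs (of_int (walk \<omega> (Suc N) * ?q - ?r) :: 'p padic) \<le> ?e"
    unfolding pC by (simp only: padic_abs_le_iff_dvd of_nat_power)
  hence "padic_abs (of_int (walk \<omega> (Suc N) * ?q) - of_int ?r :: 'p padic) \<le> ?e"
    by (simp only: of_int_diff)
  with 1 have "padic_abs (x * of_int ?q - of_int ?r) \<le> ?e" by (rule padic_abs_diff_le)
  thus ?thesis using approximation_quality[OF z] by (rule order_trans)
qed

lemma expectation_char_le:
  assumes n: "n \<ge> 1" and a: "\<not> int p dvd a"
    and c: "c > 0" "\<And>k. k \<ge> K \<Longrightarrow> c * real p ^ k / real k \<le> real (card (large_primes p k))"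
  obtains N where "n \<le> level (Suc N)" "cmod (LINT \<omega>|walk_space. cis (2 * pi * of_int (a * walk \<omega> (Suc N)) / of_nat (p ^ n)))
    \<le> 40 * (real p)\<^sup>2 / (c * (ln 2)\<^sup>2) * ((real p ^ n) powr (- 1 / \<tau>) * (ln (1 + real p ^ n))\<^sup>2)"
proof -
  obtain N where N: "level N < n" "n \<le> level (Suc N)" using exists_stage[OF n] .
  let ?k = "expo N" and ?Q = "large_primes p (expo N)"
  let ?B = "40 * (real p)\<^sup>2 / (c * (ln 2)\<^sup>2) * ((real p ^ n) powr (- 1 / \<tau>) * (ln (1 + real p ^ n))\<^sup>2)"
  have p0: "real p > 0" using p_ge_2 by simp
  have B0: "0 \<le> ?B" using c(1) by (intro mult_nonneg_nonneg) auto
  have k0: "real ?k > 0" using expo_ge(1)[of N] by simp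
  have "40 * real n / real ?k * real p ^ (level N + 1) / real (card ?Q) \<le> ?B" if nk: "n \<ge> ?k"
  proof -
    have Q: "c * real p ^ ?k / real ?k \<le> real (card ?Q)" by (rule c(2)[OF expo_ge(2)])
    have pos: "0 < c * real p ^ ?k / real ?k" using c(1) p0 k0 by simp
    have "40 * real n / real ?k * real p ^ (level N + 1) / real (card ?Q)
       \<le> 40 * real n / real ?k * real p ^ (level N + 1) / (c * real p ^ ?k / real ?k)"
      using Q pos k0 p0 by (intro divide_left_mono mult_pos_pos) auto
    \<comment> \<open>The factor \<open>1 / k\<close> of the divisor count cancels against the
      density \<open>1 / k\<close> of the primes.\<close>
    also have "\<dots> = 40 * real p / c * (real n * real (p ^ level N) / real p ^ ?k)"
      using k0 c(1) p0 by (simp add: field_simps)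
    also have "\<dots> \<le> 40 * real p / c * (real n * real n / real p ^ ?k)"
    proof -
      have "p ^ level N \<le> n" using expo_ge(3)[of N] nk by linarith
      hence "real (p ^ level N) \<le> real n" by (simp only: of_nat_le_iff)
      thus ?thesis using c(1) p0 by (intro mult_left_mono divide_right_mono) auto
    qed
    also have "\<dots> = 40 * real p / c * ((real n)\<^sup>2 / real p ^ ?k)" by (simp add: power2_eq_square)
    also have "\<dots> \<le> 40 * real p / c * (real p / (ln 2)\<^sup>2 * ((real p ^ n) powr (- 1 / \<tau>) * (ln (1 + real p ^ n))\<^sup>2))"
    proof (rule mult_left_mono)
      have "real n \<le> real (level (Suc N))" using N(2) by simp
      hence "real n \<le> real ?k * \<tau> + 1" using level_Suc_less[of N] by linarith
      thus "(real n)\<^sup>2 / real p ^ ?k \<le> real p / (ln 2)\<^sup>2 * ((real p ^ n) powr (- 1 / \<tau>) * (ln (1 + real p ^ n))\<^sup>2)"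
        by (intro stage_decay_le p_ge_2 \<tau> n)
    qed (use c(1) in auto)
    also have "\<dots> = ?B" by (simp add: power2_eq_square field_simps)
    finally show ?thesis .
  qed
  hence "(if n < ?k then 0 else 40 * real n / real ?k * real p ^ (level N + 1) / real (card ?Q)) \<le> ?B"
    using B0 by auto
  hence "cmod (\<Sum>z\<in>moves N. cis (2 * pi * of_int (a * move N d z) / of_nat (p ^ n))) / real (card (moves N)) \<le> ?B" for d
    using average_moves_le[OF N a, of d] by (rule order_trans[rotated])
  hence "cmod (LINT \<omega>|walk_space. cis (2 * pi * of_int (a * walk \<omega> (Suc N)) / of_nat (p ^ n))) \<le> ?B"
    by (intro expectation_walk_le[where f = "\<lambda>y. cis (2 * pi * of_int (a * y) / of_nat (p ^ n))"]) auto
  with N(2) show thesis by (rule that)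
qed

end

lemma exists_salem_measure:
  obtains C :: real where "C > 0" "\<And>\<tau>. \<tau> > 1 \<Longrightarrow> \<exists>\<mu>. borel_prob \<mu> \<and> compact (measure_support \<mu>) \<and>
     measure_support \<mu> \<subseteq> (well_approximable \<tau> :: 'p::prime_card padic set) \<and>
     (\<forall>\<xi>. 1 \<le> padic_abs \<xi> \<longrightarrow>
       cmod (padic_fourier \<mu> \<xi>) \<le> C * (padic_abs \<xi> powr (- 1 / \<tau>) * (ln (1 + padic_abs \<xi>))\<^sup>2))"
proof -
  define p where "p = CARD('p)"
  have p: "prime p" unfolding p_def by (rule prime_card)
  have p2: "p \<ge> 2" using p by (rule prime_ge_2_nat)
  have p1: "real p > 1" using p2 by simp
  obtain c K where c: "c > 0" and K: "K \<ge> 2"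
    and cK: "\<And>k. k \<ge> K \<Longrightarrow> c * real p ^ k / real k \<le> real (card (large_primes p k))"
    using card_large_primes_ge[OF p2] by blast
  \<comment> \<open>Fixed before \<open>\<tau>\<close>, from \<open>p\<close> and the prime count
    alone. The second summand serves \<open>padic_abs \<xi> = 1\<close>, where the trivial bound 1
    faces \<open>(ln 2)\<^sup>2\<close>.\<close>
  define C where "C = 40 * (real p)\<^sup>2 / (c * (ln 2)\<^sup>2) + 1 / (ln 2)\<^sup>2"
  have C1: "40 * (real p)\<^sup>2 / (c * (ln 2)\<^sup>2) \<le> C" and C2: "1 / (ln 2)\<^sup>2 \<le> C" and C0: "C > 0"
    using c by (auto simp: C_def intro!: add_nonneg_pos)
  show thesis
  proof (rule that[OF C0])
    fix \<tau> :: real assume \<tau>: "\<tau> > 1"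
    interpret W: salem_walk p K \<tau>
    proof
      fix k assume "k \<ge> K"
      hence "0 < real (card (large_primes p k))"
        using cK[of k] c p1 K by (intro less_le_trans[OF _ cK]) auto
      thus "large_primes p k \<noteq> {}" by auto
    qed (use p \<tau> K in auto)
    interpret W_space: prob_space W.walk_space by (rule W.prob_space_walk_space)
    let ?q = "inverse (real p)"
    have "\<exists>x :: 'p padic. (\<lambda>N. of_int (W.walk \<omega> N)) \<longlonglongrightarrow> x \<and> (\<forall>N. padic_abs (x - of_int (W.walk \<omega> N)) \<le> ?q ^ W.level N)" for \<omega>
    proof -
      obtain x :: "'p padic" where "(\<lambda>N. of_int (W.walk \<omega> N)) \<longlonglongrightarrow> x"
        "\<And>N. padic_abs (x - of_int (W.walk \<omega> N)) \<le> inverse (real CARD('p)) ^ W.level N"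
        by (rule padic_limit_of_compatible_residues[of W.level "W.walk \<omega>"])
          (use W.walk_cong W.level_ge in \<open>auto simp only: p_def\<close>)
      thus ?thesis unfolding p_def by blast
    qed
    then obtain X :: "(nat \<Rightarrow> nat \<times> nat \<times> nat) \<Rightarrow> 'p padic" where
      X_lim: "\<And>\<omega>. (\<lambda>N. of_int (W.walk \<omega> N)) \<longlonglongrightarrow> X \<omega>"
      and X: "\<And>\<omega> N. padic_abs (X \<omega> - of_int (W.walk \<omega> N)) \<le> ?q ^ W.level N"
      by metis
    have X_int: "padic_abs (X \<omega>) \<le> 1" for \<omega> using X[of \<omega> 0] by simp
    have X_meas: "X \<in> borel_measurable W.walk_space"
    proof (rule borel_measurable_LIMSEQ_metric)
      fix N
      have "(\<lambda>\<omega>. W.walk \<omega> N) \<in> measurable W.walk_space (count_space UNIV)"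
        unfolding W.walk_space_def by (rule W.measurable_walk) simp
      thus "(\<lambda>\<omega>. of_int (W.walk \<omega> N)) \<in> borel_measurable W.walk_space"
        by (rule measurable_compose) simp
    qed (rule X_lim)
    define \<mu> where "\<mu> = distr W.walk_space borel X"
    have \<mu>: "borel_prob \<mu>"
      unfolding borel_prob_def \<mu>_def using W_space.prob_space_distr[OF X_meas] by simp
    have approx: "\<exists>\<omega>. padic_abs (x - X \<omega>) \<le> ?q ^ n" if "x \<in> measure_support \<mu>" for x n
    proof -
      have "?q ^ n > 0" using p1 by simp
      then obtain \<omega> where "dist x (X \<omega>) < ?q ^ n"
        using measure_support_distr_approx[OF X_meas, of x "?q ^ n"] \<open>x \<in> measure_support \<mu>\<close> unfolding \<mu>_def by blast
      thus ?thesis by (auto simp: dist_padic_def intro: less_imp_le)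
    qed
    have supp_int: "padic_abs x \<le> 1" if x: "x \<in> measure_support \<mu>" for x
    proof -
      obtain \<omega> where "padic_abs (x - X \<omega>) \<le> 1" using approx[OF x, of 0] by auto
      thus ?thesis using padic_abs_diff_le[of x "X \<omega>" 1 0] X_int[of \<omega>] by simp
    qed
    have supp: "measure_support \<mu> \<subseteq> well_approximable \<tau>"
    proof
      fix x assume x: "x \<in> measure_support \<mu>"
      let ?G = "{(q :: int, r :: int). padic_abs (x * of_int q - of_int r) \<le> real_of_int (max \<bar>q\<bar> \<bar>r\<bar>) powr (- \<tau>)}"
      \<comment> \<open>The outcome may change with \<open>N\<close>: a support point need not be a
        value of \<open>X\<close>, but it agrees with some value to the precision that stage
        \<open>N\<close> requires.\<close>
      have large: "\<exists>q r. (q, r) \<in> ?G \<and> int (N div 2) < q" for N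
      proof -
        obtain \<omega> where \<omega>: "padic_abs (x - X \<omega>) \<le> ?q ^ W.level (Suc N)" using approx[OF x] by blast
        have "padic_abs (x - of_int (W.walk \<omega> (Suc N))) \<le> ?q ^ W.level (Suc N)"
          using \<omega> X by (rule padic_abs_diff_le)
        from W.padic_approximation[OF p_def this] W.moves_denominator_ge[OF W.clip_in_moves[of N "\<omega> N"]]
        show ?thesis
          by (intro exI[of _ "int (fst (W.clip N (\<omega> N)))"]
              exI[of _ "W.numerator N (W.walk \<omega> N) (W.clip N (\<omega> N))"]) simp
      qed
      have "infinite ?G"
      proof
        assume "finite ?G"
        hence "finite ((\<lambda>z. nat (fst z)) ` ?G)" by simp
        then obtain B where B: "\<forall>m\<in>(\<lambda>z. nat (fst z)) ` ?G. m \<le> B"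
          using finite_nat_set_iff_bounded_le by blast
        obtain q r where qr: "(q, r) \<in> ?G" "int ((2 * B) div 2) < q" using large[of "2 * B"] by blast
        have "nat (fst (q, r)) \<le> B" using B qr(1) by blast
        thus False using qr(2) by simp
      qed
      thus "x \<in> well_approximable \<tau>" using supp_int[OF x] by (simp add: well_approximable_def)
    qed
    have comp: "compact (measure_support \<mu>)"
    proof (rule compact_Int_closed[of "{x. padic_abs x \<le> 1}" "measure_support \<mu>", THEN subst[of _ _ compact, rotated]])
      show "{x. padic_abs x \<le> 1} \<inter> measure_support \<mu> = measure_support \<mu>" using supp_int by auto
    qed (rule compact_padic_integers closed_measure_support)+
    have decay: "cmod (padic_fourier \<mu> \<xi>) \<le> C * (padic_abs \<xi> powr (- 1 / \<tau>) * (ln (1 + padic_abs \<xi>))\<^sup>2)"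
      if \<xi>: "1 \<le> padic_abs \<xi>" for \<xi>
    proof (cases "padic_abs \<xi> = 1")
      case True
      have "cmod (padic_fourier \<mu> \<xi>) \<le> 1" by (rule cmod_padic_fourier_le_1[OF \<mu>])
      also have "1 = 1 / (ln 2)\<^sup>2 * (ln 2 :: real)\<^sup>2" by simp
      also have "\<dots> \<le> C * (ln 2)\<^sup>2" by (intro mult_right_mono C2) auto
      finally show ?thesis by (simp add: True)
    next
      case False
      hence "1 < padic_abs \<xi>" using \<xi> by simp
      then obtain n a where n: "n \<ge> 1" "padic_abs \<xi> = real p ^ n" and a: "\<not> int p dvd a"
        and \<xi>a: "padic_abs (\<xi> - of_int a / of_nat p ^ n) \<le> 1"
        unfolding p_def by (rule padic_frequency_representation)
      obtain N where N: "n \<le> W.level (Suc N)"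
        "cmod (LINT \<omega>|W.walk_space. cis (2 * pi * of_int (a * W.walk \<omega> (Suc N)) / of_nat (p ^ n)))
         \<le> 40 * (real p)\<^sup>2 / (c * (ln 2)\<^sup>2) * ((real p ^ n) powr (- 1 / \<tau>) * (ln (1 + real p ^ n))\<^sup>2)"
        using W.expectation_char_le[OF n(1) a c cK] by blast
      have "padic_fourier \<mu> \<xi> = (LINT \<omega>|W.walk_space. padic_char (X \<omega> * \<xi>))"
        unfolding padic_fourier_eq_integral_char \<mu>_def
        by (rule integral_distr[OF X_meas borel_measurable_padic_char])
      \<comment> \<open>As \<open>n \<le> level (Suc N)\<close>, the character cannot tell the limit
        from the walk at \<open>Suc N\<close>.\<close>
      also have "\<dots> = (LINT \<omega>|W.walk_space. cis (2 * pi * of_int (a * W.walk \<omega> (Suc N)) / of_nat (p ^ n)))"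
      proof (rule Bochner_Integration.integral_cong[OF refl])
        fix \<omega>
        have "?q ^ W.level (Suc N) \<le> ?q ^ n" using p1 N(1) by (intro power_decreasing) (auto simp: field_simps)
        hence "padic_abs (X \<omega> - of_int (W.walk \<omega> (Suc N))) \<le> ?q ^ n" using X[of \<omega> "Suc N"] by linarith
        thus "padic_char (X \<omega> * \<xi>) = cis (2 * pi * of_int (a * W.walk \<omega> (Suc N)) / of_nat (p ^ n))"
          using X_int[of \<omega>] \<xi>a unfolding p_def by (rule padic_char_mult_eq_cis)
      qed
      finally have "cmod (padic_fourier \<mu> \<xi>)
         \<le> 40 * (real p)\<^sup>2 / (c * (ln 2)\<^sup>2) * ((real p ^ n) powr (- 1 / \<tau>) * (ln (1 + real p ^ n))\<^sup>2)"
        using N(2) by simp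
      also have "\<dots> \<le> C * ((real p ^ n) powr (- 1 / \<tau>) * (ln (1 + real p ^ n))\<^sup>2)"
        by (intro mult_right_mono C1) auto
      finally show ?thesis by (simp only: n(2))
    qed
    show "\<exists>\<mu>. borel_prob \<mu> \<and> compact (measure_support \<mu>) \<and> measure_support \<mu> \<subseteq> (well_approximable \<tau> :: 'p padic set) \<and>
     (\<forall>\<xi>. 1 \<le> padic_abs \<xi> \<longrightarrow> cmod (padic_fourier \<mu> \<xi>) \<le> C * (padic_abs \<xi> powr (- 1 / \<tau>) * (ln (1 + padic_abs \<xi>))\<^sup>2))"
      using \<mu> comp supp decay by blast
  qed
qed

section \<open>From decay to dimension\<close>

text \<open>Squaring produces four logarithms; each is bounded by a power with exponent a quarter of
  \<open>\<gamma> - \<beta>\<close>, so together they use up exactly the spare decay.\<close>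

lemma ln_decay_bounded:
  fixes \<beta> \<gamma> t :: real
  assumes "\<beta> < \<gamma>" "1 \<le> t"
  shows "(t powr (- \<gamma> / 2) * (ln (1 + t))\<^sup>2)\<^sup>2 * t powr \<beta> \<le> 2 powr (\<gamma> - \<beta>) * (4 / (\<gamma> - \<beta>)) ^ 4"
proof -
  define \<delta> where "\<delta> = \<gamma> - \<beta>"
  have \<delta>: "\<delta> > 0" using assms by (simp add: \<delta>_def)
  have "ln (1 + t) \<le> (1 + t) powr (\<delta> / 4) / (\<delta> / 4)"
    using assms \<delta> by (intro ln_powr_bound) auto
  also have "\<dots> \<le> (2 * t) powr (\<delta> / 4) / (\<delta> / 4)"
    using assms \<delta> by (intro divide_right_mono powr_mono2) auto
  finally have "(ln (1 + t)) ^ 4 \<le> ((2 * t) powr (\<delta> / 4) / (\<delta> / 4)) ^ 4"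
    using assms by (intro power_mono) auto
  also have "\<dots> = (2 * t) powr \<delta> * (4 / \<delta>) ^ 4"
    using assms by (simp add: power_divide powr_power)
  finally have L: "(ln (1 + t)) ^ 4 \<le> 2 powr \<delta> * t powr \<delta> * (4 / \<delta>) ^ 4"
    using assms by (simp add: powr_mult)
  have "(t powr (- \<gamma> / 2) * (ln (1 + t))\<^sup>2)\<^sup>2 * t powr \<beta> = (t powr (- \<delta>)) * (ln (1 + t)) ^ 4"
  proof -
    have "(t powr (- \<gamma> / 2))\<^sup>2 = t powr (- \<gamma>)" using assms by (simp add: powr_power)
    moreover have "t powr (- \<gamma>) * t powr \<beta> = t powr (- \<delta>)" by (simp add: \<delta>_def flip: powr_add)
    ultimately show ?thesis by (simp add: power_mult_distrib mult_ac flip: power_mult)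
  qed
  also have "\<dots> \<le> t powr (- \<delta>) * (2 powr \<delta> * t powr \<delta> * (4 / \<delta>) ^ 4)"
    by (intro mult_left_mono L) auto
  also have "\<dots> = 2 powr \<delta> * (4 / \<delta>) ^ 4"
    using assms by (simp add: powr_minus field_simps)
  finally show ?thesis by (simp only: \<delta>_def)
qed

text \<open>The logarithms cost an arbitrarily small exponent, which the supremum in
  \<open>fourier_dim\<close> does not notice. Below absolute value 1 the trivial bound for the
  transform is enough since \<open>\<beta> \<ge> 0\<close>.\<close>

lemma fourier_dim_ge:
  fixes \<mu> :: "'p::prime_card padic measure"
  assumes \<mu>: "borel_prob \<mu>" "compact (measure_support \<mu>)" "measure_support \<mu> \<subseteq> A"
    and \<gamma>: "0 < \<gamma>" "\<gamma> \<le> 1" and C: "C \<ge> 0"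
    and decay: "\<And>\<xi>. 1 \<le> padic_abs \<xi> \<Longrightarrow>
       cmod (padic_fourier \<mu> \<xi>) \<le> C * (padic_abs \<xi> powr (- \<gamma> / 2) * (ln (1 + padic_abs \<xi>))\<^sup>2)"
  shows "ennreal \<gamma> \<le> fourier_dim A"
proof (rule dense_le)
  fix y assume "y < ennreal \<gamma>"
  then obtain \<beta> where \<beta>: "y = ennreal \<beta>" "0 \<le> \<beta>" "\<beta> < \<gamma>"
    by (cases y) (auto simp: ennreal_less_iff)
  define M where "M = max 1 (C\<^sup>2 * (2 powr (\<gamma> - \<beta>) * (4 / (\<gamma> - \<beta>)) ^ 4))"
  have "(cmod (padic_fourier \<mu> \<xi>))\<^sup>2 * padic_abs \<xi> powr \<beta> \<le> M" for \<xi>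
  proof (cases "1 \<le> padic_abs \<xi>")
    case True
    let ?t = "padic_abs \<xi>"
    have "(cmod (padic_fourier \<mu> \<xi>))\<^sup>2 * ?t powr \<beta> \<le> (C * (?t powr (- \<gamma> / 2) * (ln (1 + ?t))\<^sup>2))\<^sup>2 * ?t powr \<beta>"
      using decay[OF True] by (intro mult_right_mono power_mono) auto
    also have "\<dots> = C\<^sup>2 * ((?t powr (- \<gamma> / 2) * (ln (1 + ?t))\<^sup>2)\<^sup>2 * ?t powr \<beta>)"
      by (simp only: power_mult_distrib mult.assoc)
    also have "\<dots> \<le> C\<^sup>2 * (2 powr (\<gamma> - \<beta>) * (4 / (\<gamma> - \<beta>)) ^ 4)"
      using \<beta> True by (intro mult_left_mono ln_decay_bounded) auto
    finally show ?thesis by (simp add: M_def)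
  next
    case False
    have "(cmod (padic_fourier \<mu> \<xi>))\<^sup>2 * padic_abs \<xi> powr \<beta> \<le> 1\<^sup>2 * 1 powr \<beta>"
      using False \<beta> by (intro mult_mono power_mono powr_mono2 cmod_padic_fourier_le_1[OF \<mu>(1)]) auto
    thus ?thesis by (simp add: M_def)
  qed
  hence "bdd_above ((\<lambda>\<xi>. (cmod (padic_fourier \<mu> \<xi>))\<^sup>2 * padic_abs \<xi> powr \<beta>) ` (- {0}))"
    by (intro bdd_aboveI2) auto
  thus "y \<le> fourier_dim A"
    unfolding fourier_dim_def \<beta>(1) using \<mu> \<beta> \<gamma> by (intro SUP_upper) (auto simp: compact_probs_on_def)
qed

theorem theorem1p3p1:
  shows "(\<forall>\<tau>>2. salem_set (well_approximable \<tau> :: 'p::prime_card padic set) \<and>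
           hausdorff_dim (well_approximable \<tau> :: 'p padic set) = ennreal (2 / \<tau>) \<and>
           fourier_dim (well_approximable \<tau> :: 'p padic set) = ennreal (2 / \<tau>)) \<and>
         (\<exists>C>0. \<forall>\<tau>>2. \<exists>\<mu>. borel_prob \<mu> \<and>
           measure_support \<mu> \<subseteq> (well_approximable \<tau> :: 'p padic set) \<and>
           (\<forall>\<xi>. 1 \<le> padic_abs \<xi> \<longrightarrow>
             cmod (padic_fourier \<mu> \<xi>) \<le> C * (padic_abs \<xi> powr (- 1 / \<tau>) * (ln (1 + padic_abs \<xi>))\<^sup>2)))"
proof -
  obtain C :: real where C: "C > 0"
    and ex: "\<And>\<tau>. \<tau> > 1 \<Longrightarrow> \<exists>\<mu>. borel_prob \<mu> \<and> compact (measure_support \<mu>) \<and>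
     measure_support \<mu> \<subseteq> (well_approximable \<tau> :: 'p padic set) \<and>
     (\<forall>\<xi>. 1 \<le> padic_abs \<xi> \<longrightarrow>
       cmod (padic_fourier \<mu> \<xi>) \<le> C * (padic_abs \<xi> powr (- 1 / \<tau>) * (ln (1 + padic_abs \<xi>))\<^sup>2))"
    using exists_salem_measure[where 'p = 'p] by blast
  have dims: "hausdorff_dim (well_approximable \<tau> :: 'p padic set) = ennreal (2 / \<tau>)"
    "fourier_dim (well_approximable \<tau> :: 'p padic set) = ennreal (2 / \<tau>)" if \<tau>: "\<tau> > 2" for \<tau> :: real
  proof -
    let ?W = "well_approximable \<tau> :: 'p padic set"
    obtain \<mu> where \<mu>: "borel_prob \<mu>" "compact (measure_support \<mu>)" "measure_support \<mu> \<subseteq> ?W"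
      and decay: "\<And>\<xi>. 1 \<le> padic_abs \<xi> \<Longrightarrow>
        cmod (padic_fourier \<mu> \<xi>) \<le> C * (padic_abs \<xi> powr (- 1 / \<tau>) * (ln (1 + padic_abs \<xi>))\<^sup>2)"
      using ex[of \<tau>] \<tau> by auto
    \<comment> \<open>With \<open>\<gamma> = 2 / \<tau>\<close> the exponent
      \<open>- \<gamma> / 2\<close> is \<open>- 1 / \<tau>\<close>, and \<open>\<tau> > 2\<close>
      provides \<open>\<gamma> \<le> 1\<close>. The next two inequalities close the circle.\<close>
    have "ennreal (2 / \<tau>) \<le> fourier_dim ?W"
      by (rule fourier_dim_ge[OF \<mu>, of _ C]) (use \<tau> C decay in auto)
    moreover have "fourier_dim ?W \<le> hausdorff_dim ?W"
      by (rule fourier_dim_le_hausdorff_dim) (auto simp: well_approximable_def)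
    moreover have "hausdorff_dim ?W \<le> ennreal (2 / \<tau>)"
      using \<tau> by (intro hausdorff_dim_well_approximable_le) simp
    ultimately show "hausdorff_dim ?W = ennreal (2 / \<tau>)" "fourier_dim ?W = ennreal (2 / \<tau>)" by auto
  qed
  show ?thesis
  proof (intro conjI allI impI)
    fix \<tau> :: real assume "\<tau> > 2"
    thus "salem_set (well_approximable \<tau> :: 'p padic set)"
      "hausdorff_dim (well_approximable \<tau> :: 'p padic set) = ennreal (2 / \<tau>)"
      "fourier_dim (well_approximable \<tau> :: 'p padic set) = ennreal (2 / \<tau>)"
      using dims[of \<tau>] by (simp_all add: salem_set_def)
  next
    have "\<exists>\<mu>. borel_prob \<mu> \<and> measure_support \<mu> \<subseteq> (well_approximable \<tau> :: 'p padic set) \<and>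
      (\<forall>\<xi>. 1 \<le> padic_abs \<xi> \<longrightarrow>
        cmod (padic_fourier \<mu> \<xi>) \<le> C * (padic_abs \<xi> powr (- 1 / \<tau>) * (ln (1 + padic_abs \<xi>))\<^sup>2))"
      if "\<tau> > 2" for \<tau> :: real
      using ex[of \<tau>] that by auto
    thus "\<exists>C>0. \<forall>\<tau>>2. \<exists>\<mu>. borel_prob \<mu> \<and>
           measure_support \<mu> \<subseteq> (well_approximable \<tau> :: 'p padic set) \<and>
           (\<forall>\<xi>. 1 \<le> padic_abs \<xi> \<longrightarrow>
             cmod (padic_fourier \<mu> \<xi>) \<le> C * (padic_abs \<xi> powr (- 1 / \<tau>) * (ln (1 + padic_abs \<xi>))\<^sup>2))"
      using C by blast
  qed
qed

end
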